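(* For every $r\ge 4$ and $\ell\ge 2$ there exist $K,\epsilon>0$ such that the following holds for all sufficiently large $n$ and every $t\ge K$. Given an $r$-graph $H$ with $n$ vertices and $tn^{r-1}$ edges, there exists a collection $\mathcal{C}$ of at most $$\exp\left(\frac{(\log n)^{r-1}n^{\frac{2\ell}{2\ell-1}}}{\epsilon}\right)$$ subgraphs of $H$ such that (a) every $C^r_{2\ell}$-free subgraph of $H$ is a subgraph of some $G\in\mathcal{C}$; (b) $e(G)\le\left(1-\frac{\epsilon}{(\log n)^{r-2}}\right)tn^{r-1}$ for each $G\in\mathcal{C}$.
   Context: An $r$-graph is an $r$-uniform hypergraph; $e(G)$ is the number of edges. The linear cycle $C^r_k$ ($k\ge3$) has vertices $v_1,\dots,v_{k(r-1)}$ and edges $e_i=\{v_{(i-1)(r-1)},\dots,v_{i(r-1)}\}$, $1\le i\le k$, with $v_0=v_{k(r-1)}$. $C^r_{2\ell}$-free means containing no copy of $C^r_{2\ell}$. *)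

theory Defs
  imports Complex_Main
begin

type_synonym 'a hypergraph = "'a set \<times> 'a set set"

definition verts :: "'a hypergraph \<Rightarrow> 'a set" where
  "verts G = fst G"

definition edges :: "'a hypergraph \<Rightarrow> 'a set set" where
  "edges G = snd G"

definition num_edges :: "'a hypergraph \<Rightarrow> nat" where
  "num_edges G = card (edges G)"

definition rgraph :: "nat \<Rightarrow> 'a hypergraph \<Rightarrow> bool" where
  "rgraph r G \<longleftrightarrow> finite (verts G) \<and> (\<forall>e\<in>edges G. e \<subseteq> verts G \<and> card e = r)"

definition subgraph :: "'a hypergraph \<Rightarrow> 'a hypergraph \<Rightarrow> bool" where
  "subgraph G H \<longleftrightarrow> verts G \<subseteq> verts H \<and> edges G \<subseteq> edges H \<and> (\<forall>e\<in>edges G. e \<subseteq> verts G)"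

text \<open>Copies are not required to be induced.\<close>

definition contains_copy :: "'a hypergraph \<Rightarrow> 'b hypergraph \<Rightarrow> bool" where
  "contains_copy G F \<longleftrightarrow>
     (\<exists>f. inj_on f (verts F) \<and> f ` verts F \<subseteq> verts G \<and> (\<forall>e\<in>edges F. f ` e \<in> edges G))"

text \<open>The vertex \<open>v\<^sub>j\<close> of the linear cycle is the number \<open>j\<close>; the conditional
  implements the identification of \<open>v\<^sub>0\<close> with the last vertex.\<close>

definition linear_cycle_edge :: "nat \<Rightarrow> nat \<Rightarrow> nat \<Rightarrow> nat set" where
  "linear_cycle_edge r k i =
     (\<lambda>j. if j = 0 then k * (r - 1) else j) ` {(i - 1) * (r - 1)..i * (r - 1)}"

definition linear_cycle :: "nat \<Rightarrow> nat \<Rightarrow> nat hypergraph" where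
  "linear_cycle r k = ({1..k * (r - 1)}, linear_cycle_edge r k ` {1..k})"

definition linear_cycle_free :: "nat \<Rightarrow> nat \<Rightarrow> 'a hypergraph \<Rightarrow> bool" where
  "linear_cycle_free r k G \<longleftrightarrow> \<not> contains_copy G (linear_cycle r k)"

end

theory Submission
  imports Defs "HOL-Analysis.Convex"
begin

text \<open>
  By the container lemma it suffices to find a subset of the edges of \<open>H\<close>, of proportion at least
  \<open>\<epsilon> / (log n)\<^sup>2\<close>, and a family of linear cycles on it whose \<open>j\<close>-codegrees are at most a
  constant times \<open>\<tau>\<^bsup>j-1\<^esup>\<close> times the average degree, where \<open>\<tau>\<close> is
  \<open>n\<^bsup>2l/(2l-1)\<^esup>\<close> divided by the number of edges.

  Make \<open>H\<close> \<open>r\<close>-partite. Two dyadic pigeonhole steps, on the degrees of the vertices \<open>x\<close> of the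
  first part and on the codegrees of the pairs \<open>{x, y}\<close> with \<open>y\<close> in one further part, leave a
  bipartite graph of such pairs whose codegrees agree up to a factor \<open>2\<close>. Because \<open>r - 1 \<ge> 3\<close>
  parts are available for \<open>y\<close>, one of them gives a graph of density at least of order
  \<open>n\<^bsup>-1/3\<^esup>\<close>. As the codegrees exceed a large multiple of \<open>n\<^bsup>r-3\<^esup>\<close>, a
  cycle of length \<open>2l\<close> in the graph extends to linear cycles in almost all conceivable ways, so a
  balanced family of graph cycles is enough.

  Take a maximal family of \<open>2l\<close>-cycles respecting the codegree bounds. In a random set of vertices of
  density \<open>p\<close>, the sets of edges whose codegree is saturated become rarer than edges, since \<open>j < 2l\<close>
  edges of a cycle span at least \<open>j + 1\<close> vertices. Deleting an edge from each of them leaves a graph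
  that is still dense enough to contain more \<open>2l\<close>-cycles than the family can account for. The latter
  follows by counting closed walks: after splitting vertices into clones of bounded degree, the
  degenerate walks are dominated by the closed walks of length \<open>2l - 2\<close>.
\<close>

section \<open>Containers\<close>

text \<open>The exponent \<open>2l/(2l-1)\<close> is forced by the last codegree condition:
  \<open>v\<close> edges carry of order \<open>(v/n)^(2l)\<close> cycles, and a single cycle must
  weigh at most \<open>\<tau>^(2l-1)\<close> times the average degree. For fewer edges the bound
  comes from the sampling rate \<open>p\<close>, with \<open>p^(l-1)\<close> of order
  \<open>a n^l / N^l\<close> for a graph with \<open>N\<close> edges between parts of sizes
  \<open>a\<close> and at most \<open>n\<close>. Requiring \<open>p N\<close> to be at most of order
  \<open>n^(2l/(2l-1))\<close> amounts to \<open>l/(2l-1) \<le> 2/3\<close> once the density is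
  \<open>n^(-1/3)\<close>, and this is tight at \<open>l = 2\<close>. Here \<open>r \<ge> 4\<close>
  enters: with two further parts the same argument gives only \<open>n^(-1/2)\<close>. The price of
  cloning is that a cycle of clones may visit one vertex twice. Hence closed walks are tested for
  distinctness after a projection \<pi> that is injective only on neighbourhoods, and the count of
  degenerate walks has to work with this local injectivity. Only degrees and codegrees of pairs are
  made regular, so the loss is \<open>(log n)^2\<close> for every \<open>r\<close>, and
  \<open>r - 2 \<ge> 2\<close> turns it into the stated power.\<close>

definition wdeg :: "'a set \<Rightarrow> ('a set \<Rightarrow> real) \<Rightarrow> 'a set \<Rightarrow> real" where
  "wdeg X w s = (\<Sum>e\<in>{e. e \<subseteq> X \<and> s \<subseteq> e}. w e)"

text \<open>The quotient \<open>wdeg X w {} / card X\<close> is the average degree divided by the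
  uniformity \<open>k\<close>. Weights replace families of edges because the induction adds up links
  of several vertices, in which an edge may occur repeatedly.\<close>

definition codeg_bounded :: "'a set \<Rightarrow> nat \<Rightarrow> real \<Rightarrow> real \<Rightarrow> ('a set \<Rightarrow> real) \<Rightarrow> bool" where
  "codeg_bounded X k K \<tau> w \<longleftrightarrow>
     (\<forall>e. 0 \<le> w e) \<and> (\<forall>e. w e \<noteq> 0 \<longrightarrow> e \<subseteq> X \<and> card e = k) \<and> 0 < wdeg X w {} \<and>
     (\<forall>s. s \<subseteq> X \<and> s \<noteq> {} \<longrightarrow> wdeg X w s \<le> K * \<tau> ^ (card s - 1) * wdeg X w {} / card X)"

definition container_family ::
    "'a set \<Rightarrow> ('a set \<Rightarrow> real) \<Rightarrow> real \<Rightarrow> 'a set set \<Rightarrow> bool" where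
  "container_family X w \<delta> F \<longleftrightarrow> finite F \<and>
     (\<forall>C\<in>F. C \<subseteq> X \<and> real (card C) \<le> (1 - \<delta>) * card X) \<and>
     (\<forall>I. I \<subseteq> X \<and> (\<forall>e. e \<subseteq> I \<longrightarrow> w e = 0) \<longrightarrow> (\<exists>C\<in>F. I \<subseteq> C))"

lemma finite_supersets [simp]: "finite X \<Longrightarrow> finite {e. e \<subseteq> X \<and> P e}"
  by (rule finite_subset[of _ "Pow X"]) auto

text \<open>Double counting: an edge of size \<open>k\<close> has \<open>2 ^ k\<close> subsets. The
  predicate \<open>Q\<close> will single out the saturated sets.\<close>

lemma sum_wdeg_le:
  assumes "finite X" "\<And>e. 0 \<le> w e" "\<And>e. w e \<noteq> 0 \<Longrightarrow> card e = k"
  shows "(\<Sum>s\<in>{s. s \<subseteq> X \<and> Q s}. wdeg X w s) \<le> 2 ^ k * wdeg X w {}"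
proof -
  have "(\<Sum>s\<in>{s. s \<subseteq> X \<and> Q s}. wdeg X w s)
      = (\<Sum>s\<in>{s. s \<subseteq> X \<and> Q s}. \<Sum>e\<in>Pow X. if s \<subseteq> e then w e else 0)"
    unfolding wdeg_def using assms(1) 
    by (intro sum.cong refl sum.mono_neutral_cong_left) auto
  also have "\<dots> = (\<Sum>e\<in>Pow X. \<Sum>s\<in>{s. s \<subseteq> X \<and> Q s}. if s \<subseteq> e then w e else 0)"
    by (rule sum.swap)
  also have "\<dots> \<le> (\<Sum>e\<in>Pow X. 2 ^ k * w e)"
  proof (rule sum_mono)
    fix e assume e: "e \<in> Pow X"
    then have fe: "finite e" using assms(1) finite_subset by auto
    show "(\<Sum>s\<in>{s. s \<subseteq> X \<and> Q s}. if s \<subseteq> e then w e else 0) \<le> 2 ^ k * w e"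
    proof (cases "w e = 0")
      case False
      have "(\<Sum>s\<in>{s. s \<subseteq> X \<and> Q s}. if s \<subseteq> e then w e else 0)
          = (\<Sum>s\<in>{s. s \<subseteq> X \<and> Q s} \<inter> Pow e. w e)"
        using assms(1) by (subst sum.inter_restrict) (auto intro: sum.cong)
      also have "\<dots> \<le> card (Pow e) * w e"
        using assms(2) fe by (simp add: mult_right_mono card_mono)
      also have "\<dots> = 2 ^ k * w e" using assms(3)[OF False] fe by (simp add: card_Pow)
      finally show ?thesis .
    qed (auto intro!: sum_nonpos)
  qed
  also have "\<dots> = 2 ^ k * wdeg X w {}" by (simp add: wdeg_def sum_distrib_left Pow_def)
  finally show ?thesis .
qed

lemma sum_over_union_le:
  fixes w :: "'b \<Rightarrow> real"
  assumes "finite I" "\<And>i. i \<in> I \<Longrightarrow> finite (B i)" "\<And>e. 0 \<le> w e" "S \<subseteq> (\<Union>i\<in>I. B i)"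
  shows "sum w S \<le> (\<Sum>i\<in>I. sum w (B i))"
proof -
  have "sum w S \<le> sum w (\<Union>i\<in>I. B i)"
    using assms by (intro sum_mono2) auto
  also have "\<dots> \<le> (\<Sum>i\<in>I. sum w (B i))"
    using assms(1,2)
  proof (induction I rule: finite_induct)
    case (insert i I)
    have "sum w (B i \<union> (\<Union>i\<in>I. B i)) \<le> sum w (B i) + sum w (\<Union>i\<in>I. B i)"
      using insert assms(3) by (subst sum_Un) (auto simp: sum_nonneg)
    with insert show ?case by simp
  qed simp
  finally show ?thesis .
qed

text \<open>The recursion for the leaves of a binary decision tree: rejecting a vertex lowers the
  number \<open>m\<close> of undecided vertices, accepting one lowers both \<open>m\<close> and the
  remaining budget \<open>q\<close> of acceptances.\<close>

lemma pow_split_le: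
  fixes m q B :: nat
  assumes "0 < m" "0 < q"
  shows "m ^ q * B + m ^ (q - 1) * B \<le> (m + 1) ^ q * B"
proof -
  obtain q' where q: "q = Suc q'" using assms by (cases q) auto
  have "m ^ q + m ^ q' = (m + 1) * m ^ q'" by (simp add: q)
  also have "\<dots> \<le> (m + 1) * (m + 1) ^ q'" by (intro mult_le_mono2 power_mono) auto
  finally have "m ^ q + m ^ q' \<le> (m + 1) ^ q" by (simp add: q)
  then have "(m ^ q + m ^ q') * B \<le> (m + 1) ^ q * B" by (rule mult_le_mono1)
  then show ?thesis by (simp add: q add_mult_distrib)
qed

text \<open>A state consists of the rejected vertices \<open>R\<close>, the accepted vertices \<open>P\<close> and the weight \<open>w'\<close>
  on the links of \<open>P\<close>. A vertex of large degree is either rejected or accepted; the process ends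
  when \<open>w'\<close> is heavy enough for the induction hypothesis, or when so many edges are lost that
  the complement of \<open>R\<close> is a container. Edges through a set that is saturated in \<open>w'\<close> are ignored.\<close>

lemma container_step:
  fixes X :: "'a set" and w :: "'a set \<Rightarrow> real" and K \<tau> :: real and k Q B :: nat
  defines "v \<equiv> real (card X)" and "W \<equiv> wdeg X w {}" and "c \<equiv> 1 / (2 ^ (k + 4) * K)"
  assumes X: "finite X" and K: "K \<ge> 1" and \<tau>: "0 < \<tau>" "\<tau> \<le> 1" and k: "k \<ge> 1"
    and cb: "codeg_bounded X (Suc k) K \<tau> w"
    and Q: "\<tau> * v \<le> real Q" and B: "B \<ge> 1"
    and \<delta>: "\<delta> \<le> 1 / (8 * K)"
    and IH: "\<And>w'. codeg_bounded X k (2 * K / c) \<tau> w' \<Longrightarrow>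
                \<exists>F. container_family X w' \<delta> F \<and> card F \<le> B"
  shows "\<exists>F. container_family X w \<delta> F \<and> card F \<le> (card X + 1) ^ Q * B"
proof -
  have wnn: "\<And>e. 0 \<le> w e" and wsup: "\<And>e. w e \<noteq> 0 \<Longrightarrow> e \<subseteq> X \<and> card e = Suc k"
    and Wpos: "0 < W"
    and wdg: "\<And>s. s \<subseteq> X \<Longrightarrow> s \<noteq> {} \<Longrightarrow> wdeg X w s \<le> K * \<tau> ^ (card s - 1) * W / v"
    using cb unfolding codeg_bounded_def W_def v_def by auto
  have "X \<noteq> {}"
  proof
    assume "X = {}"
    moreover have "w {} = 0" using wsup[of "{}"] by force
    ultimately show False using Wpos by (simp add: W_def wdeg_def)
  qed
  then have v: "v > 0" using X by (simp add: v_def card_gt_0_iff)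
  \<comment> \<open>The size of \<open>c\<close> is dictated by two losses: edges through accepted
    vertices are to weigh at most \<open>W / 8\<close>, edges through saturated sets at most
    \<open>W / 4\<close>.\<close>
  have c: "c > 0" using K by (simp add: c_def)
  have cK: "2 * c * K \<le> 1/8"
  proof -
    have "2 * c * K = 2 / 2 ^ (k + 4)" using K by (simp add: c_def)
    also have "\<dots> \<le> 1/8" by (simp add: power_add field_simps)
    finally show ?thesis .
  qed
  have c2: "c \<le> 1/2" "2 ^ k * c \<le> 1/4"
  proof -
    have "2 ^ k * c = 1 / (16 * K)" by (simp add: c_def power_add)
    also have "\<dots> \<le> 1/4" using K by (simp add: field_simps)
    finally show a: "2 ^ k * c \<le> 1/4" .
    have "1 * c \<le> 2 ^ k * c" using c by (intro mult_right_mono) auto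
    with a show "c \<le> 1/2" by simp
  qed
  \<comment> \<open>The codegrees of \<open>w'\<close> carry the exponent \<open>card s\<close>
    instead of \<open>card s - 1\<close> because \<open>s\<close> stems from sets
    \<open>insert u s\<close> with one more element. Each accepted vertex contributes at least
    \<open>W / (2 * v)\<close> to the total. By the last clause, a set that contains
    \<open>P\<close> and is independent for \<open>w\<close> is independent for
    \<open>w'\<close>.\<close>
  define inv where "inv R P w' \<longleftrightarrow> R \<subseteq> X \<and> P \<subseteq> X \<and> R \<inter> P = {} \<and>
      (\<forall>e. 0 \<le> w' e) \<and> (\<forall>e. w' e \<noteq> 0 \<longrightarrow> e \<subseteq> X \<and> card e = k) \<and>
      (\<forall>s. s \<subseteq> X \<and> s \<noteq> {} \<longrightarrow> wdeg X w' s \<le> 2 * K * \<tau> ^ card s * W / v) \<and>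
      card P * W / (2 * v) \<le> wdeg X w' {} \<and>
      (\<forall>f. w' f \<noteq> 0 \<longrightarrow> (\<exists>u\<in>P. w (insert u f) \<noteq> 0))" for R P and w' :: "'a set \<Rightarrow> real"
  \<comment> \<open>Induction on the number \<open>m\<close> of undecided vertices; the exponent
    \<open>Q - card P\<close> is the number of acceptances still possible.\<close>
  have main: "\<exists>F. finite F \<and> (\<forall>C\<in>F. C \<subseteq> X \<and> real (card C) \<le> (1 - \<delta>) * card X) \<and>
       (\<forall>I. I \<subseteq> X \<and> (\<forall>e. e \<subseteq> I \<longrightarrow> w e = 0) \<and> P \<subseteq> I \<and> R \<inter> I = {} \<longrightarrow> (\<exists>C\<in>F. I \<subseteq> C)) \<and>
       card F \<le> (m + 1) ^ (Q - card P) * B"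
    if "inv R P w'" "card (X - R - P) = m" for m R P w'
    using that
  proof (induction m arbitrary: R P w' rule: less_induct)
    case (less m)
    note inv = less.prems(1)[unfolded inv_def]
    have RP: "R \<subseteq> X" "P \<subseteq> X" "R \<inter> P = {}" and w'nn: "\<And>e. 0 \<le> w' e"
      and w'sup: "\<And>e. w' e \<noteq> 0 \<Longrightarrow> e \<subseteq> X \<and> card e = k"
      and w'dg: "\<And>s. s \<subseteq> X \<Longrightarrow> s \<noteq> {} \<Longrightarrow> wdeg X w' s \<le> 2 * K * \<tau> ^ card s * W / v"
      and Pw': "card P * W / (2 * v) \<le> wdeg X w' {}"
      and w'w: "\<And>f. w' f \<noteq> 0 \<Longrightarrow> \<exists>u\<in>P. w (insert u f) \<noteq> 0"
      using inv by auto
    have fin: "finite R" "finite P" using RP X by (auto intro: finite_subset)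
    \<comment> \<open>The threshold is half of the codegree allowed in \<open>inv\<close>, so that
      one more link still fits.\<close>
    define sat where "sat s \<longleftrightarrow> s \<noteq> {} \<and> wdeg X w' s > K * \<tau> ^ card s * W / v" for s
    define A where "A = {e. e \<subseteq> X \<and> e \<inter> R = {} \<and> e \<inter> P = {} \<and> (\<forall>s\<subseteq>e. \<not> sat s) \<and> w e \<noteq> 0}"
    have fA: "finite A" using X by (simp add: A_def)
    have Bpos: "1 \<le> (m + 1) ^ (Q - card P) * B" using B by (simp add: Suc_leI)
    show ?case
    proof (cases "c * \<tau> * W \<le> wdeg X w' {}")
      case True
      have "codeg_bounded X k (2 * K / c) \<tau> w'"
        unfolding codeg_bounded_def
      proof (intro conjI allI impI)
        show "0 \<le> w' e" for e by (rule w'nn)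
        show "e \<subseteq> X" if "w' e \<noteq> 0" for e using w'sup that by blast
        show "card e = k" if "w' e \<noteq> 0" for e using w'sup that by blast
        have "0 < c * \<tau> * W" using c \<tau> Wpos by simp
        then show "0 < wdeg X w' {}" using True by linarith
        fix s assume s: "s \<subseteq> X \<and> s \<noteq> {}"
        then have cs: "card s \<ge> 1" using X by (meson card_0_eq finite_subset less_one not_le)
        have "wdeg X w' s \<le> 2 * K * \<tau> ^ card s * W / v" using w'dg s by blast
        also have "\<dots> = (2 * K / c) * \<tau> ^ (card s - 1) * (c * \<tau> * W) / v"
          using c cs by (cases "card s") auto
        also have "\<dots> \<le> (2 * K / c) * \<tau> ^ (card s - 1) * wdeg X w' {} / v"
          using True c K \<tau> v by (intro divide_right_mono mult_left_mono) auto
        finally show "wdeg X w' s \<le> 2 * K / c * \<tau> ^ (card s - 1) * wdeg X w' {} / real (card X)"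
          by (simp add: v_def)
      qed
      from IH[OF this] obtain F where F: "container_family X w' \<delta> F" "card F \<le> B" by blast
      have "1 * B \<le> (m + 1) ^ (Q - card P) * B" by (intro mult_le_mono1) (simp add: Suc_leI)
      then have cF: "card F \<le> (m + 1) ^ (Q - card P) * B" using F(2) by linarith
      have "\<exists>C\<in>F. I \<subseteq> C" if I: "I \<subseteq> X" "\<forall>e. e \<subseteq> I \<longrightarrow> w e = 0" "P \<subseteq> I" for I
      proof -
        have "w' f = 0" if "f \<subseteq> I" for f
        proof (rule ccontr)
          assume "w' f \<noteq> 0"
          then obtain u where "u \<in> P" "w (insert u f) \<noteq> 0" using w'w by blast
          with I that show False by (meson insert_subset subsetD)
        qed
        with F(1) I(1) show ?thesis unfolding container_family_def by blast
      qed
      with F(1) cF show ?thesis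
        unfolding container_family_def by (intro exI[of _ F] conjI allI impI) (elim conjE, simp)+
    next
      case False
      \<comment> \<open>As long as \<open>w'\<close> is light, few vertices can have been accepted,
        since each of them added \<open>W / (2 * v)\<close>. This also keeps \<open>card P\<close>
        below \<open>Q\<close>.\<close>
      have Psmall: "card P < 2 * c * \<tau> * v"
      proof -
        have "card P * W / (2 * v) < c * \<tau> * W" using Pw' False by linarith
        then have "card P * W < 2 * c * \<tau> * v * W" using v by (simp add: field_simps)
        then show ?thesis using Wpos by (simp add: mult_less_cancel_right)
      qed
      have sw: "W - sum w A \<le> card R * (K * W / v) + card P * (K * W / v) + W / 4"
      proof -
        let ?S = "{s. s \<subseteq> X \<and> sat s}"
        have one: "wdeg X w {x} \<le> K * W / v" if "x \<in> X" for x using wdg[of "{x}"] that by simp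
        have "W = sum w ({e. e \<subseteq> X \<and> e \<notin> A} \<union> A)"
          unfolding W_def wdeg_def by (intro sum.cong) (auto simp: A_def)
        also have "\<dots> = sum w {e. e \<subseteq> X \<and> e \<notin> A} + sum w A"
          using X fA by (intro sum.union_disjoint) auto
        finally have "W - sum w A = sum w {e. e \<subseteq> X \<and> e \<notin> A}" by simp
        also have "\<dots> = sum w {e. e \<subseteq> X \<and> e \<notin> A \<and> w e \<noteq> 0}"
          using X by (intro sum.mono_neutral_right) auto
        also have "\<dots> \<le> (\<Sum>s\<in>((\<lambda>x. {x}) ` (R \<union> P)) \<union> ?S. sum w {e. e \<subseteq> X \<and> s \<subseteq> e})"
          using X fin wnn by (intro sum_over_union_le) (auto simp: A_def, meson order_trans)
        also have "\<dots> \<le> (\<Sum>s\<in>((\<lambda>x. {x}) ` (R \<union> P)). wdeg X w s) + (\<Sum>s\<in>?S. wdeg X w s)"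
          using X fin wnn by (simp add: sum_Un wdeg_def sum_nonneg)
        also have "(\<Sum>s\<in>((\<lambda>x. {x}) ` (R \<union> P)). wdeg X w s) = (\<Sum>x\<in>R \<union> P. wdeg X w {x})"
          by (subst sum.reindex) (auto simp: inj_on_def)
        also have "\<dots> \<le> (\<Sum>x\<in>R \<union> P. K * W / v)" using one RP by (intro sum_mono) auto
        also have "\<dots> = card R * (K * W / v) + card P * (K * W / v)"
          using RP fin by (simp add: card_Un_disjoint algebra_simps add_divide_distrib)
        \<comment> \<open>The permitted degree of \<open>s\<close> in \<open>w\<close> is
          \<open>1 / \<tau>\<close> times the degree at which \<open>s\<close> saturates in
          \<open>w'\<close>, while the total weight of \<open>w'\<close> is below
          \<open>c * \<tau> * W\<close>. The two powers of \<tau> cancel.\<close>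
        also have "(\<Sum>s\<in>?S. wdeg X w s) \<le> (\<Sum>s\<in>?S. wdeg X w' s / \<tau>)"
        proof (rule sum_mono)
          fix s assume s: "s \<in> ?S"
          then have cs: "card s \<ge> 1" using X sat_def by (metis (mono_tags, lifting) card_0_eq finite_subset less_one mem_Collect_eq not_le)
          have "wdeg X w s \<le> K * \<tau> ^ (card s - 1) * W / v" using wdg s sat_def by blast
          also have "\<dots> = (K * \<tau> ^ card s * W / v) / \<tau>" using cs \<tau> by (cases "card s") auto
          also have "\<dots> \<le> wdeg X w' s / \<tau>" using s \<tau> by (intro divide_right_mono) (auto simp: sat_def)
          finally show "wdeg X w s \<le> wdeg X w' s / \<tau>" .
        qed
        also have "\<dots> = (\<Sum>s\<in>?S. wdeg X w' s) / \<tau>" by (simp add: sum_divide_distrib)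
        also have "\<dots> \<le> (2 ^ k * wdeg X w' {}) / \<tau>"
          using X w'nn w'sup \<tau> by (intro divide_right_mono sum_wdeg_le) auto
        also have "\<dots> \<le> (2 ^ k * (c * \<tau> * W)) / \<tau>"
          using False \<tau> by (intro divide_right_mono mult_left_mono) auto
        also have "\<dots> = (2 ^ k * c) * W" using \<tau> by simp
        also have "\<dots> \<le> 1/4 * W" using c2 Wpos by (intro mult_right_mono) auto
        finally show ?thesis by simp
      qed
      have Pc: "card P * (K * W / v) \<le> W / 8"
      proof -
        have "card P * (K * W / v) \<le> (2 * c * \<tau> * v) * (K * W / v)"
          using Psmall K Wpos v by (intro mult_right_mono) auto
        also have "\<dots> = (2 * c * K) * \<tau> * W" using v by simp
        also have "\<dots> \<le> 1/8 * 1 * W" using cK \<tau> Wpos c K by (intro mult_mono) auto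
        finally show ?thesis by simp
      qed
      show ?thesis
      proof (cases "sum w A < W / 2")
        case True
        \<comment> \<open>More than \<open>W / 2\<close> is lost, of which at most
          \<open>W / 4 + W / 8\<close> is due to saturated sets and accepted vertices; rejected
          vertices account for the rest, and as each has bounded degree there are many of
          them.\<close>
        then have "W / 8 \<le> card R * (K * W / v)" using sw Pc by linarith
        then have "v / (8 * K) \<le> card R" using Wpos K v by (simp add: field_simps)
        moreover have "real (card (X - R)) = v - card R"
          using RP X fin by (simp add: card_Diff_subset v_def card_mono of_nat_diff)
        moreover have "\<delta> * v \<le> v / (8 * K)" using mult_right_mono[OF \<delta>, of v] v by simp
        ultimately have "real (card (X - R)) \<le> (1 - \<delta>) * card X" by (simp add: v_def algebra_simps)
        then show ?thesis using Bpos by (intro exI[of _ "{X - R}"] conjI) auto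
      next
        case wA: False
        have "\<exists>u\<in>X - R - P. W / (2 * v) \<le> sum w {e\<in>A. u \<in> e}"
        proof (rule ccontr)
          assume *: "\<not> ?thesis"
          have ne: "e \<noteq> {}" if "e \<in> A" for e using wsup[of e] that by (auto simp: A_def)
          have "sum w A \<le> (\<Sum>u\<in>X - R - P. sum w {e\<in>A. u \<in> e})"
          proof (intro sum_over_union_le wnn)
            show "A \<subseteq> (\<Union>u\<in>X - R - P. {e\<in>A. u \<in> e})"
            proof
              fix e assume e: "e \<in> A"
              then obtain x where "x \<in> e" using ne by blast
              with e show "e \<in> (\<Union>u\<in>X - R - P. {e\<in>A. u \<in> e})" unfolding A_def by blast
            qed
          qed (use X fA in auto)
          moreover have "X - R - P \<noteq> {}"
          proof
            assume "X - R - P = {}"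
            with calculation have "sum w A \<le> 0" by (simp only: sum.empty)
            with wA Wpos show False by simp
          qed
          ultimately have "sum w A < (\<Sum>u\<in>X - R - P. W / (2 * v))"
            using * X by (smt (verit) finite_Diff sum_strict_mono)
          also have "\<dots> \<le> v * (W / (2 * v))"
            using Wpos v X unfolding v_def sum_constant by (intro mult_right_mono) (auto intro: card_mono)
          also have "\<dots> = W / 2" using v by simp
          finally show False using wA by simp
        qed
        then obtain u where u: "u \<in> X" "u \<notin> R" "u \<notin> P" and du: "W / (2 * v) \<le> sum w {e\<in>A. u \<in> e}" by auto
        \<comment> \<open>Only edges of \<open>A\<close> are linked, so a saturated set gains
          nothing. Any other set is below half of its allowance and gains at most the codegree of
          \<open>insert u s\<close> in \<open>w\<close>, which is the other half.\<close>
        define w2 where "w2 f = w' f + (if u \<notin> f \<and> insert u f \<in> A then w (insert u f) else 0)" for f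
        have card_m: "0 < m" "card (X - insert u R - P) = m - 1" "card (X - R - insert u P) = m - 1"
        proof -
          have "X - insert u R - P = (X - R - P) - {u}" "X - R - insert u P = (X - R - P) - {u}" by auto
          then show "card (X - insert u R - P) = m - 1" "card (X - R - insert u P) = m - 1"
            using u less.prems(2) by auto
          show "0 < m" using u less.prems(2) X card_gt_0_iff by blast
        qed
        have "inv (insert u R) P w'" using less.prems(1) u unfolding inv_def by auto
        from less.IH[OF _ this card_m(2)] card_m(1) obtain F1 where F1: "finite F1"
          "\<forall>C\<in>F1. C \<subseteq> X \<and> real (card C) \<le> (1 - \<delta>) * card X"
          "\<forall>I. I \<subseteq> X \<and> (\<forall>e. e \<subseteq> I \<longrightarrow> w e = 0) \<and> P \<subseteq> I \<and> insert u R \<inter> I = {} \<longrightarrow> (\<exists>C\<in>F1. I \<subseteq> C)"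
          "card F1 \<le> m ^ (Q - card P) * B" by auto
        have w2deg: "wdeg X w2 s = wdeg X w' s + sum w {e \<in> A. u \<in> e \<and> s \<subseteq> e - {u}}" for s
        proof -
          have "(\<Sum>f\<in>{f. f \<subseteq> X \<and> s \<subseteq> f}. if u \<notin> f \<and> insert u f \<in> A then w (insert u f) else 0)
             = (\<Sum>f\<in>{f. f \<subseteq> X \<and> s \<subseteq> f \<and> u \<notin> f \<and> insert u f \<in> A}. w (insert u f))"
            using X by (intro sum.mono_neutral_cong_right) auto
          also have "\<dots> = sum w {e \<in> A. u \<in> e \<and> s \<subseteq> e - {u}}"
          proof (rule sum.reindex_bij_witness[where i = "\<lambda>e. e - {u}" and j = "insert u"])
            fix e assume "e \<in> {e \<in> A. u \<in> e \<and> s \<subseteq> e - {u}}"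
            then show "e - {u} \<in> {f. f \<subseteq> X \<and> s \<subseteq> f \<and> u \<notin> f \<and> insert u f \<in> A}"
              "insert u (e - {u}) = e"
              by (auto simp: A_def insert_absorb)
          qed auto
          finally show ?thesis by (simp add: wdeg_def w2_def sum.distrib)
        qed
        have "inv R (insert u P) w2"
          unfolding inv_def
        proof (intro conjI allI impI)
          show "R \<subseteq> X" "insert u P \<subseteq> X" "R \<inter> insert u P = {}" using RP u by auto
          show "0 \<le> w2 e" for e using w'nn wnn by (simp add: w2_def)
          fix e assume "w2 e \<noteq> 0"
          then have d: "w' e \<noteq> 0 \<or> (u \<notin> e \<and> insert u e \<in> A)" by (auto simp: w2_def split: if_splits)
          have "e \<subseteq> X \<and> card e = k \<and> w (insert u e) \<noteq> 0" if "u \<notin> e" "insert u e \<in> A"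
          proof -
            have "insert u e \<subseteq> X" "card (insert u e) = Suc k" "w (insert u e) \<noteq> 0"
              using that wsup[of "insert u e"] by (auto simp: A_def)
            moreover have "finite e" using calculation(1) X finite_subset by auto
            ultimately show ?thesis using that by auto
          qed
          with d w'sup w'w show "e \<subseteq> X" "card e = k" "\<exists>u\<in>insert u P. w (insert u e) \<noteq> 0" by blast+
        next
          fix s assume s: "s \<subseteq> X \<and> s \<noteq> {}"
          then have fs: "finite s" using X finite_subset by auto
          show "wdeg X w2 s \<le> 2 * K * \<tau> ^ card s * W / v"
          proof (cases "sat s \<or> u \<in> s")
            case True
            then have "{e \<in> A. u \<in> e \<and> s \<subseteq> e - {u}} = {}" by (auto simp: A_def)
            then show ?thesis using w'dg s by (simp only: w2deg) simp
          next
            case False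
            have "sum w {e \<in> A. u \<in> e \<and> s \<subseteq> e - {u}} \<le> wdeg X w (insert u s)"
              unfolding wdeg_def using X wnn by (intro sum_mono2) (auto simp: A_def)
            also have "\<dots> \<le> K * \<tau> ^ card s * W / v"
              using wdg[of "insert u s"] s u False fs by simp
            finally have "sum w {e \<in> A. u \<in> e \<and> s \<subseteq> e - {u}} \<le> K * \<tau> ^ card s * W / v" .
            moreover have "wdeg X w' s \<le> K * \<tau> ^ card s * W / v"
              using False s by (auto simp: sat_def)
            ultimately have "wdeg X w2 s \<le> K * \<tau> ^ card s * W / v + K * \<tau> ^ card s * W / v"
              unfolding w2deg by (rule add_mono[rotated])
            also have "\<dots> = 2 * K * \<tau> ^ card s * W / v" by simp
            finally show ?thesis .
          qed
        next
          have "card (insert u P) * W / (2 * v) = card P * W / (2 * v) + W / (2 * v)"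
            using u fin by (simp add: algebra_simps add_divide_distrib)
          also have "\<dots> \<le> wdeg X w2 {}" using Pw' du by (simp add: w2deg)
          finally show "card (insert u P) * W / (2 * v) \<le> wdeg X w2 {}" .
        qed
        from less.IH[OF _ this card_m(3)] card_m(1) obtain F2 where F2: "finite F2"
          "\<forall>C\<in>F2. C \<subseteq> X \<and> real (card C) \<le> (1 - \<delta>) * card X"
          "\<forall>I. I \<subseteq> X \<and> (\<forall>e. e \<subseteq> I \<longrightarrow> w e = 0) \<and> insert u P \<subseteq> I \<and> R \<inter> I = {} \<longrightarrow> (\<exists>C\<in>F2. I \<subseteq> C)"
          "card F2 \<le> m ^ (Q - card (insert u P)) * B" by auto
        have PQ: "card P < Q"
        proof -
          have "2 * c * \<tau> * v \<le> 1 * \<tau> * v" using c2 \<tau> v by (intro mult_right_mono) auto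
          then have "real (card P) < real Q" using Psmall Q by linarith
          then show ?thesis by simp
        qed
        have "card (F1 \<union> F2) \<le> m ^ (Q - card P) * B + m ^ (Q - card P - 1) * B"
          using F1(4) F2(4) u fin card_Un_le[of F1 F2] by simp
        also have "\<dots> \<le> (m + 1) ^ (Q - card P) * B" using PQ card_m(1) by (intro pow_split_le) auto
        finally have cF: "card (F1 \<union> F2) \<le> (m + 1) ^ (Q - card P) * B" .
        show ?thesis
        proof (intro exI[of _ "F1 \<union> F2"] conjI allI impI)
          fix I assume I: "I \<subseteq> X \<and> (\<forall>e. e \<subseteq> I \<longrightarrow> w e = 0) \<and> P \<subseteq> I \<and> R \<inter> I = {}"
          show "\<exists>C\<in>F1 \<union> F2. I \<subseteq> C"
          proof (cases "u \<in> I")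
            case True
            then have "\<exists>C\<in>F2. I \<subseteq> C" using F2(3) I by simp
            then show ?thesis by blast
          next
            case False
            then have "\<exists>C\<in>F1. I \<subseteq> C" using F1(3) I by simp
            then show ?thesis by blast
          qed
        qed (use F1 F2 cF in auto)
      qed
    qed
  qed
  have "inv {} {} (\<lambda>_. 0)"
    unfolding inv_def using K \<tau> Wpos v by (auto simp: wdeg_def)
  from main[OF this refl] show ?thesis unfolding container_family_def by auto
qed

text \<open>Each step lowers the uniformity by one, multiplies the number of containers by at most
  \<open>(card X + 1) ^ Q\<close> and raises the codegree constant from \<open>K\<close> to
  \<open>2 * K / c\<close>, so that \<delta> depends on \<open>k\<close> and \<open>K\<close> alone.
  For \<open>k = 1\<close> an independent set avoids all vertices of positive weight, and there are
  at least \<open>card X / K\<close> of these because none carries more than \<open>K\<close> times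
  the average.\<close>

theorem container_lemma:
  assumes "k \<ge> 1" "K \<ge> (1::real)"
  shows "\<exists>\<delta>>0. \<forall>(X :: 'a set) \<tau> w Q. finite X \<and> 0 < \<tau> \<and> \<tau> \<le> 1 \<and> codeg_bounded X k K \<tau> w \<and>
            \<tau> * card X \<le> real Q \<longrightarrow>
            (\<exists>F. container_family X w \<delta> F \<and> card F \<le> (card X + 1) ^ (Q * (k - 1)))"
  using assms
proof (induction k arbitrary: K rule: nat_induct_at_least)
  case base
  show ?case
  proof (intro exI[of _ "1 / K"] conjI allI impI)
    show "0 < 1 / K" using base by simp
    fix X :: "'a set" and \<tau> :: real and w :: "'a set \<Rightarrow> real" and Q :: nat
    assume *: "finite X \<and> 0 < \<tau> \<and> \<tau> \<le> 1 \<and> codeg_bounded X 1 K \<tau> w \<and> \<tau> * card X \<le> real Q"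
    then have X: "finite X" and cb: "codeg_bounded X 1 K \<tau> w" by auto
    have wnn: "\<And>e. 0 \<le> w e" and wsup: "\<And>e. w e \<noteq> 0 \<Longrightarrow> e \<subseteq> X \<and> card e = 1"
      and Wpos: "0 < wdeg X w {}"
      and wdg: "\<And>s. s \<subseteq> X \<Longrightarrow> s \<noteq> {} \<Longrightarrow> wdeg X w s \<le> K * \<tau> ^ (card s - 1) * wdeg X w {} / card X"
      using cb unfolding codeg_bounded_def by auto
    define Y where "Y = {x \<in> X. w {x} \<noteq> 0}"
    have fY: "finite Y" using X by (simp add: Y_def)
    have "wdeg X w {} \<le> (\<Sum>x\<in>Y. wdeg X w {x})"
    proof -
      have "wdeg X w {} = sum w {e. e \<subseteq> X \<and> w e \<noteq> 0}"
        unfolding wdeg_def using X by (intro sum.mono_neutral_right) auto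
      also have "\<dots> \<le> (\<Sum>x\<in>Y. sum w {e. e \<subseteq> X \<and> {x} \<subseteq> e})"
      proof (intro sum_over_union_le fY wnn)
        show "{e. e \<subseteq> X \<and> w e \<noteq> 0} \<subseteq> (\<Union>x\<in>Y. {e. e \<subseteq> X \<and> {x} \<subseteq> e})"
        proof
          fix e assume "e \<in> {e. e \<subseteq> X \<and> w e \<noteq> 0}"
          then obtain x where "e = {x}" "x \<in> X" "w {x} \<noteq> 0"
            using wsup[of e] by (auto simp: card_1_singleton_iff)
          then show "e \<in> (\<Union>x\<in>Y. {e. e \<subseteq> X \<and> {x} \<subseteq> e})" by (auto simp: Y_def)
        qed
      qed (use X in auto)
      finally show ?thesis by (simp add: wdeg_def)
    qed
    also have "\<dots> \<le> (\<Sum>x\<in>Y. K * wdeg X w {} / card X)"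
      using wdg[of "{x}" for x] by (intro sum_mono) (force simp: Y_def)
    finally have "wdeg X w {} * 1 \<le> wdeg X w {} * (card Y * (K / card X))" by (simp add: mult_ac)
    then have "1 \<le> card Y * (K / card X)" using Wpos mult_le_cancel_left_pos by blast
    then have "card X > 0" by (auto intro: gr0I)
    with \<open>1 \<le> card Y * (K / card X)\<close> have YK: "card X / K \<le> card Y"
      using base by (simp add: field_simps)
    have "real (card (X - Y)) = real (card X) - card Y"
      using X fY by (simp add: card_Diff_subset Y_def card_mono of_nat_diff)
    with YK have "real (card (X - Y)) \<le> (1 - 1 / K) * card X" by (simp add: algebra_simps)
    then have "container_family X w (1 / K) {X - Y}"
      unfolding container_family_def by (auto simp: Y_def)
    then show "\<exists>F. container_family X w (1 / K) F \<and> card F \<le> (card X + 1) ^ (Q * (1 - 1))"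
      by (intro exI[of _ "{X - Y}"]) simp
  qed
next
  case (Suc k)
  define c where "c = 1 / (2 ^ (k + 4) * K)"
  have "2 * K / c = 2 * K * (2 ^ (k + 4) * K)" by (simp add: c_def)
  moreover have "1 * 1 \<le> (2 ^ (k + 4)) * K" using Suc.prems by (intro mult_mono) auto
  then have "1 * 1 \<le> 2 * K * (2 ^ (k + 4) * K)" using Suc.prems by (intro mult_mono) auto
  ultimately have "1 \<le> 2 * K / c" by simp
  from Suc.IH[OF this] obtain \<delta> where \<delta>: "\<delta> > 0"
    "\<And>(X :: 'a set) \<tau> w Q. finite X \<and> 0 < \<tau> \<and> \<tau> \<le> 1 \<and> codeg_bounded X k (2 * K / c) \<tau> w \<and>
            \<tau> * card X \<le> real Q \<Longrightarrow>
            (\<exists>F. container_family X w \<delta> F \<and> card F \<le> (card X + 1) ^ (Q * (k - 1)))" by blast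
  define \<delta>' where "\<delta>' = min \<delta> (1 / (8 * K))"
  have mono: "container_family X w \<delta>' F" if "container_family X w \<delta> F" for X :: "'a set" and w F
  proof -
    have "(1 - \<delta>) * real (card X) \<le> (1 - \<delta>') * real (card X)"
      by (intro mult_right_mono) (auto simp: \<delta>'_def)
    with that show ?thesis unfolding container_family_def by (meson order_trans)
  qed
  show ?case
  proof (intro exI[of _ \<delta>'] conjI allI impI)
    show "0 < \<delta>'" using \<delta>(1) Suc.prems by (simp add: \<delta>'_def)
    fix X :: "'a set" and \<tau> :: real and w :: "'a set \<Rightarrow> real" and Q :: nat
    assume *: "finite X \<and> 0 < \<tau> \<and> \<tau> \<le> 1 \<and> codeg_bounded X (Suc k) K \<tau> w \<and> \<tau> * card X \<le> real Q"
    have "\<exists>F. container_family X w \<delta>' F \<and> card F \<le> (card X + 1) ^ Q * (card X + 1) ^ (Q * (k - 1))"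
    proof (rule container_step[where K = K and k = k and \<tau> = \<tau>])
      fix w' assume "codeg_bounded X k (2 * K / (1 / (2 ^ (k + 4) * K))) \<tau> w'"
      then show "\<exists>F. container_family X w' \<delta>' F \<and> card F \<le> (card X + 1) ^ (Q * (k - 1))"
        using \<delta>(2)[of X \<tau> w' Q] * mono by (auto simp: c_def)
    qed (use * Suc in \<open>auto simp: \<delta>'_def\<close>)
    moreover have "(card X + 1) ^ Q * (card X + 1) ^ (Q * (k - 1)) = (card X + 1) ^ (Q * (Suc k - 1))"
      using Suc.hyps by (cases k) (auto simp: power_add)
    ultimately show "\<exists>F. container_family X w \<delta>' F \<and> card F \<le> (card X + 1) ^ (Q * (Suc k - 1))"
      by simp
  qed
qed

section \<open>Closed walks and cycles in graphs\<close>

lemma logconvex_ratio: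
  fixes a :: "nat \<Rightarrow> real"
  assumes "0 < a 0" "0 < a 1" "\<And>m. (a (Suc m))\<^sup>2 \<le> a m * a (Suc (Suc m))"
  shows "0 < a m \<and> a 1 / a 0 * a m \<le> a (Suc m)"
proof (induction m)
  case 0
  then show ?case using assms by simp
next
  case (Suc m)
  let ?\<rho> = "a 1 / a 0"
  have \<rho>: "?\<rho> > 0" using assms by simp
  have pos: "0 < a (Suc m)" using Suc \<rho> by (meson less_le_trans mult_pos_pos)
  have "?\<rho> * a (Suc m) * a m \<le> a (Suc m) * a (Suc m)"
    using Suc pos mult_right_mono[of "?\<rho> * a m" "a (Suc m)" "a (Suc m)"] by (simp add: mult_ac)
  also have "\<dots> \<le> a (Suc (Suc m)) * a m" using assms(3)[of m] by (simp add: power2_eq_square mult_ac)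
  finally have "?\<rho> * a (Suc m) \<le> a (Suc (Suc m))" using Suc mult_le_cancel_right_pos by blast
  with pos show ?case by simp
qed

lemma logconvex_lower:
  fixes a :: "nat \<Rightarrow> real"
  assumes "0 < a 0" "0 < a 1" "\<And>m. (a (Suc m))\<^sup>2 \<le> a m * a (Suc (Suc m))"
  shows "a 0 * (a 1 / a 0) ^ m \<le> a m"
proof (induction m)
  case (Suc m)
  have "a 0 * (a 1 / a 0) ^ Suc m = a 1 / a 0 * (a 0 * (a 1 / a 0) ^ m)" by simp
  also have "\<dots> \<le> a 1 / a 0 * a m" using Suc assms by (intro mult_left_mono) auto
  also have "\<dots> \<le> a (Suc m)" using logconvex_ratio[OF assms, of m] by blast
  finally show ?case .
qed simp

text \<open>Equivalently, the \<open>m\<close>-th root of \<open>a m / a 0\<close> does not decrease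
  with \<open>m\<close>. It serves to bound the closed walks of length \<open>2 * l - 2\<close> by
  those of length \<open>2 * l\<close>. In the induction both sides acquire the factor
  \<open>a (Suc m) ^ m\<close>, which is then cancelled.\<close>

lemma logconvex_pow:
  fixes a :: "nat \<Rightarrow> real"
  assumes "0 < a 0" "0 < a 1" "\<And>m. (a (Suc m))\<^sup>2 \<le> a m * a (Suc (Suc m))"
  shows "a m ^ Suc m \<le> a 0 * a (Suc m) ^ m"
proof (induction m)
  case (Suc m)
  have pos: "0 < a m" for m using logconvex_ratio[OF assms, of m] by blast
  have "a (Suc m) ^ m * a (Suc m) ^ Suc (Suc m) = ((a (Suc m))\<^sup>2) ^ Suc m"
    by (simp add: power_mult[symmetric] power_add[symmetric] mult_2)
  also have "\<dots> \<le> (a m * a (Suc (Suc m))) ^ Suc m"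
    by (intro power_mono assms) auto
  also have "\<dots> = a m ^ Suc m * a (Suc (Suc m)) ^ Suc m" by (rule power_mult_distrib)
  also have "\<dots> \<le> a 0 * a (Suc m) ^ m * a (Suc (Suc m)) ^ Suc m"
    using Suc pos by (intro mult_right_mono zero_le_power less_imp_le[OF pos]) auto
  finally have "a (Suc m) ^ m * a (Suc m) ^ Suc (Suc m) \<le> a (Suc m) ^ m * (a 0 * a (Suc (Suc m)) ^ Suc m)"
    by (simp add: mult_ac)
  then show ?case using pos by (simp only: mult_le_cancel_left_pos zero_less_power)
qed simp

section \<open>Walk counts and their even moments\<close>

locale finite_graph =
  fixes V :: "'v set" and E :: "'v set set"
  assumes finite_V: "finite V"
    and edges_in: "{u, v} \<in> E \<Longrightarrow> u \<in> V"
begin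

definition nb :: "'v \<Rightarrow> 'v set" where
  "nb u = {z. {u, z} \<in> E}"

text \<open>For vertices of \<open>V\<close> these are the entries of the \<open>m\<close>-th power
  of the adjacency matrix.\<close>

primrec wk :: "nat \<Rightarrow> 'v \<Rightarrow> 'v \<Rightarrow> real" where
  "wk 0 u v = of_bool (u = v)"
| "wk (Suc m) u v = (\<Sum>z\<in>nb u. wk m z v)"

lemma nb_sub: "nb u \<subseteq> V"
  using edges_in by (auto simp: nb_def insert_commute)

lemma finite_nb [simp]: "finite (nb u)"
  using nb_sub finite_V finite_subset by blast

lemma nb_sym: "z \<in> nb u \<longleftrightarrow> u \<in> nb z"
  by (simp add: nb_def insert_commute)

lemma sum_nb: "(\<Sum>z\<in>nb u. f z) = (\<Sum>z\<in>V. of_bool (z \<in> nb u) * f z)" for f :: "'v \<Rightarrow> real"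
proof -
  have "(\<Sum>z\<in>V. of_bool (z \<in> nb u) * f z) = (\<Sum>z\<in>nb u. of_bool (z \<in> nb u) * f z)"
    using finite_V nb_sub by (intro sum.mono_neutral_right) auto
  then show ?thesis by simp
qed

lemma wk_nonneg: "0 \<le> wk m u v"
  by (induction m arbitrary: u) (auto simp: sum_nonneg)

lemma wk_add: "u \<in> V \<Longrightarrow> wk (m + k) u v = (\<Sum>z\<in>V. wk m u z * wk k z v)"
proof (induction m arbitrary: u)
  case 0
  have "(\<Sum>z\<in>V. wk 0 u z * wk k z v) = (\<Sum>z\<in>V. if z = u then wk k z v else 0)"
    by (intro sum.cong) auto
  then show ?case using 0 finite_V by simp
next
  case (Suc m)
  have "wk (Suc m + k) u v = (\<Sum>y\<in>nb u. \<Sum>z\<in>V. wk m y z * wk k z v)"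
    using Suc.IH nb_sub by (auto intro!: sum.cong)
  also have "\<dots> = (\<Sum>z\<in>V. (\<Sum>y\<in>nb u. wk m y z) * wk k z v)"
    by (subst sum.swap) (simp add: sum_distrib_right)
  finally show ?case by simp
qed

lemma wk_sym: "u \<in> V \<Longrightarrow> v \<in> V \<Longrightarrow> wk m u v = wk m v u"
proof (induction m arbitrary: u v)
  case (Suc m)
  have one: "wk 1 z u = of_bool (z \<in> nb u)" for z
  proof -
    have "wk 1 z u = (\<Sum>y\<in>nb z. if y = u then 1 else 0)" by (simp add: of_bool_def)
    then show ?thesis using nb_sym[of z u] by simp
  qed
  have "wk (Suc m) v u = (\<Sum>z\<in>V. wk m v z * wk 1 z u)"
    using wk_add[OF Suc.prems(2), of m 1 u] by simp
  also have "\<dots> = (\<Sum>z\<in>V. of_bool (z \<in> nb u) * wk m z v)"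
    using Suc by (intro sum.cong) (simp_all only: one mult.commute)
  also have "\<dots> = wk (Suc m) u v" using sum_nb[of "\<lambda>z. wk m z v" u] by simp
  finally show ?case by simp
qed auto

text \<open>The squared Frobenius norm of the rows indexed by \<open>S\<close> of the
  \<open>m\<close>-th power of the adjacency matrix, which is the number of closed walks of length
  \<open>2 * m\<close> from \<open>S\<close>. In the form of a sum of squares it is open to the
  Cauchy-Schwarz inequality.\<close>

definition h :: "'v set \<Rightarrow> nat \<Rightarrow> real" where
  "h S m = (\<Sum>u\<in>S. \<Sum>z\<in>V. (wk m u z)\<^sup>2)"

lemma sum_wk_wk:
  assumes "u \<in> V" "v \<in> V"
  shows "(\<Sum>z\<in>V. wk m u z * wk k v z) = wk (m + k) u v"
  using wk_sym assms by (simp add: wk_add)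

lemma h_trace: "S \<subseteq> V \<Longrightarrow> h S m = (\<Sum>u\<in>S. wk (2 * m) u u)"
  unfolding h_def power2_eq_square mult_2 by (intro sum.cong refl sum_wk_wk) auto

lemma h_logconvex:
  assumes "S \<subseteq> V"
  shows "(h S (Suc m))\<^sup>2 \<le> h S m * h S (Suc (Suc m))"
proof -
  have "h S (Suc m) = (\<Sum>u\<in>S. \<Sum>z\<in>V. wk m u z * wk (Suc (Suc m)) u z)"
    unfolding h_trace[OF assms] using assms
    by (intro sum.cong refl) (subst sum_wk_wk, auto simp: numeral_2_eq_2)
  also have "\<dots> = (\<Sum>(u, z)\<in>S \<times> V. wk m u z * wk (Suc (Suc m)) u z)"
    by (rule sum.cartesian_product)
  finally have "h S (Suc m) = (\<Sum>x\<in>S \<times> V. wk m (fst x) (snd x) * wk (Suc (Suc m)) (fst x) (snd x))"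
    by (simp add: case_prod_unfold)
  moreover have "h S k = (\<Sum>x\<in>S \<times> V. (wk k (fst x) (snd x))\<^sup>2)" for k
    unfolding h_def sum.cartesian_product by (simp add: case_prod_unfold)
  ultimately show ?thesis by (simp only: Cauchy_Schwarz_ineq_sum)
qed

text \<open>The \<open>m\<close>-th power of the adjacency matrix applied to the indicator vector of
  \<open>S\<close>.\<close>

definition fl :: "'v set \<Rightarrow> nat \<Rightarrow> 'v \<Rightarrow> real" where
  "fl S m z = (\<Sum>u\<in>S. wk m u z)"

lemma sum_fl_fl:
  assumes "S \<subseteq> V"
  shows "(\<Sum>z\<in>V. fl S m z * fl S k z) = (\<Sum>u\<in>S. \<Sum>v\<in>S. wk (m + k) u v)"
proof -
  have "(\<Sum>z\<in>V. fl S m z * fl S k z) = (\<Sum>z\<in>V. \<Sum>u\<in>S. \<Sum>v\<in>S. wk m u z * wk k v z)"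
    by (simp add: fl_def sum_product)
  also have "\<dots> = (\<Sum>u\<in>S. \<Sum>v\<in>S. \<Sum>z\<in>V. wk m u z * wk k v z)"
    by (subst sum.swap) (intro sum.cong refl sum.swap)
  also have "\<dots> = (\<Sum>u\<in>S. \<Sum>v\<in>S. wk (m + k) u v)"
    using assms by (intro sum.cong refl sum_wk_wk) auto
  finally show ?thesis .
qed

lemma fl_logconvex:
  assumes "S \<subseteq> V"
  shows "(\<Sum>z\<in>V. (fl S (Suc m) z)\<^sup>2)\<^sup>2 \<le> (\<Sum>z\<in>V. (fl S m z)\<^sup>2) * (\<Sum>z\<in>V. (fl S (Suc (Suc m)) z)\<^sup>2)"
proof -
  have "(\<Sum>z\<in>V. (fl S (Suc m) z)\<^sup>2) = (\<Sum>z\<in>V. fl S m z * fl S (Suc (Suc m)) z)"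
    unfolding power2_eq_square sum_fl_fl[OF assms] by simp
  then show ?thesis by (simp only: Cauchy_Schwarz_ineq_sum)
qed

text \<open>Cauchy-Schwarz over the starting vertices. It leads from walks between arbitrary
  vertices of \<open>S\<close>, whose number is easily bounded below, to closed walks.\<close>

lemma fl_le_h:
  assumes "finite S"
  shows "(\<Sum>z\<in>V. (fl S m z)\<^sup>2) \<le> card S * h S m"
proof -
  have "(fl S m z)\<^sup>2 \<le> card S * (\<Sum>u\<in>S. (wk m u z)\<^sup>2)" for z
    using Cauchy_Schwarz_ineq_sum[of "\<lambda>_. 1" "\<lambda>u. wk m u z" S] by (simp add: fl_def)
  then have "(\<Sum>z\<in>V. (fl S m z)\<^sup>2) \<le> (\<Sum>z\<in>V. card S * (\<Sum>u\<in>S. (wk m u z)\<^sup>2))" by (rule sum_mono)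
  also have "\<dots> = card S * h S m"
    unfolding h_def sum_distrib_left[symmetric] by (subst sum.swap) simp
  finally show ?thesis .
qed

section \<open>Walks as vertex lists, and conflicts between their vertices\<close>

definition wl :: "nat \<Rightarrow> 'v \<Rightarrow> 'v \<Rightarrow> 'v list set" where
  "wl m u v = {xs. length xs = Suc m \<and> xs ! 0 = u \<and> xs ! m = v \<and> (\<forall>i<m. {xs ! i, xs ! Suc i} \<in> E)}"

lemma wl_Suc: "wl (Suc m) u v = (\<Union>z\<in>nb u. (#) u ` wl m z v)"
proof (intro set_eqI iffI)
  fix xs assume xs: "xs \<in> wl (Suc m) u v"
  then obtain ys where ys: "xs = u # ys" by (cases xs) (auto simp: wl_def)
  have "{u, ys ! 0} \<in> E" "\<forall>i<m. {ys ! i, ys ! Suc i} \<in> E"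
    using xs ys by (auto simp: wl_def dest: spec[of _ "Suc _"] spec[of _ 0])
  then show "xs \<in> (\<Union>z\<in>nb u. (#) u ` wl m z v)"
    using xs ys by (intro UN_I[of "ys ! 0"]) (auto simp: wl_def nb_def)
next
  fix xs assume "xs \<in> (\<Union>z\<in>nb u. (#) u ` wl m z v)"
  then show "xs \<in> wl (Suc m) u v"
    by (auto simp: wl_def nb_def nth_Cons split: nat.splits)
qed

lemma finite_card_wl: "finite (wl m u v) \<and> real (card (wl m u v)) = wk m u v"
proof (induction m arbitrary: u)
  case 0
  have "wl 0 u v = (if u = v then {[u]} else {})"
    by (auto simp: wl_def length_Suc_conv)
  then show ?case by simp
next
  case (Suc m)
  have "card (\<Union>z\<in>nb u. (#) u ` wl m z v) = (\<Sum>z\<in>nb u. card ((#) u ` wl m z v))"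
    using Suc by (intro card_UN_disjoint) (auto simp: wl_def)
  also have "\<dots> = (\<Sum>z\<in>nb u. card (wl m z v))"
    by (intro sum.cong refl card_image) auto
  finally show ?case using Suc by (simp add: wl_Suc)
qed

lemmas finite_wl = finite_card_wl[THEN conjunct1]
lemmas card_wl = finite_card_wl[THEN conjunct2]

text \<open>The final vertex is not repeated and indices wrap around, so that rotation acts on these
  lists.\<close>

definition closed_walks :: "nat \<Rightarrow> 'v list set" where
  "closed_walks n = {xs. length xs = n \<and> (\<forall>i<n. {xs ! i, xs ! (Suc i mod n)} \<in> E)}"

lemma closed_walks_sub: "xs \<in> closed_walks n \<Longrightarrow> set xs \<subseteq> V"
  using edges_in by (fastforce simp: closed_walks_def set_conv_nth)

lemma finite_closed_walks: "finite (closed_walks n)"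
  using closed_walks_sub[of _ n]
  by (intro finite_subset[OF _ finite_lists_length_eq[OF finite_V, of n]]) (auto simp: closed_walks_def)

lemma card_closed_walks:
  assumes "l \<ge> 1"
  shows "h V l \<le> card (closed_walks (2 * l))"
proof -
  let ?L = "\<Union>u\<in>V. wl (2 * l) u u"
  have "h V l = (\<Sum>u\<in>V. card (wl (2 * l) u u))" by (simp add: h_trace card_wl)
  also have "\<dots> = card ?L"
    using finite_V finite_wl by (subst card_UN_disjoint) (auto simp: wl_def)
  also have "\<dots> \<le> card (closed_walks (2 * l))"
  proof -
    have inj: "inj_on butlast ?L"
    proof (rule inj_onI)
      fix xs ys assume *: "xs \<in> ?L" "ys \<in> ?L" "butlast xs = butlast ys"
      have "xs = butlast xs @ [butlast xs ! 0]" if "xs \<in> ?L" for xs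
      proof -
        have ln: "length xs = Suc (2 * l)" and e: "xs ! 0 = xs ! (2 * l)" using that by (auto simp: wl_def)
        then have "xs \<noteq> []" by auto
        then have "xs = butlast xs @ [last xs]" by simp
        moreover have "last xs = butlast xs ! 0"
          using ln e assms \<open>xs \<noteq> []\<close> by (simp add: last_conv_nth nth_butlast)
        ultimately show ?thesis by simp
      qed
      then show "xs = ys" using * by metis
    qed
    have "butlast xs \<in> closed_walks (2 * l)" if xs: "xs \<in> ?L" for xs
    proof -
      have ln: "length xs = Suc (2 * l)" and e: "xs ! 0 = xs ! (2 * l)"
        and E: "\<And>i. i < 2 * l \<Longrightarrow> {xs ! i, xs ! Suc i} \<in> E" using xs by (auto simp: wl_def)
      have "{butlast xs ! i, butlast xs ! (Suc i mod (2 * l))} \<in> E" if i: "i < 2 * l" for i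
      proof (cases "Suc i = 2 * l")
        case True
        then show ?thesis using E[OF i] ln e i by (simp add: nth_butlast)
      next
        case False
        then show ?thesis using E[OF i] ln i by (simp add: nth_butlast)
      qed
      then show ?thesis using ln by (simp add: closed_walks_def)
    qed
    then show ?thesis using inj by (intro of_nat_mono card_inj_on_le[of butlast] finite_closed_walks) auto
  qed
  finally show ?thesis by simp
qed

text \<open>The idea is to compare, for the conflicting vertex \<open>x\<^sub>0\<close>, its successor \<open>u\<close> and the vertex \<open>z\<close>
  opposite to \<open>u\<close>, the number of walks of length \<open>l - 1\<close> from \<open>x\<^sub>0\<close> to \<open>z\<close> with \<open>\<mu>\<close> times
  the number of walks of length \<open>l\<close> from \<open>u\<close> to \<open>z\<close>. If it is smaller, use that \<open>x\<^sub>0\<close> is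
  determined by \<open>u\<close> and the vertex it is in conflict with; otherwise forget the conflict.\<close>

lemma conflict_bound:
  fixes \<mu> \<Delta> :: real
  assumes l: "l \<ge> 2" and d: "1 \<le> d" "d \<le> l" and \<mu>: "\<mu> > 0"
    and deg: "\<And>v. v \<in> V \<Longrightarrow> card (nb v) \<le> \<Delta>"
    and inj: "\<And>v. v \<in> V \<Longrightarrow> inj_on \<pi> (nb v)"
  shows "card {xs \<in> closed_walks (2 * l). \<pi> (xs ! 0) = \<pi> (xs ! d)} \<le> \<mu> * h V l + \<Delta> / \<mu> * h V (l - 1)"
proof -
  \<comment> \<open>The candidates for \<open>xs ! 0\<close>, given the walk \<open>P\<close> from
    \<open>xs ! 1\<close> to \<open>xs ! (l + 1)\<close>. The index is \<open>d - 1\<close> because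
    \<open>P\<close> starts at \<open>xs ! 1\<close>; since \<open>d \<le> l\<close>, the vertex
    \<open>xs ! d\<close> lies on \<open>P\<close>.\<close>
  define cf where "cf P = {x \<in> nb (P ! 0). \<pi> x = \<pi> (P ! (d - 1))}" for P
  define D where "D = (SIGMA q:V \<times> V. SIGMA P:wl l (fst q) (snd q). SIGMA x:cf P. wl (l - 1) (snd q) x)"
  \<comment> \<open>The closed walk is cut at \<open>xs ! 1\<close>, at \<open>xs ! (l + 1)\<close>
    and at \<open>xs ! 0\<close> into walks of lengths \<open>l\<close> and \<open>l - 1\<close> and
    the edge from \<open>xs ! 0\<close> to \<open>xs ! 1\<close>.\<close>
  define G where "G xs = ((xs ! 1, xs ! (l + 1)), map (\<lambda>i. xs ! (i + 1)) [0..<Suc l], xs ! 0,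
      map (\<lambda>i. xs ! ((l + 1 + i) mod (2 * l))) [0..<l])" for xs :: "'v list"
  let ?T = "{xs \<in> closed_walks (2 * l). \<pi> (xs ! 0) = \<pi> (xs ! d)}"
  have fcf: "finite (cf P)" for P by (simp add: cf_def)
  have fD: "finite D"
    unfolding D_def using finite_V finite_wl fcf by (intro finite_SigmaI) auto
  have "G ` ?T \<subseteq> D"
  proof
    fix y assume "y \<in> G ` ?T"
    then obtain xs where xs: "length xs = 2 * l" "\<And>i. i < 2 * l \<Longrightarrow> {xs ! i, xs ! (Suc i mod (2 * l))} \<in> E"
      "\<pi> (xs ! 0) = \<pi> (xs ! d)" "y = G xs" "xs \<in> closed_walks (2 * l)" by (auto simp: closed_walks_def)
    have V: "xs ! i \<in> V" if "i < 2 * l" for i using closed_walks_sub[OF xs(5)] xs(1) that by auto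
    have step: "{xs ! i, xs ! Suc i} \<in> E" if "Suc i < 2 * l" for i using xs(2)[of i] that by simp
    have last: "{xs ! (2 * l - 1), xs ! 0} \<in> E" using xs(2)[of "2 * l - 1"] l by simp
    have "map (\<lambda>i. xs ! (i + 1)) [0..<Suc l] \<in> wl l (xs ! 1) (xs ! (l + 1))"
      using step l by (auto simp: wl_def simp del: upt_Suc)
    moreover have "xs ! 0 \<in> cf (map (\<lambda>i. xs ! (i + 1)) [0..<Suc l])"
      using xs(3) step[of 0] l d by (auto simp: cf_def nb_def insert_commute simp del: upt_Suc)
    moreover have "map (\<lambda>i. xs ! ((l + 1 + i) mod (2 * l))) [0..<l] \<in> wl (l - 1) (xs ! (l + 1)) (xs ! 0)"
    proof -
      have "{xs ! ((l + 1 + i) mod (2 * l)), xs ! ((l + 1 + Suc i) mod (2 * l))} \<in> E" if "i < l - 1" for i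
      proof (cases "l + 1 + Suc i = 2 * l")
        case True
        then have "l + 1 + i = 2 * l - 1" by simp
        then show ?thesis using last True l by simp
      next
        case False
        then show ?thesis using step[of "l + 1 + i"] that by simp
      qed
      moreover have "(l + 1 + (l - 1)) mod (2 * l) = 0" using l by (simp add: mult_2)
      ultimately show ?thesis using l by (auto simp: wl_def)
    qed
    ultimately show "y \<in> D" using V l xs(4) by (auto simp: D_def G_def simp del: upt_Suc)
  qed
  moreover have "inj_on G ?T"
  proof (rule inj_onI)
    fix xs ys assume *: "xs \<in> ?T" "ys \<in> ?T" "G xs = G ys"
    have ln: "length xs = 2 * l" "length ys = 2 * l" using * by (auto simp: closed_walks_def)
    have a: "xs ! (i + 1) = ys ! (i + 1)" if "i < Suc l" for i
      using *(3) that by (simp add: G_def del: upt_Suc)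
    have b: "xs ! ((l + 1 + i) mod (2 * l)) = ys ! ((l + 1 + i) mod (2 * l))" if "i < l" for i
      using *(3) that by (simp add: G_def del: upt_Suc)
    show "xs = ys"
    proof (rule nth_equalityI)
      fix i assume i: "i < length xs"
      consider "i = 0" | "1 \<le> i" "i \<le> l" | "l < i" by linarith
      then show "xs ! i = ys ! i"
      proof cases
        case 1
        then show ?thesis using *(3) by (simp add: G_def)
      next
        case 2
        then show ?thesis using a[of "i - 1"] by simp
      next
        case 3
        then show ?thesis using b[of "i - l - 1"] i ln by simp
      qed
    qed (use ln in simp)
  qed
  ultimately have "card ?T \<le> card D" using fD card_inj_on_le by blast
  also have "real (card D) = (\<Sum>q\<in>V \<times> V. \<Sum>P\<in>wl l (fst q) (snd q). \<Sum>x\<in>cf P. wk (l - 1) (snd q) x)"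
    unfolding D_def using finite_V finite_wl fcf by (simp add: card_wl)
  also have "\<dots> \<le> (\<Sum>q\<in>V \<times> V. \<mu> * (wk l (fst q) (snd q))\<^sup>2 + (1 / \<mu>) * (\<Sum>x\<in>nb (fst q). (wk (l - 1) (snd q) x)\<^sup>2))"
  proof (rule sum_mono)
    fix q assume q: "q \<in> V \<times> V"
    define u z where "u = fst q" and "z = snd q"
    define s where "s = wk l u z"
    have s: "0 \<le> s" by (simp add: s_def wk_nonneg)
    \<comment> \<open>Injectivity of \<pi> on the neighbourhood of \<open>u\<close> leaves at most
      one candidate. It pays \<mu> times \<open>s\<close> if it has few continuations; the
      neighbours with more continuations are summed regardless of the conflict, and for them
      \<open>s\<close> is less than \<open>wk (l - 1) z x / \<mu>\<close>.\<close>
    have bd: "(\<Sum>x\<in>cf P. wk (l - 1) z x) \<le> \<mu> * s + (\<Sum>x\<in>nb u. if \<mu> * s < wk (l - 1) z x then wk (l - 1) z x else 0)"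
      if P: "P \<in> wl l u z" for P
    proof -
      have P0: "P ! 0 = u" using P by (simp add: wl_def)
      have "u \<in> V" using q by (auto simp: u_def)
      then have "card (cf P) \<le> 1"
        using inj[of u] unfolding cf_def P0 unfolding One_nat_def by (subst card_le_Suc0_iff_eq) (auto simp: inj_on_def)
      then have one: "real (card (cf P)) * (\<mu> * s) \<le> 1 * (\<mu> * s)" using s \<mu> by (intro mult_right_mono) auto
      have "(\<Sum>x\<in>cf P. wk (l - 1) z x) \<le> (\<Sum>x\<in>cf P. \<mu> * s + (if \<mu> * s < wk (l - 1) z x then wk (l - 1) z x else 0))"
        using s \<mu> by (intro sum_mono) auto
      also have "\<dots> = card (cf P) * (\<mu> * s) + (\<Sum>x\<in>cf P. if \<mu> * s < wk (l - 1) z x then wk (l - 1) z x else 0)"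
        by (simp add: sum.distrib)
      also have "\<dots> \<le> 1 * (\<mu> * s) + (\<Sum>x\<in>nb u. if \<mu> * s < wk (l - 1) z x then wk (l - 1) z x else 0)"
        using P0 one by (intro add_mono sum_mono2) (auto simp: cf_def wk_nonneg)
      finally show ?thesis by simp
    qed
    have "(\<Sum>P\<in>wl l u z. \<Sum>x\<in>cf P. wk (l - 1) z x)
        \<le> (\<Sum>P\<in>wl l u z. \<mu> * s + (\<Sum>x\<in>nb u. if \<mu> * s < wk (l - 1) z x then wk (l - 1) z x else 0))"
      by (intro sum_mono bd)
    also have "\<dots> = \<mu> * s\<^sup>2 + (\<Sum>x\<in>nb u. s * (if \<mu> * s < wk (l - 1) z x then wk (l - 1) z x else 0))"
      by (simp add: card_wl s_def[symmetric] algebra_simps power2_eq_square sum_distrib_left)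
    also have "\<dots> \<le> \<mu> * s\<^sup>2 + (\<Sum>x\<in>nb u. (1 / \<mu>) * (wk (l - 1) z x)\<^sup>2)"
    proof (intro add_left_mono sum_mono)
      fix x
      show "s * (if \<mu> * s < wk (l - 1) z x then wk (l - 1) z x else 0) \<le> (1 / \<mu>) * (wk (l - 1) z x)\<^sup>2"
      proof (cases "\<mu> * s < wk (l - 1) z x")
        case True
        then have "s \<le> wk (l - 1) z x / \<mu>" using \<mu> by (simp add: field_simps)
        then have "s * wk (l - 1) z x \<le> wk (l - 1) z x / \<mu> * wk (l - 1) z x"
          by (intro mult_right_mono wk_nonneg)
        then show ?thesis using True by (simp add: power2_eq_square)
      qed (use \<mu> in simp)
    qed
    finally show "(\<Sum>P\<in>wl l (fst q) (snd q). \<Sum>x\<in>cf P. wk (l - 1) (snd q) x)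
        \<le> \<mu> * (wk l (fst q) (snd q))\<^sup>2 + (1 / \<mu>) * (\<Sum>x\<in>nb (fst q). (wk (l - 1) (snd q) x)\<^sup>2)"
      by (simp add: u_def z_def s_def sum_distrib_left)
  qed
  also have "\<dots> = \<mu> * h V l + (1 / \<mu>) * (\<Sum>q\<in>V \<times> V. \<Sum>x\<in>nb (fst q). (wk (l - 1) (snd q) x)\<^sup>2)"
    unfolding h_def sum.cartesian_product by (simp add: sum.distrib sum_distrib_left case_prod_unfold)
  also have "(\<Sum>q\<in>V \<times> V. \<Sum>x\<in>nb (fst q). (wk (l - 1) (snd q) x)\<^sup>2)
     = (\<Sum>u\<in>V. \<Sum>z\<in>V. \<Sum>x\<in>nb u. (wk (l - 1) z x)\<^sup>2)"
    using sum.cartesian_product[of "\<lambda>u z. \<Sum>x\<in>nb u. (wk (l - 1) z x)\<^sup>2" V V]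
    by (simp add: case_prod_unfold)
  also have "\<dots> = (\<Sum>u\<in>V. \<Sum>z\<in>V. \<Sum>x\<in>V. of_bool (x \<in> nb u) * (wk (l - 1) z x)\<^sup>2)"
    by (simp only: sum_nb)
  also have "\<dots> = (\<Sum>z\<in>V. \<Sum>x\<in>V. \<Sum>u\<in>V. of_bool (x \<in> nb u) * (wk (l - 1) z x)\<^sup>2)"
    by (subst sum.swap) (intro sum.cong refl sum.swap)
  \<comment> \<open>Each pair \<open>z\<close>, \<open>x\<close> was counted once for every
    neighbour \<open>u\<close> of \<open>x\<close>; this is the source of the factor
    \<Delta>.\<close>
  also have "\<dots> = (\<Sum>z\<in>V. \<Sum>x\<in>V. card (nb x) * (wk (l - 1) z x)\<^sup>2)"
  proof (intro sum.cong refl)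
    fix z x
    have "(\<Sum>u\<in>V. of_bool (x \<in> nb u) * (wk (l - 1) z x)\<^sup>2) = (\<Sum>u\<in>V. of_bool (u \<in> nb x) * (wk (l - 1) z x)\<^sup>2)"
      using nb_sym by (intro sum.cong) auto
    then show "(\<Sum>u\<in>V. of_bool (x \<in> nb u) * (wk (l - 1) z x)\<^sup>2) = card (nb x) * (wk (l - 1) z x)\<^sup>2"
      by (simp add: sum_nb[symmetric])
  qed
  also have "\<dots> \<le> (\<Sum>z\<in>V. \<Sum>x\<in>V. \<Delta> * (wk (l - 1) z x)\<^sup>2)"
    by (intro sum_mono mult_right_mono deg) auto
  also have "\<dots> = \<Delta> * h V (l - 1)" by (simp add: h_def sum_distrib_left)
  finally show ?thesis using \<mu> by (simp add: divide_right_mono)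
qed

lemma rotate_conflict:
  assumes "i < n" "d < n"
  shows "card {xs \<in> closed_walks n. \<pi> (xs ! i) = \<pi> (xs ! ((i + d) mod n))}
     \<le> card {xs \<in> closed_walks n. \<pi> (xs ! 0) = \<pi> (xs ! d)}"
proof (rule card_inj_on_le[of "rotate i"])
  show "inj_on (rotate i) {xs \<in> closed_walks n. \<pi> (xs ! i) = \<pi> (xs ! ((i + d) mod n))}"
  proof -
    have "inj (rotate i)" unfolding rotate_def by (induction i) (auto intro: inj_compose[OF inj_rotate1, unfolded comp_def])
    then show ?thesis by (rule inj_on_subset) simp
  qed
  show "finite {xs \<in> closed_walks n. \<pi> (xs ! 0) = \<pi> (xs ! d)}" using finite_closed_walks by simp
  show "rotate i ` {xs \<in> closed_walks n. \<pi> (xs ! i) = \<pi> (xs ! ((i + d) mod n))}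
      \<subseteq> {xs \<in> closed_walks n. \<pi> (xs ! 0) = \<pi> (xs ! d)}"
  proof
    fix ys assume "ys \<in> rotate i ` {xs \<in> closed_walks n. \<pi> (xs ! i) = \<pi> (xs ! ((i + d) mod n))}"
    then obtain xs where xs: "length xs = n" "\<And>j. j < n \<Longrightarrow> {xs ! j, xs ! (Suc j mod n)} \<in> E"
      "\<pi> (xs ! i) = \<pi> (xs ! ((i + d) mod n))" "ys = rotate i xs" by (auto simp: closed_walks_def)
    have n: "n > 0" using assms by simp
    have nth: "ys ! j = xs ! ((i + j) mod n)" if "j < n" for j using xs that by (simp add: nth_rotate)
    have "{ys ! j, ys ! (Suc j mod n)} \<in> E" if "j < n" for j
    proof -
      have "ys ! (Suc j mod n) = xs ! (Suc ((i + j) mod n) mod n)"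
        using nth[of "Suc j mod n"] n by (simp add: mod_simps)
      then show ?thesis using nth[OF that] xs(2)[of "(i + j) mod n"] n by simp
    qed
    moreover have "\<pi> (ys ! 0) = \<pi> (ys ! d)" using nth[of 0] nth[of d] xs(3) assms by simp
    ultimately show "ys \<in> {xs \<in> closed_walks n. \<pi> (xs ! 0) = \<pi> (xs ! d)}"
      using xs by (simp add: closed_walks_def)
  qed
qed

lemma conflict_free_walks:
  fixes \<Delta> :: real
  assumes l: "l \<ge> 2"
    and deg: "\<And>v. v \<in> V \<Longrightarrow> card (nb v) \<le> \<Delta>"
    and inj: "\<And>v. v \<in> V \<Longrightarrow> inj_on \<pi> (nb v)"
    and small: "64 * real l ^ 4 * \<Delta> * h V (l - 1) \<le> h V l"
  shows "h V l / 2 \<le> card {xs \<in> closed_walks (2 * l). distinct (map \<pi> xs)}"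
proof -
  let ?T = "\<lambda>i d. {xs \<in> closed_walks (2 * l). \<pi> (xs ! i) = \<pi> (xs ! ((i + d) mod (2 * l)))}"
  let ?B = "{xs \<in> closed_walks (2 * l). \<not> distinct (map \<pi> xs)}"
  \<comment> \<open>There are \<open>2 * l * l\<close> types of conflict. This \<mu> turns the first
    part of their total into a quarter of \<open>h V l\<close>, and the hypothesis
    \<open>small\<close> does the same for the second part.\<close>
  define \<mu> where "\<mu> = 1 / (8 * real l ^ 2)"
  have \<mu>: "\<mu> > 0" using l by (simp add: \<mu>_def)
  define M where "M = \<mu> * h V l + \<Delta> / \<mu> * h V (l - 1)"
  have T: "card (?T i d) \<le> M" if "i < 2 * l" "1 \<le> d" "d \<le> l" for i d
  proof -
    have "real (card (?T i d)) \<le> card {xs \<in> closed_walks (2 * l). \<pi> (xs ! 0) = \<pi> (xs ! d)}"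
      using rotate_conflict[of i "2 * l" d \<pi>] that l by (intro of_nat_mono) auto
    also have "\<dots> \<le> M" unfolding M_def by (rule conflict_bound[OF l _ _ \<mu> deg inj]) (use that in auto)
    finally show ?thesis .
  qed
  \<comment> \<open>Of the two arcs between conflicting positions, one has length at most
    \<open>l\<close>; going along it from the right starting point gives a pair \<open>i\<close>,
    \<open>d\<close>.\<close>
  have "?B \<subseteq> (\<Union>q\<in>{..<2 * l} \<times> {1..l}. ?T (fst q) (snd q))"
  proof
    fix xs assume xs: "xs \<in> ?B"
    then have ln: "length xs = 2 * l" by (simp add: closed_walks_def)
    from xs obtain i j where ij: "i < j" "j < 2 * l" "\<pi> (xs ! i) = \<pi> (xs ! j)"
      using ln by (auto simp: distinct_conv_nth) (metis linorder_neqE_nat)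
    show "xs \<in> (\<Union>q\<in>{..<2 * l} \<times> {1..l}. ?T (fst q) (snd q))"
    proof (cases "j - i \<le> l")
      case True
      have "(i + (j - i)) mod (2 * l) = j" using ij by simp
      then show ?thesis using xs ij True by (intro UN_I[of "(i, j - i)"]) auto
    next
      case False
      have "(j + (2 * l - (j - i))) mod (2 * l) = i"
      proof -
        have "j + (2 * l - (j - i)) = i + 2 * l" using ij by simp
        then show ?thesis using ij by simp
      qed
      then show ?thesis using xs ij False by (intro UN_I[of "(j, 2 * l - (j - i))"]) auto
    qed
  qed
  then have "card ?B \<le> card (\<Union>q\<in>{..<2 * l} \<times> {1..l}. ?T (fst q) (snd q))"
    using finite_closed_walks by (intro card_mono) auto
  also have "\<dots> \<le> (\<Sum>q\<in>{..<2 * l} \<times> {1..l}. card (?T (fst q) (snd q)))" by (rule card_UN_le) simp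
  finally have "real (card ?B) \<le> real (\<Sum>q\<in>{..<2 * l} \<times> {1..l}. card (?T (fst q) (snd q)))"
    by (rule of_nat_mono)
  also have "\<dots> = (\<Sum>q\<in>{..<2 * l} \<times> {1..l}. real (card (?T (fst q) (snd q))))"
    by (rule of_nat_sum)
  also have "\<dots> \<le> (\<Sum>q\<in>{..<2 * l} \<times> {1..l}. M)" by (intro sum_mono T) auto
  also have "\<dots> = 2 * real l ^ 2 * M" by (simp add: power2_eq_square)
  also have "\<dots> = h V l / 4 + (64 * real l ^ 4 * \<Delta> * h V (l - 1)) / 4"
    using l by (simp add: M_def \<mu>_def field_simps power2_eq_square power4_eq_xxxx)
  also have "\<dots> \<le> h V l / 2" using small by linarith
  finally have B: "real (card ?B) \<le> h V l / 2" .
  have "card (closed_walks (2 * l)) = card {xs \<in> closed_walks (2 * l). distinct (map \<pi> xs)} + card ?B"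
    using finite_closed_walks by (subst card_Un_disjoint[symmetric]) (auto intro: arg_cong[where f = card])
  moreover have "h V l \<le> card (closed_walks (2 * l))" using l by (intro card_closed_walks) auto
  ultimately show ?thesis using B by simp
qed

end

section \<open>Cycles modulo a projection\<close>

definition cycle_edges :: "'v list \<Rightarrow> 'v set set" where
  "cycle_edges xs = (\<lambda>i. {xs ! i, xs ! (Suc i mod length xs)}) ` {..<length xs}"

text \<open>A cycle is identified with its edge set, independently of starting point and direction.
  Distinctness is required after \<pi> because the vertices will be clones, and the cycle has to
  survive when clones of the same vertex are merged.\<close>

definition is_cycle :: "('v \<Rightarrow> 'a) \<Rightarrow> nat \<Rightarrow> 'v set set \<Rightarrow> 'v set set \<Rightarrow> bool" where
  "is_cycle \<pi> k E c \<longleftrightarrow> (\<exists>xs. length xs = k \<and> distinct (map \<pi> xs) \<and> c = cycle_edges xs \<and> c \<subseteq> E)"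

lemma Union_cycle_edges: "\<Union> (cycle_edges xs) = set xs"
proof
  show "\<Union> (cycle_edges xs) \<subseteq> set xs"
    by (auto simp: cycle_edges_def) (metis mod_less_divisor not_less_zero nth_mem gr0I)
  show "set xs \<subseteq> \<Union> (cycle_edges xs)"
    by (auto simp: cycle_edges_def in_set_conv_nth)
qed

text \<open>The quantity \<rho> = \<open>N ^ 2 / (card U * card W)\<close> is the product of the
  average degrees of the two sides. Since the squared norms \<open>g m\<close> of the walk counts
  from \<open>U\<close> form a log-convex sequence whose first ratio is at least \<rho>, there are
  at least \<open>\<rho> ^ l\<close> closed walks of length \<open>2 * l\<close> from
  \<open>U\<close>. The hypothesis \<open>small\<close> makes the walks of length
  \<open>2 * l - 2\<close> so few that at least half of the closed walks are free of
  conflicts.\<close>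

lemma many_cycles:
  fixes \<pi> :: "'v \<Rightarrow> 'a" and \<Delta> :: real and E :: "'v set set"
  defines "N \<equiv> real (card E)"
  assumes l: "l \<ge> 2" and fin: "finite U" "finite W" and disj: "U \<inter> W = {}"
    and E: "\<And>e. e \<in> E \<Longrightarrow> \<exists>u\<in>U. \<exists>w\<in>W. e = {u, w}" and ne: "E \<noteq> {}"
    and inj: "inj_on ((`) \<pi>) E"
    and deg: "\<And>v. v \<in> U \<union> W \<Longrightarrow> card {e \<in> E. v \<in> e} \<le> \<Delta>"
    and small: "(64 * real l ^ 4 * \<Delta>) ^ l * card U \<le> (N\<^sup>2 / (real (card U) * card W)) ^ l"
  shows "(N\<^sup>2 / (real (card U) * card W)) ^ l / (2 * real l) ^ (2 * l) \<le> card {c. is_cycle \<pi> (2 * l) E c}"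
proof -
  define V where "V = U \<union> W"
  interpret finite_graph V E
  proof
    show "finite V" using fin by (simp add: V_def)
    show "u \<in> V" if "{u, v} \<in> E" for u v using E[OF that] by (auto simp: V_def doubleton_eq_iff)
  qed
  have UV: "U \<subseteq> V" "W \<subseteq> V" by (auto simp: V_def)
  have fE: "finite E"
    by (rule finite_subset[of _ "Pow V"]) (use E fin in \<open>auto simp: V_def\<close>)
  have nbU: "nb u \<subseteq> W" if "u \<in> U" for u
    using E disj that by (fastforce simp: nb_def doubleton_eq_iff)
  have nbW: "nb u \<subseteq> U" if "u \<in> W" for u
    using E disj that by (fastforce simp: nb_def doubleton_eq_iff)
  have nbdeg: "card (nb v) = card {e \<in> E. v \<in> e}" for v
  proof (rule bij_betw_same_card[of "\<lambda>z. {v, z}"])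
    show "bij_betw (\<lambda>z. {v, z}) (nb v) {e \<in> E. v \<in> e}"
      unfolding bij_betw_def
    proof
      show "inj_on (\<lambda>z. {v, z}) (nb v)" by (auto simp: inj_on_def doubleton_eq_iff)
      show "(\<lambda>z. {v, z}) ` nb v = {e \<in> E. v \<in> e}"
      proof
        show "(\<lambda>z. {v, z}) ` nb v \<subseteq> {e \<in> E. v \<in> e}" by (auto simp: nb_def)
        show "{e \<in> E. v \<in> e} \<subseteq> (\<lambda>z. {v, z}) ` nb v"
        proof
          fix e assume e: "e \<in> {e \<in> E. v \<in> e}"
          then obtain u w where "e = {u, w}" using E by blast
          then obtain z where "e = {v, z}" using e by auto
          then show "e \<in> (\<lambda>z. {v, z}) ` nb v" using e by (auto simp: nb_def)
        qed
      qed
    qed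
  qed
  have degV: "card (nb v) \<le> \<Delta>" if "v \<in> V" for v using deg that by (simp add: nbdeg V_def)
  have injnb: "inj_on \<pi> (nb v)" for v
  proof (rule inj_onI)
    fix x y assume *: "x \<in> nb v" "y \<in> nb v" "\<pi> x = \<pi> y"
    then have "\<pi> ` {v, x} = \<pi> ` {v, y}" "{v, x} \<in> E" "{v, y} \<in> E" by (auto simp: nb_def)
    then have "{v, x} = {v, y}" using inj by (meson inj_onD)
    then show "x = y" by (auto simp: doubleton_eq_iff)
  qed
  have N: "N > 0" using ne fE by (simp add: N_def card_gt_0_iff)
  have UWne: "card U > 0" "card W > 0" using ne E fin by (fastforce simp: card_gt_0_iff)+
  have sumW: "(\<Sum>w\<in>W. real (card (nb w))) = N"
  proof -
    have "card E = (\<Sum>w\<in>W. card {e \<in> E. w \<in> e})"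
    proof -
      have "E = (\<Union>w\<in>W. {e \<in> E. w \<in> e})" using E by fastforce
      then have "card E = card (\<Union>w\<in>W. {e \<in> E. w \<in> e})" by simp
      also have "\<dots> = (\<Sum>w\<in>W. card {e \<in> E. w \<in> e})"
        using fin fE E disj by (intro card_UN_disjoint) (simp_all, fastforce)
      finally show ?thesis .
    qed
    then show ?thesis by (simp add: N_def nbdeg)
  qed
  define \<rho> where "\<rho> = N\<^sup>2 / (real (card U) * card W)"
  have \<rho>: "\<rho> > 0" using N UWne by (simp add: \<rho>_def)
  define g where "g m = (\<Sum>z\<in>V. (fl U m z)\<^sup>2)" for m
  have g0: "g 0 = card U"
  proof -
    have "fl U 0 z = of_bool (z \<in> U)" for z
    proof -
      have "fl U 0 z = (\<Sum>u\<in>U. if u = z then 1 else 0)" by (simp add: fl_def of_bool_def)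
      then show ?thesis using fin by simp
    qed
    then have "g 0 = (\<Sum>z\<in>V. if z \<in> U then 1 else 0)"
      unfolding g_def by (intro sum.cong) auto
    also have "\<dots> = (\<Sum>z\<in>U. 1)" using finite_V UV by (simp add: sum.If_cases Int_absorb1 Int_absorb2)
    finally show ?thesis by simp
  qed
  have g1: "N\<^sup>2 / card W \<le> g 1"
  proof -
    have f1: "fl U 1 w = card (nb w)" if "w \<in> W" for w
    proof -
      have "fl U 1 w = (\<Sum>u\<in>U. \<Sum>z\<in>nb u. if z = w then 1 else 0)" by (simp add: fl_def of_bool_def)
      also have "\<dots> = (\<Sum>u\<in>U. of_bool (u \<in> nb w))" using nb_sym by (intro sum.cong) auto
      also have "\<dots> = card (nb w)" using nbW[OF that] fin by (simp add: sum.If_cases of_bool_def Int_absorb1 Int_absorb2)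
      finally show ?thesis .
    qed
    have "N\<^sup>2 = (\<Sum>w\<in>W. 1 * fl U 1 w)\<^sup>2" using sumW f1 by simp
    also have "\<dots> \<le> (\<Sum>w\<in>W. 1\<^sup>2) * (\<Sum>w\<in>W. (fl U 1 w)\<^sup>2)" by (rule Cauchy_Schwarz_ineq_sum)
    also have "(\<Sum>w\<in>W. (fl U 1 w)\<^sup>2) \<le> g 1" unfolding g_def using finite_V UV by (intro sum_mono2) auto
    finally have "N\<^sup>2 \<le> card W * g 1" using UWne by (simp add: mult_left_mono)
    then show ?thesis using UWne by (simp add: field_simps)
  qed
  have "0 < N\<^sup>2 / card W" using N UWne by simp
  then have g1p: "0 < g 1" using g1 by linarith
  have glc: "(g (Suc m))\<^sup>2 \<le> g m * g (Suc (Suc m))" for m unfolding g_def by (rule fl_logconvex[OF UV(1)])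
  have hU: "\<rho> ^ m \<le> h U m" for m
  proof -
    have "\<rho> = (N\<^sup>2 / card W) / card U" by (simp add: \<rho>_def)
    also have "\<dots> \<le> g 1 / g 0" unfolding g0 using g1 by (intro divide_right_mono) auto
    finally have "\<rho> \<le> g 1 / g 0" .
    then have "card U * \<rho> ^ m \<le> g 0 * (g 1 / g 0) ^ m" unfolding g0 using \<rho> by (intro mult_left_mono power_mono) auto
    also have "\<dots> \<le> g m" using UWne g1p glc by (intro logconvex_lower) (auto simp: g0)
    also have "\<dots> \<le> card U * h U m" unfolding g_def by (rule fl_le_h[OF fin(1)])
    finally show ?thesis using UWne by simp
  qed
  have hpos: "0 < h U m" for m using hU[of m] \<rho> by (meson less_le_trans zero_less_power)
  have h0: "h U 0 = card U"
  proof -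
    have "h U 0 = (\<Sum>u\<in>U. \<Sum>z\<in>V. if z = u then 1 else 0)" unfolding h_def by (intro sum.cong) auto
    also have "\<dots> = (\<Sum>u\<in>U. 1)" using finite_V UV by (intro sum.cong) auto
    finally show ?thesis by simp
  qed
  \<comment> \<open>Cyclicity of the trace: moving the base point along the first edge exchanges the
    two sides.\<close>
  have hUW: "h W m = h U m" if "m \<ge> 1" for m
  proof -
    define k where "k = 2 * m - 1"
    have k: "2 * m = Suc k" using that by (simp add: k_def)
    have "h U m = (\<Sum>u\<in>U. \<Sum>z\<in>nb u. wk k z u)" by (simp add: h_trace[OF UV(1)] k)
    also have "\<dots> = (\<Sum>u\<in>U. \<Sum>z\<in>W. of_bool (z \<in> nb u) * wk k z u)"
    proof (rule sum.cong[OF refl])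
      fix u assume "u \<in> U"
      then show "(\<Sum>z\<in>nb u. wk k z u) = (\<Sum>z\<in>W. of_bool (z \<in> nb u) * wk k z u)"
        using nbU fin by (intro sum.mono_neutral_cong_left) auto
    qed
    also have "\<dots> = (\<Sum>z\<in>W. \<Sum>u\<in>U. of_bool (z \<in> nb u) * wk k z u)" by (rule sum.swap)
    also have "\<dots> = (\<Sum>z\<in>W. \<Sum>u\<in>U. of_bool (u \<in> nb z) * wk k u z)"
    proof (intro sum.cong refl)
      fix z u assume "z \<in> W" "u \<in> U"
      then have "wk k z u = wk k u z" using UV by (intro wk_sym) auto
      then show "of_bool (z \<in> nb u) * wk k z u = of_bool (u \<in> nb z) * wk k u z"
        using nb_sym[of z u] by simp
    qed
    also have "\<dots> = (\<Sum>z\<in>W. \<Sum>u\<in>nb z. wk k u z)"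
    proof (rule sum.cong[OF refl])
      fix z assume "z \<in> W"
      then show "(\<Sum>u\<in>U. of_bool (u \<in> nb z) * wk k u z) = (\<Sum>u\<in>nb z. wk k u z)"
        using nbW fin by (intro sum.mono_neutral_cong_right) auto
    qed
    also have "\<dots> = h W m" by (simp add: h_trace[OF UV(2)] k)
    finally show ?thesis by simp
  qed
  have hV: "h V m = 2 * h U m" if "m \<ge> 1" for m
  proof -
    have "h V m = h U m + h W m" unfolding h_def
      using fin disj by (subst sum.union_disjoint[symmetric]) (auto simp: V_def)
    then show ?thesis using hUW[OF that] by simp
  qed
  \<comment> \<open>After taking \<open>l\<close>-th powers, \<open>logconvex_pow\<close> gives
    \<open>h U (l - 1) ^ l \<le> card U * h U l ^ (l - 1)\<close>, and \<open>small\<close> supplies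
    the remaining factor \<open>\<rho> ^ l \<le> h U l\<close>.\<close>
  have "64 * real l ^ 4 * \<Delta> * h U (l - 1) \<le> h U l"
  proof -
    obtain l' where l': "l = Suc l'" using l by (cases l) auto
    obtain w where "w \<in> W" using UWne by (auto simp: card_gt_0_iff)
    then have \<Delta>: "0 \<le> \<Delta>" using degV[of w] UV by (meson of_nat_0_le_iff order_trans subsetD)
    have "h U l' ^ Suc l' \<le> h U 0 * h U (Suc l') ^ l'"
      using hpos h_logconvex[OF UV(1)] by (intro logconvex_pow) auto
    then have hp: "h U (l - 1) ^ l \<le> card U * h U l ^ (l - 1)" by (simp add: l' h0)
    have "(64 * real l ^ 4 * \<Delta> * h U (l - 1)) ^ l = (64 * real l ^ 4 * \<Delta>) ^ l * h U (l - 1) ^ l"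
      by (rule power_mult_distrib)
    also have "\<dots> \<le> (64 * real l ^ 4 * \<Delta>) ^ l * (card U * h U l ^ (l - 1))"
      using hp \<Delta> by (intro mult_left_mono) auto
    also have "\<dots> = ((64 * real l ^ 4 * \<Delta>) ^ l * card U) * h U l ^ (l - 1)" by simp
    also have "\<dots> \<le> \<rho> ^ l * h U l ^ (l - 1)"
      using small hpos[of l] by (intro mult_right_mono) (auto simp: \<rho>_def)
    also have "\<dots> \<le> h U l * h U l ^ (l - 1)" using hU hpos[of l] by (intro mult_right_mono) auto
    also have "\<dots> = h U l ^ l" by (simp add: l')
    finally have le: "(64 * real l ^ 4 * \<Delta> * h U (l - 1)) ^ l \<le> h U l ^ l" .
    show ?thesis by (rule power_le_imp_le_base[of _ l']) (use le hpos[of l] in \<open>auto simp: l'\<close>)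
  qed
  then have "64 * real l ^ 4 * \<Delta> * h V (l - 1) \<le> h V l"
  proof -
    have a: "h V l = 2 * h U l" "h V (l - 1) = 2 * h U (l - 1)" using l by (intro hV; simp)+
    show ?thesis unfolding a using \<open>64 * real l ^ 4 * \<Delta> * h U (l - 1) \<le> h U l\<close> by linarith
  qed
  from conflict_free_walks[OF l degV injnb this]
  have cw: "h U l \<le> card {xs \<in> closed_walks (2 * l). distinct (map \<pi> xs)}" using hV[of l] l by simp
  let ?G = "{xs \<in> closed_walks (2 * l). distinct (map \<pi> xs)}"
  have fG: "finite ?G" using finite_closed_walks by simp
  have im: "cycle_edges ` ?G \<subseteq> {c. is_cycle \<pi> (2 * l) E c}"
    by (auto simp: is_cycle_def closed_walks_def cycle_edges_def intro!: exI)
  have fC: "finite {c. is_cycle \<pi> (2 * l) E c}"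
    by (rule finite_subset[of _ "Pow E"]) (use fE in \<open>auto simp: is_cycle_def\<close>)
  \<comment> \<open>The edge set determines the vertex set, so a list has at most
    \<open>2 * l\<close> choices for each entry.\<close>
  have fib: "card {xs \<in> ?G. cycle_edges xs = c} \<le> (2 * l) ^ (2 * l)" if "c \<in> cycle_edges ` ?G" for c
  proof -
    obtain ys where ys: "ys \<in> ?G" "c = cycle_edges ys" using \<open>c \<in> cycle_edges ` ?G\<close> by blast
    have ly: "length ys = 2 * l" using ys by (simp add: closed_walks_def)
    have "{xs \<in> ?G. cycle_edges xs = c} \<subseteq> {xs. set xs \<subseteq> set ys \<and> length xs = 2 * l}"
    proof
      fix xs assume xs: "xs \<in> {xs \<in> ?G. cycle_edges xs = c}"
      then have "set xs = set ys" using ys(2) Union_cycle_edges[of xs] Union_cycle_edges[of ys] by simp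
      with xs show "xs \<in> {xs. set xs \<subseteq> set ys \<and> length xs = 2 * l}" by (simp add: closed_walks_def)
    qed
    then have "card {xs \<in> ?G. cycle_edges xs = c} \<le> card {xs. set xs \<subseteq> set ys \<and> length xs = 2 * l}"
      by (intro card_mono finite_lists_length_eq) auto
    also have "\<dots> = card (set ys) ^ (2 * l)" by (rule card_lists_length_eq) simp
    also have "\<dots> \<le> (2 * l) ^ (2 * l)" using card_length[of ys] ly by (intro power_mono) auto
    finally show ?thesis .
  qed
  have "card ?G = (\<Sum>c\<in>cycle_edges ` ?G. card {xs \<in> ?G. cycle_edges xs = c})"
    using sum.image_gen[OF fG, of "\<lambda>_. 1::nat" cycle_edges] by simp
  also have "\<dots> \<le> card (cycle_edges ` ?G) * (2 * l) ^ (2 * l)"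
    using fib by (metis (no_types, lifting) sum_bounded_above of_nat_id)
  also have "\<dots> \<le> card {c. is_cycle \<pi> (2 * l) E c} * (2 * l) ^ (2 * l)"
    using im fC by (intro mult_right_mono card_mono) auto
  finally have "real (card ?G) \<le> real (card {c. is_cycle \<pi> (2 * l) E c} * (2 * l) ^ (2 * l))"
    by (rule of_nat_mono)
  then have "\<rho> ^ l \<le> card {c. is_cycle \<pi> (2 * l) E c} * (2 * real l) ^ (2 * l)"
    using cw hU[of l] by simp
  moreover have "0 < (2 * real l) ^ (2 * l)" using l by simp
  ultimately show ?thesis by (simp only: \<rho>_def pos_divide_le_eq)
qed

section \<open>Expectations over a random set that contains each vertex independently with
  probability \<open>p\<close>\<close>

definition sample_mean :: "real \<Rightarrow> 'v set \<Rightarrow> ('v set \<Rightarrow> real) \<Rightarrow> real" where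
  "sample_mean p V f = (\<Sum>R\<in>Pow V. p ^ card R * (1 - p) ^ card (V - R) * f R)"

text \<open>Expanding a product over the vertices with factors \<open>p + (1 - p)\<close> outside
  \<open>S\<close> and \<open>p + 0\<close> inside; the zero kills every \<open>R\<close> that
  misses a vertex of \<open>S\<close>.\<close>

lemma sample_mean_subset:
  assumes "finite V" "S \<subseteq> V"
  shows "sample_mean p V (\<lambda>R. of_bool (S \<subseteq> R)) = p ^ card S"
proof -
  let ?g = "\<lambda>x. if x \<in> S then 0 else 1 - p"
  have "(\<Prod>x\<in>V. p + ?g x) = (\<Prod>x\<in>V. if x \<in> S then p else 1)" by (intro prod.cong) auto
  also have "\<dots> = p ^ card S" using assms by (simp add: prod.If_cases Int_absorb1)
  finally have "p ^ card S = (\<Sum>R\<in>Pow V. prod (\<lambda>_. p) R * prod ?g (V - R))"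
    using prod_add[OF assms(1), of "\<lambda>_. p" ?g] by simp
  also have "\<dots> = sample_mean p V (\<lambda>R. of_bool (S \<subseteq> R))"
    unfolding sample_mean_def
  proof (intro sum.cong refl)
    fix R assume R: "R \<in> Pow V"
    have "prod ?g (V - R) = (1 - p) ^ card (V - R) * of_bool (S \<subseteq> R)"
    proof (cases "S \<subseteq> R")
      case True
      then have "prod ?g (V - R) = (\<Prod>x\<in>V - R. 1 - p)" by (intro prod.cong) auto
      then show ?thesis using True by simp
    next
      case False
      then obtain x where "x \<in> S" "x \<notin> R" by blast
      then have "prod ?g (V - R) = 0" using assms by (intro prod_zero) auto
      then show ?thesis using False by simp
    qed
    then show "prod (\<lambda>_. p) R * prod ?g (V - R) = p ^ card R * (1 - p) ^ card (V - R) * of_bool (S \<subseteq> R)"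
      by simp
  qed
  finally show ?thesis by simp
qed

lemma sample_mean_card:
  assumes "finite V" "finite I" "\<And>i. i \<in> I \<Longrightarrow> s i \<subseteq> V"
  shows "sample_mean p V (\<lambda>R. real (card {i \<in> I. s i \<subseteq> R})) = (\<Sum>i\<in>I. p ^ card (s i))"
proof -
  have "real (card {i \<in> I. s i \<subseteq> R}) = (\<Sum>i\<in>I. of_bool (s i \<subseteq> R))" for R
    using assms(2) by (simp add: of_bool_def sum.If_cases Int_def)
  then have "sample_mean p V (\<lambda>R. real (card {i \<in> I. s i \<subseteq> R}))
     = (\<Sum>R\<in>Pow V. \<Sum>i\<in>I. p ^ card R * (1 - p) ^ card (V - R) * of_bool (s i \<subseteq> R))"
    by (simp add: sample_mean_def sum_distrib_left)
  also have "\<dots> = (\<Sum>i\<in>I. sample_mean p V (\<lambda>R. of_bool (s i \<subseteq> R)))"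
    unfolding sample_mean_def by (rule sum.swap)
  also have "\<dots> = (\<Sum>i\<in>I. p ^ card (s i))"
    using assms by (intro sum.cong refl sample_mean_subset) auto
  finally show ?thesis .
qed

lemma sample_mean_diff: "sample_mean p V (\<lambda>R. f R - g R) = sample_mean p V f - sample_mean p V g"
  by (simp add: sample_mean_def sum_subtractf right_diff_distrib)

lemma sample_mean_cmult: "sample_mean p V (\<lambda>R. c * f R) = c * sample_mean p V f"
  by (simp add: sample_mean_def sum_distrib_left mult_ac)

lemma sample_mean_attained:
  assumes "finite V" "0 \<le> p" "p \<le> 1" "c \<le> sample_mean p V f"
  obtains R where "R \<subseteq> V" "c \<le> f R"
proof -
  have "\<exists>R\<subseteq>V. c \<le> f R"
  proof (rule ccontr)
    assume *: "\<not> ?thesis"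
    have tot: "(\<Sum>R\<in>Pow V. p ^ card R * (1 - p) ^ card (V - R)) = 1"
      using sample_mean_subset[OF assms(1), of "{}" p] by (simp add: sample_mean_def)
    have le: "p ^ card R * (1 - p) ^ card (V - R) * f R \<le> p ^ card R * (1 - p) ^ card (V - R) * c"
      if "R \<in> Pow V" for R
      using * that assms by (intro mult_left_mono) auto
    have "\<exists>R\<in>Pow V. p ^ card R * (1 - p) ^ card (V - R) \<noteq> 0"
    proof (rule ccontr)
      assume "\<not> ?thesis"
      then have "(\<Sum>R\<in>Pow V. p ^ card R * (1 - p) ^ card (V - R)) = 0" by (intro sum.neutral) auto
      then show False using tot by simp
    qed
    then obtain R where R: "R \<in> Pow V" "p ^ card R * (1 - p) ^ card (V - R) \<noteq> 0" by blast
    have "0 \<le> p ^ card R * (1 - p) ^ card (V - R)" using assms by simp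
    then have "0 < p ^ card R * (1 - p) ^ card (V - R)" using R(2) by linarith
    moreover have "f R < c" using * R(1) by (meson PowD not_le)
    ultimately have "p ^ card R * (1 - p) ^ card (V - R) * f R < p ^ card R * (1 - p) ^ card (V - R) * c"
      by (rule mult_strict_left_mono[rotated])
    then have "sample_mean p V f < (\<Sum>R\<in>Pow V. p ^ card R * (1 - p) ^ card (V - R) * c)"
      unfolding sample_mean_def using R(1) le assms(1) by (intro sum_strict_mono_ex1) auto
    also have "\<dots> = c" using tot by (simp add: sum_distrib_right[symmetric])
    finally show False using assms(4) by simp
  qed
  then show ?thesis using that by blast
qed

lemma cycle_edges_card:
  assumes "distinct xs" "length xs \<ge> 3"
  shows "card (cycle_edges xs) = length xs"
proof -
  let ?n = "length xs"
  have "inj_on (\<lambda>i. {xs ! i, xs ! (Suc i mod ?n)}) {..<?n}"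
  proof (rule inj_onI)
    fix i j assume *: "i \<in> {..<?n}" "j \<in> {..<?n}"
      "{xs ! i, xs ! (Suc i mod ?n)} = {xs ! j, xs ! (Suc j mod ?n)}"
    then have n: "?n > 0" by auto
    have "i = j \<or> (i = Suc j mod ?n \<and> j = Suc i mod ?n)"
      using * assms(1) n by (auto simp: doubleton_eq_iff nth_eq_iff_index_eq)
    then show "i = j"
      using * assms(2) by (auto simp: mod_Suc split: if_splits)
  qed
  then show ?thesis by (simp add: cycle_edges_def card_image)
qed

text \<open>A nonempty set of positions closed under the cyclic successor is everything. The
  positions of \<sigma> are therefore not closed, and their successors add at least one vertex. This
  is the one extra factor \<open>p\<close> that makes saturated sets rarer than edges.\<close>

lemma cycle_edges_span:
  assumes "distinct xs" "\<sigma> \<subset> cycle_edges xs" "\<sigma> \<noteq> {}"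
  shows "card \<sigma> + 1 \<le> card (\<Union> \<sigma>)"
proof -
  let ?n = "length xs" and ?s = "\<lambda>i. Suc i mod length xs"
  define I where "I = {i. i < ?n \<and> {xs ! i, xs ! ?s i} \<in> \<sigma>}"
  have \<sigma>: "\<sigma> = (\<lambda>i. {xs ! i, xs ! ?s i}) ` I"
    using assms(2) by (auto simp: I_def cycle_edges_def)
  have I: "I \<noteq> {}" "I \<subseteq> {..<?n}" "finite I"
  proof -
    show "I \<noteq> {}" using assms(3) \<sigma> by (metis image_empty)
    show "I \<subseteq> {..<?n}" by (auto simp: I_def)
    then show "finite I" by (rule finite_subset) simp
  qed
  then have n: "?n > 0" by auto
  have "\<not> ?s ` I \<subseteq> I"
  proof
    assume cl: "?s ` I \<subseteq> I"
    obtain i0 where i0: "i0 \<in> I" using I by blast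
    have all: "(i0 + k) mod ?n \<in> I" for k
    proof (induction k)
      case 0
      then show ?case using i0 I(2) by auto
    next
      case (Suc k)
      then have "?s ((i0 + k) mod ?n) \<in> I" using cl by blast
      then show ?case by (simp add: mod_Suc_eq)
    qed
    have "j \<in> I" if "j < ?n" for j
    proof -
      have "i0 < ?n" using i0 I(2) by auto
      then have "(i0 + (?n - i0 + j)) mod ?n = j" using that by simp
      then show ?thesis using all by metis
    qed
    then have "I = {..<?n}" using I(2) by auto
    then show False using \<sigma> assms(2) by (auto simp: cycle_edges_def)
  qed
  then have "I \<subset> I \<union> ?s ` I" by blast
  then have "card I < card (I \<union> ?s ` I)" using I(3) by (intro psubset_card_mono) auto
  also have "\<dots> = card ((!) xs ` (I \<union> ?s ` I))"
  proof (rule card_image[symmetric])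
    have "I \<union> ?s ` I \<subseteq> {..<?n}" using I(2) n by auto
    then show "inj_on ((!) xs) (I \<union> ?s ` I)" using assms(1) by (intro inj_on_nth) auto
  qed
  also have "(!) xs ` (I \<union> ?s ` I) = \<Union> \<sigma>" by (auto simp: \<sigma>)
  finally show ?thesis using \<sigma> card_image_le[OF I(3)] by (metis Suc_eq_plus1 Suc_leI le_less_trans)
qed

text \<open>These pair counts play the role of second moments. A pair spanning three vertices has
  probability \<open>p ^ 3\<close>; the pairs that span only the edge itself contribute
  \<open>p ^ 2\<close> per edge and are absorbed because \<open>p * x\<close> and
  \<open>p * N / x\<close> are at least 1.\<close>

lemma sample_side:
  fixes E :: "'v set set" and x p :: real
  defines "N \<equiv> real (card E)"
  assumes fin: "finite V" "finite S" "finite E" and SV: "S \<subseteq> V" and EV: "\<And>e. e \<in> E \<Longrightarrow> e \<subseteq> V"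
    and E2: "\<And>e. e \<in> E \<Longrightarrow> card e = 2" and E1: "\<And>e. e \<in> E \<Longrightarrow> card (e \<inter> S) = 1"
    and cS: "card S \<le> 2 * x" and deg: "\<And>u. u \<in> S \<Longrightarrow> card {e \<in> E. u \<in> e} \<le> 2 * N / x"
    and x: "x > 0" and p: "0 < p" "p \<le> 1" and px: "1 \<le> p * x" and pN: "1 \<le> p * N / x"
  shows "sample_mean p V (\<lambda>R. real (card {i \<in> E \<times> S. fst i \<union> {snd i} \<subseteq> R})) \<le> 3 * p\<^sup>2 * N * (p * x)"
    and "sample_mean p V (\<lambda>R. real (card {i \<in> (SIGMA e:E. SIGMA u:e \<inter> S. {e' \<in> E. u \<in> e'}).
            fst i \<union> snd (snd i) \<subseteq> R})) \<le> 3 * p\<^sup>2 * N * (p * N / x)"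
proof -
  have fe: "finite e" if "e \<in> E" for e using EV[OF that] fin(1) finite_subset by blast
  have "sample_mean p V (\<lambda>R. real (card {i \<in> E \<times> S. fst i \<union> {snd i} \<subseteq> R}))
      = (\<Sum>i\<in>E \<times> S. p ^ card (fst i \<union> {snd i}))"
    using fin SV by (intro sample_mean_card) (auto dest: EV[THEN subsetD])
  also have "\<dots> = (\<Sum>e\<in>E. \<Sum>u\<in>S. p ^ card (e \<union> {u}))"
    using sum.cartesian_product[of "\<lambda>e u. p ^ card (e \<union> {u})" S E] by (simp add: case_prod_unfold)
  also have "\<dots> \<le> (\<Sum>e\<in>E. p\<^sup>2 + 2 * x * p ^ 3)"
  proof (rule sum_mono)
    fix e assume e: "e \<in> E"
    have "(\<Sum>u\<in>S. p ^ card (e \<union> {u})) = (\<Sum>u\<in>S. if u \<in> e then p\<^sup>2 else p ^ 3)"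
      using E2[OF e] fe[OF e] by (intro sum.cong refl) (auto simp: insert_absorb)
    also have "\<dots> = card (S \<inter> e) * p\<^sup>2 + card (S \<inter> - e) * p ^ 3"
      using fin by (simp add: sum.If_cases Collect_mem_eq Collect_neg_eq)
    also have "\<dots> \<le> 1 * p\<^sup>2 + (2 * x) * p ^ 3"
    proof (intro add_mono mult_right_mono)
      show "real (card (S \<inter> e)) \<le> 1" using E1[OF e] by (simp add: Int_commute)
      have "real (card (S \<inter> - e)) \<le> card S" using fin by (intro of_nat_mono card_mono) auto
      then show "real (card (S \<inter> - e)) \<le> 2 * x" using cS by linarith
    qed (use p in auto)
    finally show "(\<Sum>u\<in>S. p ^ card (e \<union> {u})) \<le> p\<^sup>2 + 2 * x * p ^ 3" by simp
  qed
  also have "\<dots> = N * p\<^sup>2 * (1 + 2 * (p * x))" by (simp add: N_def algebra_simps power2_eq_square power3_eq_cube)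
  also have "\<dots> \<le> N * p\<^sup>2 * (3 * (p * x))" using px by (intro mult_left_mono) (auto simp: N_def)
  finally show "sample_mean p V (\<lambda>R. real (card {i \<in> E \<times> S. fst i \<union> {snd i} \<subseteq> R})) \<le> 3 * p\<^sup>2 * N * (p * x)"
    by (simp add: mult_ac)
  let ?I = "SIGMA e:E. SIGMA u:e \<inter> S. {e' \<in> E. u \<in> e'}"
  have "sample_mean p V (\<lambda>R. real (card {i \<in> ?I. fst i \<union> snd (snd i) \<subseteq> R}))
     = (\<Sum>i\<in>?I. p ^ card (fst i \<union> snd (snd i)))"
    using fin by (intro sample_mean_card finite_SigmaI) (auto dest: EV[THEN subsetD])
  also have "\<dots> = (\<Sum>e\<in>E. \<Sum>u\<in>e \<inter> S. \<Sum>e'\<in>{e' \<in> E. u \<in> e'}. p ^ card (e \<union> e'))"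
  proof -
    have "(\<Sum>i\<in>?I. p ^ card (fst i \<union> snd (snd i)))
        = (\<Sum>e\<in>E. \<Sum>j\<in>(SIGMA u:e \<inter> S. {e' \<in> E. u \<in> e'}). p ^ card (e \<union> snd j))"
      using fin by (subst sum.Sigma) (auto simp: case_prod_unfold)
    also have "\<dots> = (\<Sum>e\<in>E. \<Sum>u\<in>e \<inter> S. \<Sum>e'\<in>{e' \<in> E. u \<in> e'}. p ^ card (e \<union> e'))"
      using fin by (intro sum.cong refl) (subst sum.Sigma, auto simp: case_prod_unfold)
    finally show ?thesis .
  qed
  also have "\<dots> \<le> (\<Sum>e\<in>E. p\<^sup>2 + 2 * N / x * p ^ 3)"
  proof (rule sum_mono)
    fix e assume e: "e \<in> E"
    obtain u where u: "e \<inter> S = {u}" using E1[OF e] by (auto simp: card_1_singleton_iff)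
    have "p ^ card (e \<union> e') \<le> (if e' = e then p\<^sup>2 else 0) + p ^ 3" if "e' \<in> {e' \<in> E. u \<in> e'}" for e'
    proof (cases "e' = e")
      case False
      have e': "card e' = 2" "finite e'" using that E2 fe by auto
      have "\<not> e' \<subseteq> e" using card_subset_eq[OF fe[OF e], of e'] E2[OF e] e' False by auto
      then have "card e < card (e \<union> e')" using fe[OF e] e' by (intro psubset_card_mono) auto
      then have "p ^ card (e \<union> e') \<le> p ^ 3" using p E2[OF e] by (intro power_decreasing) auto
      then show ?thesis using False by simp
    qed (use E2[OF e] p in auto)
    then have "(\<Sum>e'\<in>{e' \<in> E. u \<in> e'}. p ^ card (e \<union> e'))
       \<le> (\<Sum>e'\<in>{e' \<in> E. u \<in> e'}. (if e' = e then p\<^sup>2 else 0) + p ^ 3)" by (rule sum_mono)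
    also have "\<dots> \<le> p\<^sup>2 + card {e' \<in> E. u \<in> e'} * p ^ 3"
      using fin by (simp add: sum.distrib)
    also have "\<dots> \<le> p\<^sup>2 + 2 * N / x * p ^ 3"
      using deg[of u] u p by (intro add_left_mono mult_right_mono) auto
    finally show "(\<Sum>u\<in>e \<inter> S. \<Sum>e'\<in>{e' \<in> E. u \<in> e'}. p ^ card (e \<union> e')) \<le> p\<^sup>2 + 2 * N / x * p ^ 3"
      by (simp add: u)
  qed
  also have "\<dots> = N * p\<^sup>2 * (1 + 2 * (p * N / x))" by (simp add: N_def algebra_simps power2_eq_square power3_eq_cube)
  also have "\<dots> \<le> N * p\<^sup>2 * (3 * (p * N / x))" using pN by (intro mult_left_mono) (auto simp: N_def)
  finally show "sample_mean p V (\<lambda>R. real (card {i \<in> ?I. fst i \<union> snd (snd i) \<subseteq> R})) \<le> 3 * p\<^sup>2 * N * (p * N / x)"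
    by (simp add: mult_ac)
qed

text \<open>Markov's inequality for degrees inside \<open>R\<close>: an edge with an end of degree
  above \<open>T\<close> on the side \<open>S\<close> occurs in more than \<open>T\<close> of the
  counted pairs.\<close>

lemma high_degree_edges:
  fixes E :: "'v set set" and T :: real
  assumes fin: "finite E" and E1: "\<And>e. e \<in> E \<Longrightarrow> card (e \<inter> S) = 1"
  shows "card {e \<in> E. e \<subseteq> R \<and> (\<exists>u\<in>e \<inter> S. T < card {e' \<in> E. u \<in> e' \<and> e' \<subseteq> R})} * T
    \<le> card {i \<in> (SIGMA e:E. SIGMA u:e \<inter> S. {e' \<in> E. u \<in> e'}). fst i \<union> snd (snd i) \<subseteq> R}"
proof -
  let ?X = "{e \<in> E. e \<subseteq> R \<and> (\<exists>u\<in>e \<inter> S. T < card {e' \<in> E. u \<in> e' \<and> e' \<subseteq> R})}"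
  let ?d = "\<lambda>u. {e' \<in> E. u \<in> e' \<and> e' \<subseteq> R}"
  have fS: "finite (e \<inter> S)" if "e \<in> E" for e using E1[OF that] by (metis card.infinite zero_neq_one)
  have "card ?X * T = (\<Sum>e\<in>?X. T)" by simp
  also have "\<dots> \<le> (\<Sum>e\<in>?X. \<Sum>u\<in>e \<inter> S. real (card (?d u)))"
  proof (rule sum_mono)
    fix e assume e: "e \<in> ?X"
    then obtain u where u: "u \<in> e \<inter> S" "T < card (?d u)" by blast
    have "real (card (?d u)) \<le> (\<Sum>u\<in>e \<inter> S. real (card (?d u)))"
      using u(1) fS e by (intro member_le_sum) auto
    then show "T \<le> (\<Sum>u\<in>e \<inter> S. real (card (?d u)))" using u(2) by linarith
  qed
  also have "\<dots> = card (SIGMA e:?X. SIGMA u:e \<inter> S. ?d u)"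
    using fin fS by (subst card_SigmaI) (auto simp: card_SigmaI)
  also have "\<dots> \<le> card {i \<in> (SIGMA e:E. SIGMA u:e \<inter> S. {e' \<in> E. u \<in> e'}). fst i \<union> snd (snd i) \<subseteq> R}"
  proof (intro of_nat_mono card_mono)
    have "finite (SIGMA e:E. SIGMA u:e \<inter> S. {e' \<in> E. u \<in> e'})" using fin fS by (intro finite_SigmaI) auto
    then show "finite {i \<in> (SIGMA e:E. SIGMA u:e \<inter> S. {e' \<in> E. u \<in> e'}). fst i \<union> snd (snd i) \<subseteq> R}" by simp
  qed auto
  finally show ?thesis .
qed

section \<open>Balanced families of even cycles\<close>

lemma real_pow_ge1: "1 \<le> x" if "1 \<le> x ^ n" "0 \<le> x" "n > 0" for x :: real
  using that by (metis not_le power_less_one_iff)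

text \<open>A random vertex set of density \<open>p\<close> has sides of order \<open>p * a\<close>
  and \<open>p * b\<close> and about \<open>p ^ 2 * card E\<close> edges. For these parameters the
  hypothesis of \<open>many_cycles\<close> reads, up to constants,
  \<open>a * b ^ l \<le> p ^ (l - 1) * card E ^ l\<close>, and this is the condition imposed with
  \<open>C0\<close>.\<close>

lemma balanced_cycles:
  fixes l :: nat
  assumes l: "l \<ge> 2"
  shows "\<exists>c0>0::real. \<exists>C0\<ge>1::real. \<exists>K0\<ge>1::real.
    \<forall>(U :: 'v set) W E (\<pi> :: 'v \<Rightarrow> 'a) (a :: real) (b :: real) (p :: real).
     finite U \<and> finite W \<and> U \<inter> W = {} \<and> (\<forall>e\<in>E. \<exists>u\<in>U. \<exists>w\<in>W. e = {u, w}) \<and>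
     inj_on ((`) \<pi>) E \<and> 0 < a \<and> a \<le> b \<and> real (card U) \<le> 2 * a \<and> real (card W) \<le> 2 * b \<and>
     (\<forall>u\<in>U. real (card {e \<in> E. u \<in> e}) \<le> 2 * card E / a) \<and>
     (\<forall>w\<in>W. real (card {e \<in> E. w \<in> e}) \<le> 2 * card E / b) \<and>
     real (card E) \<le> a * b \<and> 0 < p \<and> p \<le> 1 \<and> C0 * a * b ^ l \<le> p ^ (l - 1) * real (card E) ^ l \<longrightarrow>
     (\<exists>\<C>. \<C> \<subseteq> {c. is_cycle \<pi> (2 * l) E c} \<and>
        c0 * ((real (card E))\<^sup>2 / (a * b)) ^ l \<le> card \<C> \<and>
        (\<forall>\<sigma>. \<sigma> \<subseteq> E \<and> \<sigma> \<noteq> {} \<and> card \<sigma> < 2 * l \<longrightarrow>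
            real (card {c \<in> \<C>. \<sigma> \<subseteq> c}) \<le> K0 * p ^ (card \<sigma> - 1) * card \<C> / card E))"
proof -
  define M0 :: real where "M0 = 60"
  define K1 :: real where "K1 = 20 * 4 ^ l"
  define c0 :: real where "c0 = 1 / (20 * M0\<^sup>2 * (4 * M0\<^sup>2) ^ l * (2 * real l) ^ (2 * l))"
  define C0 :: real where "C0 = (256 * real l ^ 4 * M0 ^ 3) ^ l * M0 + 2 / (K1 * c0) + 1"
  have c0: "c0 > 0" using l by (simp add: c0_def M0_def)
  have "(1::real) \<le> 4 ^ l" by (rule one_le_power) simp
  then have K1: "K1 \<ge> 1" unfolding K1_def by linarith
  have "0 < 2 / (K1 * c0)" using c0 K1 by simp
  moreover have "0 \<le> (256 * real l ^ 4 * M0 ^ 3) ^ l * M0" by (simp add: M0_def)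
  ultimately have C0: "C0 \<ge> 1" "(256 * real l ^ 4 * M0 ^ 3) ^ l * M0 \<le> C0" "2 / (K1 * c0) \<le> C0"
    unfolding C0_def by linarith+
  have main: "\<exists>\<C>. \<C> \<subseteq> {c. is_cycle \<pi> (2 * l) E c} \<and>
        c0 * ((real (card E))\<^sup>2 / (a * b)) ^ l \<le> card \<C> \<and>
        (\<forall>\<sigma>. \<sigma> \<subseteq> E \<and> \<sigma> \<noteq> {} \<and> card \<sigma> < 2 * l \<longrightarrow>
            real (card {c \<in> \<C>. \<sigma> \<subseteq> c}) \<le> K1 * p ^ (card \<sigma> - 1) * card \<C> / card E)"
    if fin: "finite U" "finite W" and disj: "U \<inter> W = {}" and E: "\<forall>e\<in>E. \<exists>u\<in>U. \<exists>w\<in>W. e = {u, w}"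
      and inj: "inj_on ((`) \<pi>) E" and ab: "0 < a" "a \<le> b" and cU: "real (card U) \<le> 2 * a"
      and cW: "real (card W) \<le> 2 * b"
      and dU: "\<forall>u\<in>U. real (card {e \<in> E. u \<in> e}) \<le> 2 * card E / a"
      and dW: "\<forall>w\<in>W. real (card {e \<in> E. w \<in> e}) \<le> 2 * card E / b"
      and Nab: "real (card E) \<le> a * b" and p: "0 < p" "p \<le> 1"
      and pc: "C0 * a * b ^ l \<le> p ^ (l - 1) * real (card E) ^ l"
    for U W :: "'v set" and E and \<pi> :: "'v \<Rightarrow> 'a" and a b p :: real
  proof -
    define N where "N = real (card E)"
    define V where "V = U \<union> W"
    have fV: "finite V" using fin by (simp add: V_def)
    have fE: "finite E" by (rule finite_subset[of _ "Pow V"]) (use E fin in \<open>auto simp: V_def\<close>)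
    have b: "b > 0" using ab by simp
    have EV: "e \<subseteq> V" "card e = 2" "card (e \<inter> U) = 1" "card (e \<inter> W) = 1" if eE: "e \<in> E" for e
    proof -
      obtain u w where "u \<in> U" "w \<in> W" "e = {u, w}" using E eE by blast
      moreover have "u \<noteq> w" "u \<notin> W" "w \<notin> U" using calculation disj by auto
      moreover have "e \<inter> U = {u}" "e \<inter> W = {w}" using calculation by auto
      ultimately show "e \<subseteq> V" "card e = 2" "card (e \<inter> U) = 1" "card (e \<inter> W) = 1" by (auto simp: V_def)
    qed
    have ablpos: "0 < a * b ^ l" using ab b by simp
    have pc1: "a * b ^ l \<le> p ^ (l - 1) * N ^ l"
    proof -
      have "1 * (a * b ^ l) \<le> C0 * (a * b ^ l)" using C0(1) ablpos by (intro mult_right_mono) auto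
      then show ?thesis using pc by (simp add: N_def mult_ac)
    qed
    have N: "N > 0"
    proof (rule ccontr)
      assume "\<not> N > 0"
      then have "N = 0" by (simp add: N_def)
      then show False using pc1 ablpos l by (simp add: power_0_left)
    qed
    obtain l' where l': "l = Suc l'" "l' > 0" using l by (cases l) auto
    \<comment> \<open>Together with \<open>N \<le> a * b\<close>, the condition on \<open>p\<close>
      forces the expected sizes and degrees to be bounded below, as \<open>sample_side\<close>
      requires.\<close>
    have pa: "1 \<le> p * a"
    proof -
      have "a * b ^ l \<le> p ^ l' * (a * b) ^ l"
      proof -
        have "p ^ (l - 1) * N ^ l \<le> p ^ (l - 1) * (a * b) ^ l"
          using Nab p N by (intro mult_left_mono power_mono) (auto simp: N_def)
        then show ?thesis using pc1 by (simp add: l')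
      qed
      then have "(a * b ^ l) * 1 \<le> (a * b ^ l) * (p * a) ^ l'"
        by (simp add: l' power_mult_distrib mult_ac)
      then have "1 \<le> (p * a) ^ l'" using ablpos mult_le_cancel_left_pos by blast
      then show ?thesis by (rule real_pow_ge1) (use p ab l' in auto)
    qed
    have pb: "1 \<le> p * b" using pa ab p mult_left_mono[of a b p] by linarith
    have pNb: "b \<le> p * N"
    proof -
      have "a * b ^ l \<le> (p * N) ^ l' * N" using pc1 by (simp add: l' power_mult_distrib mult_ac)
      also have "\<dots> \<le> (p * N) ^ l' * (a * b)" using Nab p N by (intro mult_left_mono) (auto simp: N_def)
      finally have "(a * b) * b ^ l' \<le> (a * b) * (p * N) ^ l'" by (simp add: l' mult_ac)
      then have "b ^ l' \<le> (p * N) ^ l'" using ab b by simp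
      then show ?thesis using p N b l' by (metis power_mono_iff less_imp_le mult_pos_pos)
    qed
    have pN: "1 \<le> p * N / a" "1 \<le> p * N / b" using pNb ab b by (auto simp: field_simps)
    define M where "M = c0 * (N\<^sup>2 / (a * b)) ^ l"
    have M: "M > 0" using c0 N ab b by (simp add: M_def)
    \<comment> \<open>The caps use the target size \<open>M\<close> in place of the current size of
      the family, so that they stay fixed while the family grows.\<close>
    define cap where "cap j = K1 * p ^ (j - 1) * M / N" for j :: nat
    \<comment> \<open>A set whose cap would be exceeded by one more cycle then lies in some cycle of
      the family already, and its degree is at least half of its cap. The extreme case is
      \<open>j = 2 * l - 1\<close>.\<close>
    have cap2: "2 \<le> cap j" if "j < 2 * l" for j
    proof -
      have "(C0 * a * b ^ l)\<^sup>2 \<le> (p ^ (l - 1) * N ^ l)\<^sup>2"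
        using pc C0 ab b by (intro power_mono) (auto simp: N_def)
      also have "\<dots> = p ^ (2 * l - 2) * (N\<^sup>2) ^ l"
        by (simp add: power_mult_distrib power_mult[symmetric] mult_ac diff_mult_distrib2)
      finally have 1: "C0\<^sup>2 * (a * b ^ l)\<^sup>2 \<le> p ^ (2 * l - 2) * (N\<^sup>2) ^ l" by (simp add: power_mult_distrib mult_ac)
      have 2: "(a * b) ^ l * N \<le> (a * b ^ l)\<^sup>2"
      proof -
        have "(a * b) ^ l * N \<le> (a * b) ^ l * (a * b)" using Nab ab b by (intro mult_left_mono) (auto simp: N_def)
        also have "\<dots> = a\<^sup>2 * b\<^sup>2 * (a ^ l' * b ^ l')" by (simp add: l' power_mult_distrib power2_eq_square mult_ac)
        also have "\<dots> \<le> a\<^sup>2 * b\<^sup>2 * (b ^ l' * b ^ l')" using ab b by (intro mult_left_mono mult_right_mono power_mono) auto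
        also have "\<dots> = (a * b ^ l)\<^sup>2" by (simp add: l' power2_eq_square mult_ac)
        finally show ?thesis .
      qed
      have 3: "2 / (K1 * c0) \<le> C0\<^sup>2"
      proof -
        have "C0 * 1 \<le> C0 * C0" using C0(1) by (intro mult_left_mono) auto
        then show ?thesis using C0(3) by (simp add: power2_eq_square)
      qed
      have "2 / (K1 * c0) * ((a * b) ^ l * N) \<le> C0\<^sup>2 * (a * b ^ l)\<^sup>2"
        using 2 3 c0 K1 ab b N by (intro mult_mono) auto
      also have "\<dots> \<le> p ^ (2 * l - 2) * (N\<^sup>2) ^ l" by (rule 1)
      also have "\<dots> \<le> p ^ (j - 1) * (N\<^sup>2) ^ l"
        using p that by (intro mult_right_mono power_decreasing) auto
      finally have "2 / (K1 * c0) * ((a * b) ^ l * N) \<le> p ^ (j - 1) * (N\<^sup>2) ^ l" .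
      then have "2 \<le> K1 * c0 * (p ^ (j - 1) * (N\<^sup>2) ^ l) / ((a * b) ^ l * N)"
        using c0 K1 ab b N by (simp add: field_simps)
      also have "\<dots> = cap j" by (simp add: cap_def M_def power_divide)
      finally show ?thesis .
    qed
    define valid where "valid \<C> \<longleftrightarrow> \<C> \<subseteq> {c. is_cycle \<pi> (2 * l) E c} \<and>
        (\<forall>\<sigma>. \<sigma> \<subseteq> E \<and> \<sigma> \<noteq> {} \<and> card \<sigma> < 2 * l \<longrightarrow> real (card {c \<in> \<C>. \<sigma> \<subseteq> c}) \<le> cap (card \<sigma>))" for \<C>
    have cycE: "c \<subseteq> E" if "is_cycle \<pi> (2 * l) E c" for c using that by (auto simp: is_cycle_def)
    have fcyc: "finite {c. is_cycle \<pi> (2 * l) E c}"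
      by (rule finite_subset[of _ "Pow E"]) (use fE cycE in auto)
    have fval: "finite {\<C>. valid \<C>}"
      by (rule finite_subset[of _ "Pow {c. is_cycle \<pi> (2 * l) E c}"]) (use fcyc in \<open>auto simp: valid_def\<close>)
    have "0 \<le> cap j" for j using K1 p M N by (simp add: cap_def)
    then have "valid {}" by (simp add: valid_def)
    then have "card ` {\<C>. valid \<C>} \<noteq> {}" by blast
    then have "Max (card ` {\<C>. valid \<C>}) \<in> card ` {\<C>. valid \<C>}" using fval by (intro Max_in) auto
    then obtain \<C> where \<C>: "valid \<C>" and "card \<C> = Max (card ` {\<C>. valid \<C>})" by auto
    then have max: "card \<D> \<le> card \<C>" if "valid \<D>" for \<D>
      using fval Max_ge[of "card ` {\<C>. valid \<C>}" "card \<D>"] that by simp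
    have f\<C>: "finite \<C>" using \<C> fcyc finite_subset by (auto simp: valid_def)
    have "M \<le> card \<C>"
    proof (rule ccontr)
      assume "\<not> M \<le> card \<C>"
      then have small: "card \<C> < M" by simp
      define dg where "dg \<sigma> = card {c \<in> \<C>. \<sigma> \<subseteq> c}" for \<sigma>
      define F where "F = {\<sigma>. \<sigma> \<subseteq> E \<and> \<sigma> \<noteq> {} \<and> card \<sigma> < 2 * l \<and> cap (card \<sigma>) < dg \<sigma> + 1}"
      have fF: "finite F" by (rule finite_subset[of _ "Pow E"]) (use fE in \<open>auto simp: F_def\<close>)
      have cyc: "\<exists>xs. length xs = 2 * l \<and> distinct xs \<and> c = cycle_edges xs" if "c \<in> \<C>" for c
        using \<C> that by (auto simp: valid_def is_cycle_def distinct_map)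
      have Ccard: "card c = 2 * l" "card (\<Union> c) = 2 * l" if "c \<in> \<C>" for c
        using cyc[OF that] l by (auto simp: cycle_edges_card Union_cycle_edges distinct_card)
      have fc: "finite c" if "c \<in> \<C>" for c using Ccard(1)[OF that] l by (intro card_ge_0_finite) auto
      \<comment> \<open>A saturated set with \<open>j\<close> edges spans at least
        \<open>j + 1\<close> vertices and survives with probability at most
        \<open>p ^ 2 * p ^ (j - 1)\<close>; the last factor cancels against the one in its cap. The
        degrees sum to at most \<open>4 ^ l * M\<close>, as a cycle has \<open>4 ^ l\<close>
        subsets, and \<open>K1 = 20 * 4 ^ l\<close> leaves a tenth of
        \<open>p ^ 2 * N\<close>.\<close>
      have Fsum: "(\<Sum>\<sigma>\<in>F. p ^ card (\<Union> \<sigma>)) \<le> p\<^sup>2 * N / 10"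
      proof -
        have "(\<Sum>\<sigma>\<in>F. real (dg \<sigma>)) = (\<Sum>\<sigma>\<in>F. \<Sum>c\<in>\<C>. of_bool (\<sigma> \<subseteq> c))"
          using f\<C> by (simp add: dg_def of_bool_def sum.If_cases Int_def)
        also have "\<dots> = (\<Sum>c\<in>\<C>. \<Sum>\<sigma>\<in>F. of_bool (\<sigma> \<subseteq> c))" by (rule sum.swap)
        also have "\<dots> \<le> (\<Sum>c\<in>\<C>. 4 ^ l)"
        proof (rule sum_mono)
          fix c assume c: "c \<in> \<C>"
          have "(\<Sum>\<sigma>\<in>F. of_bool (\<sigma> \<subseteq> c)) = real (card (F \<inter> Pow c))"
            using fF by (simp add: of_bool_def sum.If_cases Pow_def)
          also have "\<dots> \<le> card (Pow c)" using fc[OF c] by (intro of_nat_mono card_mono) auto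
          also have "\<dots> = 4 ^ l" using fc[OF c] Ccard[OF c] by (simp add: card_Pow power_mult)
          finally show "(\<Sum>\<sigma>\<in>F. of_bool (\<sigma> \<subseteq> c)) \<le> (4 ^ l :: real)" .
        qed
        also have "\<dots> = real (card \<C>) * 4 ^ l" by simp
        also have "\<dots> \<le> M * 4 ^ l" using small by (intro mult_right_mono) auto
        finally have dgs: "(\<Sum>\<sigma>\<in>F. real (dg \<sigma>)) \<le> M * 4 ^ l" .
        have "(\<Sum>\<sigma>\<in>F. p ^ card (\<Union> \<sigma>)) \<le> (\<Sum>\<sigma>\<in>F. (2 * p\<^sup>2 * N / (K1 * M)) * dg \<sigma>)"
        proof (rule sum_mono)
          fix \<sigma> assume \<sigma>: "\<sigma> \<in> F"
          then have cap: "2 \<le> cap (card \<sigma>)" "cap (card \<sigma>) < dg \<sigma> + 1" using cap2 by (auto simp: F_def)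
          then have "0 < dg \<sigma>" by linarith
          then obtain c where c: "c \<in> \<C>" "\<sigma> \<subseteq> c" by (auto simp: dg_def card_gt_0_iff)
          obtain xs where xs: "distinct xs" "c = cycle_edges xs" using cyc[OF c(1)] by blast
          have "\<sigma> \<noteq> c" using \<sigma> Ccard[OF c(1)] by (auto simp: F_def)
          then have "card \<sigma> + 1 \<le> card (\<Union> \<sigma>)"
            using c \<sigma> xs by (intro cycle_edges_span[OF xs(1)]) (auto simp: F_def)
          then have "p ^ card (\<Union> \<sigma>) \<le> p ^ (card \<sigma> + 1)" using p by (intro power_decreasing) auto
          also have "\<dots> = p ^ (card \<sigma> + 1) * 1" by simp
          also have "\<dots> \<le> p ^ (card \<sigma> + 1) * (2 * dg \<sigma> / cap (card \<sigma>))"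
            using p cap by (intro mult_left_mono) (auto simp: field_simps)
          also have "\<dots> = (2 * p\<^sup>2 * N / (K1 * M)) * dg \<sigma>"
          proof -
            have "finite \<sigma>" "\<sigma> \<noteq> {}" using \<sigma> fE finite_subset by (auto simp: F_def)
            then obtain j where j: "card \<sigma> = Suc j" by (cases "card \<sigma>") auto
            show ?thesis using p N M K1 by (simp add: cap_def j power2_eq_square field_simps)
          qed
          finally show "p ^ card (\<Union> \<sigma>) \<le> (2 * p\<^sup>2 * N / (K1 * M)) * dg \<sigma>" .
        qed
        also have "\<dots> = (2 * p\<^sup>2 * N / (K1 * M)) * (\<Sum>\<sigma>\<in>F. real (dg \<sigma>))" by (simp add: sum_distrib_left)
        also have "\<dots> \<le> (2 * p\<^sup>2 * N / (K1 * M)) * (M * 4 ^ l)"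
          using dgs p N M K1 by (intro mult_left_mono) auto
        also have "\<dots> = p\<^sup>2 * N / 10" using M by (simp add: K1_def)
        finally show ?thesis .
      qed
      define eR where "eR R = real (card {e \<in> E. e \<subseteq> R})" for R
      define nS where "nS S R = real (card {i \<in> E \<times> S. fst i \<union> {snd i} \<subseteq> R})" for S R
      define qS where "qS S R = real (card {i \<in> (SIGMA e:E. SIGMA u:e \<inter> S. {e' \<in> E. u \<in> e'}).
            fst i \<union> snd (snd i) \<subseteq> R})" for S R
      define fR where "fR R = real (card {\<sigma> \<in> F. \<Union> \<sigma> \<subseteq> R})" for R
      define cR where "cR R = real (card {c \<in> \<C>. \<Union> c \<subseteq> R})" for R
      \<comment> \<open>Normalised so that a family with fewer than \<open>M\<close> cycles costs at
        most a tenth of \<open>p ^ 2 * N\<close> in expectation.\<close>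
      define \<mu> where "\<mu> = p\<^sup>2 * N / (10 * p ^ (2 * l) * M)"
      have \<mu>: "\<mu> > 0" using p N M by (simp add: \<mu>_def)
      \<comment> \<open>A set \<open>R\<close> on which \<open>Z\<close> is at least half of the expected number of edges satisfies all the
        required bounds at once, so that no concentration is needed.\<close>
      define Z where "Z R = eR R - 1 / (M0 * p * a) * nS U R - 1 / (M0 * p * b) * nS W R
          - 1 / (M0 * p * N / a) * qS U R - 1 / (M0 * p * N / b) * qS W R - fR R - \<mu> * cR R" for R
      have m1: "sample_mean p V eR = p\<^sup>2 * N"
        unfolding eR_def using fV fE EV by (subst sample_mean_card) (auto simp: N_def)
      have UV: "U \<subseteq> V" "W \<subseteq> V" by (auto simp: V_def)
      note sU = sample_side[OF fV fin(1) fE UV(1) EV(1) EV(2) EV(3) cU _ ab(1) p pa pN(1)[unfolded N_def]]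
      note sW = sample_side[OF fV fin(2) fE UV(2) EV(1) EV(2) EV(4) cW _ b p pb pN(2)[unfolded N_def]]
      have half: "1 / (M0 * y) * x \<le> p\<^sup>2 * N / 20" if "x \<le> 3 * p\<^sup>2 * N * y" "y > 0" for x y
        using that by (simp add: M0_def field_simps)
      have m2: "1 / (M0 * p * a) * sample_mean p V (nS U) \<le> p\<^sup>2 * N / 20"
        using half[OF sU(1)[folded N_def]] dU p ab unfolding nS_def N_def by (simp add: mult.assoc)
      have m3: "1 / (M0 * p * b) * sample_mean p V (nS W) \<le> p\<^sup>2 * N / 20"
        using half[OF sW(1)[folded N_def]] dW p b unfolding nS_def N_def by (simp add: mult.assoc)
      have m4: "1 / (M0 * p * N / a) * sample_mean p V (qS U) \<le> p\<^sup>2 * N / 20"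
        using half[OF sU(2)[folded N_def]] dU p ab N unfolding qS_def N_def by (simp add: mult.assoc)
      have m5: "1 / (M0 * p * N / b) * sample_mean p V (qS W) \<le> p\<^sup>2 * N / 20"
        using half[OF sW(2)[folded N_def]] dW p b N unfolding qS_def N_def by (simp add: mult.assoc)
      have m6: "sample_mean p V fR \<le> p\<^sup>2 * N / 10"
      proof -
        have "\<Union> \<sigma> \<subseteq> V" if "\<sigma> \<in> F" for \<sigma> using that EV(1) by (auto simp: F_def)
        then have "sample_mean p V fR = (\<Sum>\<sigma>\<in>F. p ^ card (\<Union> \<sigma>))"
          unfolding fR_def using fV fF by (intro sample_mean_card) auto
        then show ?thesis using Fsum by simp
      qed
      have m7: "\<mu> * sample_mean p V cR \<le> p\<^sup>2 * N / 10"
      proof -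
        have "\<Union> c \<subseteq> V" if "c \<in> \<C>" for c using that \<C> cycE EV(1) by (fastforce simp: valid_def)
        then have "sample_mean p V cR = (\<Sum>c\<in>\<C>. p ^ card (\<Union> c))"
          unfolding cR_def using fV f\<C> by (intro sample_mean_card) auto
        also have "\<dots> = card \<C> * p ^ (2 * l)" using Ccard by simp
        also have "\<dots> \<le> M * p ^ (2 * l)" using small p by (intro mult_right_mono) auto
        finally have "\<mu> * sample_mean p V cR \<le> \<mu> * (M * p ^ (2 * l))" using \<mu> by (intro mult_left_mono) auto
        also have "\<dots> = p\<^sup>2 * N / 10" using M p by (simp add: \<mu>_def)
        finally show ?thesis .
      qed
      have "sample_mean p V Z = p\<^sup>2 * N - 1 / (M0 * p * a) * sample_mean p V (nS U)
          - 1 / (M0 * p * b) * sample_mean p V (nS W)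
          - 1 / (M0 * p * N / a) * sample_mean p V (qS U) - 1 / (M0 * p * N / b) * sample_mean p V (qS W)
          - sample_mean p V fR - \<mu> * sample_mean p V cR"
        unfolding Z_def sample_mean_diff sample_mean_cmult m1 by simp
      then have "p\<^sup>2 * N / 2 \<le> sample_mean p V Z"
      proof -
        \<comment> \<open>The losses amount to \<open>4/20 + 2/10 = 2/5\<close> of \<open>q\<close>,
          which is less than one half.\<close>
        have "q / 2 \<le> z" if "z = q - x2 - x3 - x4 - x5 - x6 - x7" "x2 \<le> q / 20" "x3 \<le> q / 20"
          "x4 \<le> q / 20" "x5 \<le> q / 20" "x6 \<le> q / 10" "x7 \<le> q / 10" "0 < q" for z q x2 x3 x4 x5 x6 x7 :: real
          using that by linarith
        from this[OF \<open>sample_mean p V Z = _\<close> m2 m3 m4 m5 m6 m7] show ?thesis using p N by simp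
      qed
      then obtain R where R: "R \<subseteq> V" "p\<^sup>2 * N / 2 \<le> Z R"
        using sample_mean_attained[OF fV less_imp_le[OF p(1)] p(2)] by metis
      define q where "q = p\<^sup>2 * N"
      have q: "q > 0" using p N by (simp add: q_def)
      define TU TW where "TU = M0 * p * N / a" and "TW = M0 * p * N / b"
      have T: "0 < TU" "0 < TW" "TW \<le> TU"
        using p N ab b by (auto simp: TU_def TW_def M0_def frac_le)
      define X where "X S T = {e \<in> E. e \<subseteq> R \<and> (\<exists>u\<in>e \<inter> S. T < card {e' \<in> E. u \<in> e' \<and> e' \<subseteq> R})}" for S and T :: real
      have XU: "card (X U TU) \<le> 1 / TU * qS U R"
        using high_degree_edges[OF fE EV(3), where R = R and T = TU] T by (simp add: X_def qS_def field_simps)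
      have XW: "card (X W TW) \<le> 1 / TW * qS W R"
        using high_degree_edges[OF fE EV(4), where R = R and T = TW] T by (simp add: X_def qS_def field_simps)
      define pick where "pick \<sigma> = (SOME e. e \<in> \<sigma>)" for \<sigma> :: "'v set set"
      define FR where "FR = {\<sigma> \<in> F. \<Union> \<sigma> \<subseteq> R}"
      \<comment> \<open>Removing one edge from every saturated set inside \<open>R\<close> ensures
        that no cycle in \<open>E'\<close> contains a saturated set. The other deletions bound the
        degrees.\<close>
      define E' where "E' = {e \<in> E. e \<subseteq> R} - (X U TU \<union> X W TW \<union> pick ` FR)"
      have fin': "finite (X U TU)" "finite (X W TW)" "finite FR" "finite E'"
        using fE fF by (auto simp: X_def FR_def E'_def)
      have nn: "0 \<le> nS S R" "0 \<le> qS S R" "0 \<le> fR R" "0 \<le> cR R" "0 \<le> eR R" for S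
        by (auto simp: nS_def qS_def fR_def cR_def eR_def)
      \<comment> \<open>The count of pairs factorises. Hence positivity of the edge count minus this
        term alone bounds the number of vertices of \<open>S\<close> in \<open>R\<close>.\<close>
      have nS': "nS S R = eR R * card (S \<inter> R)" for S
      proof -
        have "{i \<in> E \<times> S. fst i \<union> {snd i} \<subseteq> R} = {e \<in> E. e \<subseteq> R} \<times> (S \<inter> R)" by auto
        then show ?thesis by (simp add: nS_def eR_def card_cartesian_product)
      qed
      have terms: "0 \<le> 1 / (M0 * p * a) * nS U R" "0 \<le> 1 / (M0 * p * b) * nS W R"
        "0 \<le> 1 / TU * qS U R" "0 \<le> 1 / TW * qS W R" "0 \<le> \<mu> * cR R"
        using nn p ab b T \<mu> by (auto simp: M0_def)
      have Zq: "q / 2 \<le> eR R - 1 / (M0 * p * a) * nS U R - 1 / (M0 * p * b) * nS W R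
          - 1 / TU * qS U R - 1 / TW * qS W R - fR R - \<mu> * cR R"
        using R(2) unfolding Z_def q_def TU_def TW_def .
      have rest: "eR R * (1 - card (U \<inter> R) / (M0 * p * a)) > 0" "eR R * (1 - card (W \<inter> R) / (M0 * p * b)) > 0"
        "q / 2 + \<mu> * cR R \<le> eR R - 1 / TU * qS U R - 1 / TW * qS W R - fR R"
      proof -
        have arith: "0 < e - x1 \<and> 0 < e - x2 \<and> q / 2 + x6 \<le> e - x3 - x4 - x5"
          if "q / 2 \<le> e - x1 - x2 - x3 - x4 - x5 - x6" "0 \<le> x1" "0 \<le> x2" "0 \<le> x3" "0 \<le> x4" "0 \<le> x5" "0 \<le> x6"
          for e x1 x2 x3 x4 x5 x6 :: real
          using that q by linarith
        note ar = arith[OF Zq terms(1,2,3,4) nn(3) terms(5)]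
        show "q / 2 + \<mu> * cR R \<le> eR R - 1 / TU * qS U R - 1 / TW * qS W R - fR R" using ar by blast
        show "eR R * (1 - card (U \<inter> R) / (M0 * p * a)) > 0" "eR R * (1 - card (W \<inter> R) / (M0 * p * b)) > 0"
          using ar by (auto simp: nS' right_diff_distrib)
      qed
      have cUR: "card (U \<inter> R) \<le> M0 * p * a"
      proof -
        have "0 < 1 - card (U \<inter> R) / (M0 * p * a)" using rest(1) nn(5) by (simp add: zero_less_mult_iff)
        moreover have "0 < M0 * p * a" using p ab by (simp add: M0_def)
        ultimately show ?thesis by (simp add: pos_divide_less_eq)
      qed
      have cWR: "card (W \<inter> R) \<le> M0 * p * b"
      proof -
        have "0 < 1 - card (W \<inter> R) / (M0 * p * b)" using rest(2) nn(5) by (simp add: zero_less_mult_iff)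
        moreover have "0 < M0 * p * b" using p b by (simp add: M0_def)
        ultimately show ?thesis by (simp add: pos_divide_less_eq)
      qed
      have E'low: "q / 2 + \<mu> * cR R \<le> card E'"
      proof -
        have "card {e \<in> E. e \<subseteq> R} - card (X U TU \<union> X W TW \<union> pick ` FR) \<le> card E'"
          unfolding E'_def using fin' by (intro diff_card_le_card_Diff) auto
        moreover have "card (X U TU \<union> X W TW \<union> pick ` FR) \<le> card (X U TU) + card (X W TW) + card FR"
          using card_Un_le[of "X U TU \<union> X W TW" "pick ` FR"] card_Un_le[of "X U TU" "X W TW"]
            card_image_le[OF fin'(3), of pick] by linarith
        ultimately have "eR R \<le> real (card E') + card (X U TU) + card (X W TW) + fR R"
          by (simp add: eR_def fR_def FR_def)
        moreover have "y \<le> e'" if "e \<le> e' + x3 + x4 + x5" "y \<le> e - x3' - x4' - x5" "x3 \<le> x3'" "x4 \<le> x4'"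
          for y e e' x3 x4 x5 x3' x4' :: real using that by linarith
        ultimately show ?thesis using rest(3) XU XW by blast
      qed
      have degU: "card {e \<in> E'. v \<in> e} \<le> T" if "X S T \<subseteq> X U TU \<union> X W TW" "v \<in> S" "0 \<le> T" for v S and T :: real
      proof (cases "{e \<in> E'. v \<in> e} = {}")
        case True
        then show ?thesis using that by (simp only: True) simp
      next
        case False
        then obtain e where e: "e \<in> E'" "v \<in> e" by blast
        then have "e \<notin> X S T" "e \<in> E" "e \<subseteq> R" using that by (auto simp: E'_def)
        then have "card {e' \<in> E. v \<in> e' \<and> e' \<subseteq> R} \<le> T" using e that by (force simp: X_def)
        moreover have "card {e \<in> E'. v \<in> e} \<le> card {e' \<in> E. v \<in> e' \<and> e' \<subseteq> R}"
          using fE by (intro card_mono) (auto simp: E'_def)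
        ultimately show ?thesis by linarith
      qed
      have deg: "card {e \<in> E'. v \<in> e} \<le> TU" if "v \<in> (U \<inter> R) \<union> (W \<inter> R)" for v
        using that
      proof
        assume "v \<in> U \<inter> R"
        then show ?thesis using degU[of U TU v] T by auto
      next
        assume "v \<in> W \<inter> R"
        then have "card {e \<in> E'. v \<in> e} \<le> TW" using degU[of W TW v] T by auto
        then show ?thesis using T by linarith
      qed
      have E'sub: "\<exists>u\<in>U \<inter> R. \<exists>w\<in>W \<inter> R. e = {u, w}" if e: "e \<in> E'" for e
      proof -
        have "e \<in> E" "e \<subseteq> R" using e by (auto simp: E'_def)
        moreover obtain u w where "u \<in> U" "w \<in> W" "e = {u, w}" using E \<open>e \<in> E\<close> by blast
        ultimately show ?thesis by auto
      qed
      \<comment> \<open>An upper bound on \<open>E'\<close> is of use because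
        \<open>\<mu> * cR R\<close> is at most \<open>card E'\<close>: it limits how many cycles of
        the family lie inside \<open>R\<close>.\<close>
      have E'high: "card E' \<le> M0\<^sup>2 * q"
      proof -
        have "card E' \<le> card (\<Union>u\<in>U \<inter> R. {e \<in> E'. u \<in> e})"
          using fin' fin E'sub by (intro card_mono) fastforce+
        also have "\<dots> \<le> (\<Sum>u\<in>U \<inter> R. card {e \<in> E'. u \<in> e})" using fin by (intro card_UN_le) auto
        finally have "real (card E') \<le> real (\<Sum>u\<in>U \<inter> R. card {e \<in> E'. u \<in> e})" by (rule of_nat_mono)
        also have "\<dots> = (\<Sum>u\<in>U \<inter> R. real (card {e \<in> E'. u \<in> e}))" by (rule of_nat_sum)
        also have "\<dots> \<le> (\<Sum>u\<in>U \<inter> R. TU)" by (intro sum_mono deg) auto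
        also have "\<dots> = card (U \<inter> R) * TU" by simp
        also have "\<dots> \<le> (M0 * p * a) * TU" using cUR T by (intro mult_right_mono) auto
        also have "\<dots> = M0\<^sup>2 * q" using ab by (simp add: TU_def q_def power2_eq_square)
        finally show ?thesis .
      qed
      have cRs: "cR R \<le> 10 * M0\<^sup>2 * p ^ (2 * l) * M"
      proof -
        have "\<mu> * cR R \<le> M0\<^sup>2 * q" using E'low E'high q by linarith
        moreover have "M0\<^sup>2 * q = \<mu> * (10 * M0\<^sup>2 * p ^ (2 * l) * M)" using p M by (simp add: \<mu>_def q_def)
        ultimately show ?thesis using \<mu> by simp
      qed
      \<comment> \<open>The product of average degrees guaranteed in the worst case:
        \<open>q / 2\<close> edges between sides of sizes \<open>M0 * p * a\<close> and
        \<open>M0 * p * b\<close>.\<close>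
      define \<rho> where "\<rho> = p\<^sup>2 * N\<^sup>2 / (4 * M0\<^sup>2 * (a * b))"
      have \<rho>0: "0 \<le> \<rho>" using ab b by (simp add: \<rho>_def)
      have E'ne: "E' \<noteq> {}" using E'low q terms(5) by auto
      have UWpos: "0 < card (U \<inter> R)" "0 < card (W \<inter> R)" using E'ne E'sub fin by (fastforce simp: card_gt_0_iff)+
      have \<rho>le: "\<rho> \<le> (real (card E'))\<^sup>2 / (real (card (U \<inter> R)) * card (W \<inter> R))"
      proof -
        have "\<rho> = (q / 2)\<^sup>2 / ((M0 * p * a) * (M0 * p * b))"
          using p by (simp add: \<rho>_def q_def power2_eq_square M0_def field_simps)
        also have "\<dots> \<le> (real (card E'))\<^sup>2 / (real (card (U \<inter> R)) * card (W \<inter> R))"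
        proof (rule frac_le)
          have "q / 2 \<le> card E'" using E'low terms(5) by linarith
          then show "(q / 2)\<^sup>2 \<le> (real (card E'))\<^sup>2" using q by (intro power_mono) auto
          show "real (card (U \<inter> R)) * card (W \<inter> R) \<le> (M0 * p * a) * (M0 * p * b)"
            using cUR cWR p ab by (intro mult_mono) (auto simp: M0_def)
          show "0 < real (card (U \<inter> R)) * card (W \<inter> R)" using UWpos by simp
        qed simp
        finally show ?thesis .
      qed
      have sm: "(64 * real l ^ 4 * TU) ^ l * card (U \<inter> R) \<le> \<rho> ^ l"
      proof -
        define P where "P = p ^ (l + 1) * N ^ l"
        have P: "P \<ge> 0" using p N by (simp add: P_def)
        have "(64 * real l ^ 4 * TU) ^ l * card (U \<inter> R) \<le> (64 * real l ^ 4 * TU) ^ l * (M0 * p * a)"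
          using cUR T by (intro mult_left_mono) auto
        also have "\<dots> = ((256 * real l ^ 4 * M0 ^ 3) ^ l * M0) * (a * b ^ l * P) / ((4 * M0\<^sup>2 * (a * b)) ^ l)"
        proof -
          have "(64 * real l ^ 4 * TU) * (4 * M0\<^sup>2 * (a * b)) = (256 * real l ^ 4 * M0 ^ 3) * (p * N * b)"
            using ab by (simp add: TU_def field_simps power2_eq_square power3_eq_cube)
          then have "(64 * real l ^ 4 * TU) ^ l * (4 * M0\<^sup>2 * (a * b)) ^ l = (256 * real l ^ 4 * M0 ^ 3) ^ l * (p * N * b) ^ l"
            by (metis power_mult_distrib)
          then have "(64 * real l ^ 4 * TU) ^ l * (M0 * p * a) * (4 * M0\<^sup>2 * (a * b)) ^ l
             = (256 * real l ^ 4 * M0 ^ 3) ^ l * (p * N * b) ^ l * (M0 * p * a)" by (simp only: mult_ac)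
          also have "\<dots> = ((256 * real l ^ 4 * M0 ^ 3) ^ l * M0) * (a * b ^ l * P)"
            by (simp add: P_def power_mult_distrib[of "p * N"] power_mult_distrib[of p])
          finally show ?thesis using ab b by (simp add: eq_divide_eq M0_def)
        qed
        also have "\<dots> \<le> C0 * (a * b ^ l * P) / ((4 * M0\<^sup>2 * (a * b)) ^ l)"
          using C0(2) ab b P by (intro divide_right_mono mult_right_mono) auto
        also have "\<dots> \<le> (p ^ (l - 1) * N ^ l) * P / ((4 * M0\<^sup>2 * (a * b)) ^ l)"
          using mult_right_mono[OF pc P] ab b by (intro divide_right_mono) (auto simp: N_def mult_ac)
        also have "(p ^ (l - 1) * N ^ l) * P = (p\<^sup>2 * N\<^sup>2) ^ l"
          by (simp add: P_def l' power_mult_distrib power_add power2_eq_square mult_ac)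
        also have "(p\<^sup>2 * N\<^sup>2) ^ l / ((4 * M0\<^sup>2 * (a * b)) ^ l) = \<rho> ^ l" by (simp add: \<rho>_def power_divide)
        finally show ?thesis .
      qed
      have inj': "inj_on ((`) \<pi>) E'" using inj by (rule inj_on_subset) (auto simp: E'_def)
      have \<rho>pow: "\<rho> ^ l \<le> ((real (card E'))\<^sup>2 / (real (card (U \<inter> R)) * card (W \<inter> R))) ^ l"
        using \<rho>le \<rho>0 by (rule power_mono)
      have "((real (card E'))\<^sup>2 / (real (card (U \<inter> R)) * card (W \<inter> R))) ^ l / (2 * real l) ^ (2 * l)
          \<le> card {c. is_cycle \<pi> (2 * l) E' c}"
      proof (rule many_cycles[where \<Delta> = TU])
        show "(64 * real l ^ 4 * TU) ^ l * real (card (U \<inter> R))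
            \<le> ((real (card E'))\<^sup>2 / (real (card (U \<inter> R)) * real (card (W \<inter> R)))) ^ l"
          using sm \<rho>pow by (rule order_trans)
      qed (use l fin disj E'sub E'ne inj' deg in auto)
      then have "\<rho> ^ l / (2 * real l) ^ (2 * l) \<le> card {c. is_cycle \<pi> (2 * l) E' c}"
        using divide_right_mono[OF \<rho>pow, of "(2 * real l) ^ (2 * l)"] by simp
      moreover have "\<rho> ^ l / (2 * real l) ^ (2 * l) = 20 * M0\<^sup>2 * p ^ (2 * l) * M"
      proof -
        have "\<rho> = p\<^sup>2 * (N\<^sup>2 / (a * b)) / (4 * M0\<^sup>2)" by (simp add: \<rho>_def)
        then have "\<rho> ^ l = p ^ (2 * l) * (N\<^sup>2 / (a * b)) ^ l / (4 * M0\<^sup>2) ^ l"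
          by (simp only: power_divide power_mult_distrib power_mult)
        moreover have "20 * M0\<^sup>2 * c0 = 1 / ((4 * M0\<^sup>2) ^ l * (2 * real l) ^ (2 * l))"
          by (simp add: c0_def M0_def)
        moreover have "20 * M0\<^sup>2 * p ^ (2 * l) * M = p ^ (2 * l) * (N\<^sup>2 / (a * b)) ^ l * (20 * M0\<^sup>2 * c0)"
          by (simp only: M_def mult_ac)
        ultimately have "\<rho> ^ l = p ^ (2 * l) * (N\<^sup>2 / (a * b)) ^ l / (4 * M0\<^sup>2) ^ l"
          "20 * M0\<^sup>2 * p ^ (2 * l) * M = p ^ (2 * l) * (N\<^sup>2 / (a * b)) ^ l * (1 / ((4 * M0\<^sup>2) ^ l * (2 * real l) ^ (2 * l)))"
          by (simp_all only:)
        then show ?thesis by simp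
      qed
      moreover have "0 < 10 * M0\<^sup>2 * p ^ (2 * l) * M" using p M by (simp add: M0_def)
      \<comment> \<open>There are more cycles in \<open>E'\<close> than members of the family inside
        \<open>R\<close>, so one of them is new. It contains no saturated set and may be added,
        against maximality.\<close>
      ultimately have "cR R < card {c. is_cycle \<pi> (2 * l) E' c}" using cRs by linarith
      then have "\<not> {c. is_cycle \<pi> (2 * l) E' c} \<subseteq> {c \<in> \<C>. \<Union> c \<subseteq> R}"
        using card_mono[of "{c \<in> \<C>. \<Union> c \<subseteq> R}" "{c. is_cycle \<pi> (2 * l) E' c}"] f\<C> by (auto simp: cR_def)
      then obtain c where c: "is_cycle \<pi> (2 * l) E' c" "c \<notin> {c \<in> \<C>. \<Union> c \<subseteq> R}" by blast
      have cE': "c \<subseteq> E'" using c(1) by (auto simp: is_cycle_def)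
      have "\<Union> c \<subseteq> R" using cE' by (auto simp: E'_def)
      then have cC: "c \<notin> \<C>" using c(2) by blast
      have cE: "is_cycle \<pi> (2 * l) E c" using c(1) by (auto simp: is_cycle_def E'_def)
      have noF: "\<not> \<sigma> \<subseteq> c" if "\<sigma> \<in> F" for \<sigma>
      proof
        assume sub: "\<sigma> \<subseteq> c"
        then have "\<sigma> \<in> FR" using that \<open>\<Union> c \<subseteq> R\<close> by (auto simp: FR_def)
        then have "pick \<sigma> \<notin> E'" by (simp add: E'_def)
        moreover have "pick \<sigma> \<in> \<sigma>" using that by (auto simp: pick_def F_def some_in_eq)
        ultimately show False using sub cE' by blast
      qed
      have "valid (insert c \<C>)"
        unfolding valid_def
      proof (intro conjI allI impI)
        show "insert c \<C> \<subseteq> {c. is_cycle \<pi> (2 * l) E c}" using cE \<C> by (auto simp: valid_def)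
        fix \<sigma> assume \<sigma>: "\<sigma> \<subseteq> E \<and> \<sigma> \<noteq> {} \<and> card \<sigma> < 2 * l"
        show "real (card {c' \<in> insert c \<C>. \<sigma> \<subseteq> c'}) \<le> cap (card \<sigma>)"
        proof (cases "\<sigma> \<subseteq> c")
          case True
          then have "\<sigma> \<notin> F" using noF by blast
          then have "dg \<sigma> + 1 \<le> cap (card \<sigma>)" using \<sigma> by (auto simp: F_def)
          moreover have "{c' \<in> insert c \<C>. \<sigma> \<subseteq> c'} = insert c {c' \<in> \<C>. \<sigma> \<subseteq> c'}" using True by auto
          ultimately show ?thesis using cC f\<C> by (simp add: dg_def)
        next
          case False
          then have "{c' \<in> insert c \<C>. \<sigma> \<subseteq> c'} = {c' \<in> \<C>. \<sigma> \<subseteq> c'}" by auto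
          then show ?thesis using \<C> \<sigma> by (simp add: valid_def)
        qed
      qed
      from max[OF this] show False using cC f\<C> by simp
    qed
    \<comment> \<open>Once the family has reached size \<open>M\<close>, the fixed caps are bounds
      relative to its actual size.\<close>
    moreover have "cap j \<le> K1 * p ^ (j - 1) * card \<C> / card E" for j
      unfolding cap_def N_def using calculation K1 p by (intro divide_right_mono mult_left_mono) auto
    ultimately show ?thesis using \<C> unfolding valid_def M_def N_def by (meson order_trans)
  qed
  show ?thesis
    by (rule exI[of _ c0], rule conjI[OF c0], rule exI[of _ C0], rule conjI[OF C0(1)],
        rule exI[of _ K1], rule conjI[OF K1], intro allI impI, elim conjE) (rule main)
qed

section \<open>Regularising the codegrees\<close>

lemma card_cover_le:
  fixes y :: real
  assumes "finite I" "\<And>i. i \<in> I \<Longrightarrow> finite (B i)" "S \<subseteq> (\<Union>i\<in>I. B i)" "\<And>i. i \<in> I \<Longrightarrow> card (B i) \<le> y"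
  shows "card S \<le> card I * y"
proof -
  have "card S \<le> card (\<Union>i\<in>I. B i)" using assms by (intro card_mono) auto
  also have "\<dots> \<le> (\<Sum>i\<in>I. card (B i))" by (rule card_UN_le[OF assms(1)])
  finally have "real (card S) \<le> real (\<Sum>i\<in>I. card (B i))" by (rule of_nat_mono)
  also have "\<dots> = (\<Sum>i\<in>I. real (card (B i)))" by (rule of_nat_sum)
  also have "\<dots> \<le> (\<Sum>i\<in>I. y)" using assms(4) by (rule sum_mono)
  finally show ?thesis by simp
qed

lemma card_fibres:
  fixes x y :: real
  assumes "finite E" "\<And>z. z \<in> f ` E \<Longrightarrow> x \<le> card {e \<in> E. f e = z} \<and> card {e \<in> E. f e = z} \<le> y"
  shows "card (f ` E) * x \<le> card E" and "card E \<le> card (f ` E) * y"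
proof -
  have "card E = (\<Sum>z\<in>f ` E. card {e \<in> E. f e = z})"
    using sum.image_gen[OF assms(1), of "\<lambda>_. 1::nat" f] by simp
  then have "real (card E) = (\<Sum>z\<in>f ` E. real (card {e \<in> E. f e = z}))" by simp
  moreover have "(\<Sum>z\<in>f ` E. x) \<le> (\<Sum>z\<in>f ` E. real (card {e \<in> E. f e = z}))" 
    "(\<Sum>z\<in>f ` E. real (card {e \<in> E. f e = z})) \<le> (\<Sum>z\<in>f ` E. y)"
    by (intro sum_mono; use assms(2) in blast)+
  ultimately show "card (f ` E) * x \<le> card E" "card E \<le> card (f ` E) * y" by simp_all
qed

lemma card_supersets_le:
  assumes "finite V" "finite Z" "card Z \<le> r"
  shows "card {e. e \<subseteq> V \<and> card e = r \<and> Z \<subseteq> e} \<le> card V ^ (r - card Z)"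
proof -
  let ?S = "{e. e \<subseteq> V \<and> card e = r \<and> Z \<subseteq> e}"
  have "card ?S \<le> card {f. f \<subseteq> V \<and> card f = r - card Z}"
  proof (rule card_inj_on_le[of "\<lambda>e. e - Z"])
    show "inj_on (\<lambda>e. e - Z) ?S" by (auto simp: inj_on_def)
    show "(\<lambda>e. e - Z) ` ?S \<subseteq> {f. f \<subseteq> V \<and> card f = r - card Z}"
      using assms(2) by (auto simp: card_Diff_subset)
    show "finite {f. f \<subseteq> V \<and> card f = r - card Z}" by (rule finite_subset[of _ "Pow V"]) (use assms(1) in auto)
  qed
  also have "\<dots> = card V choose (r - card Z)" by (rule n_subsets[OF assms(1)])
  also have "\<dots> \<le> card V ^ (r - card Z)"
    by (cases "r - card Z \<le> card V") (auto simp: binomial_le_pow binomial_eq_0)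
  finally show ?thesis .
qed

text \<open>Averaging over all \<open>r ^ card V\<close> colourings. Fixing one bijection from an
  edge to the colours and colouring the other vertices freely shows that the edge is rainbow in at
  least the proportion \<open>1 / r ^ r\<close> of them.\<close>

lemma rainbow_colouring:
  assumes V: "finite V" and r: "r \<ge> 1" and E: "\<And>e. e \<in> E \<Longrightarrow> e \<subseteq> V \<and> card e = r"
  obtains c :: "'a \<Rightarrow> nat" where "card E \<le> card {e \<in> E. c ` e = {..<r} \<and> inj_on c e} * r ^ r"
proof -
  let ?F = "V \<rightarrow>\<^sub>E {..<r}"
  let ?good = "\<lambda>c e. c ` e = {..<r} \<and> inj_on c e"
  have fE: "finite E" by (rule finite_subset[of _ "Pow V"]) (use E V in auto)
  have fF: "finite ?F" using V by (intro finite_PiE) auto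
  have cF: "card ?F = r ^ card V" using V by (simp add: card_PiE)
  have ext: "r ^ (card V - r) \<le> card {c \<in> ?F. ?good c e}" if e: "e \<in> E" for e
  proof -
    have eV: "e \<subseteq> V" "card e = r" "finite e" using E[OF e] V finite_subset by auto
    obtain g where g: "bij_betw g e {..<r}"
      using eV by (metis bij_betw_iff_card card_lessThan finite_lessThan)
    have "card (V - e \<rightarrow>\<^sub>E {..<r}) \<le> card {c \<in> ?F. ?good c e}"
    proof (rule card_inj_on_le[of "\<lambda>h x. if x \<in> e then g x else h x"])
      show "inj_on (\<lambda>h x. if x \<in> e then g x else h x) (V - e \<rightarrow>\<^sub>E {..<r})"
      proof (rule inj_onI)
        fix h1 h2 assume h: "h1 \<in> V - e \<rightarrow>\<^sub>E {..<r}" "h2 \<in> V - e \<rightarrow>\<^sub>E {..<r}"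
          "(\<lambda>x. if x \<in> e then g x else h1 x) = (\<lambda>x. if x \<in> e then g x else h2 x)"
        show "h1 = h2"
        proof (rule PiE_ext[OF h(1,2)])
          fix x assume "x \<in> V - e"
          then show "h1 x = h2 x" using fun_cong[OF h(3), of x] by simp
        qed
      qed
      show "(\<lambda>h x. if x \<in> e then g x else h x) ` (V - e \<rightarrow>\<^sub>E {..<r}) \<subseteq> {c \<in> ?F. ?good c e}"
      proof
        fix c assume "c \<in> (\<lambda>h x. if x \<in> e then g x else h x) ` (V - e \<rightarrow>\<^sub>E {..<r})"
        then obtain h where h: "h \<in> V - e \<rightarrow>\<^sub>E {..<r}" "c = (\<lambda>x. if x \<in> e then g x else h x)" by blast
        have "c ` e = g ` e" "inj_on c e \<longleftrightarrow> inj_on g e" using h(2) by (auto simp: inj_on_def)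
        moreover have "c \<in> ?F"
          using h g eV by (auto simp: PiE_iff extensional_def bij_betw_def)
        ultimately show "c \<in> {c \<in> ?F. ?good c e}" using g by (simp add: bij_betw_def)
      qed
      show "finite {c \<in> ?F. ?good c e}" using fF by simp
    qed
    moreover have "card (V - e \<rightarrow>\<^sub>E {..<r}) = r ^ (card V - r)"
      using V eV by (simp add: card_PiE card_Diff_subset)
    ultimately show ?thesis by simp
  qed
  have "\<exists>c. card E \<le> card {e \<in> E. ?good c e} * r ^ r"
  proof (rule ccontr)
    assume *: "\<not> ?thesis"
    then have lt: "card {e \<in> E. ?good c e} * r ^ r < card E" for c by (meson not_le)
    then have "E \<noteq> {}" by force
    then obtain e where e: "e \<in> E" by blast
    then have rV: "r \<le> card V" using E[OF e] V card_mono by metis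
    have Fne: "?F \<noteq> {}"
      using r by (auto simp: PiE_eq_empty_iff lessThan_empty_iff)
    have "card E * r ^ card V = (\<Sum>e\<in>E. r ^ (card V - r)) * r ^ r"
      using rV by (simp add: mult.assoc power_add[symmetric])
    also have "\<dots> \<le> (\<Sum>e\<in>E. card {c \<in> ?F. ?good c e}) * r ^ r"
      using ext by (intro mult_le_mono1 sum_mono) auto
    also have "(\<Sum>e\<in>E. card {c \<in> ?F. ?good c e}) = (\<Sum>e\<in>E. \<Sum>c\<in>?F. of_bool (?good c e))"
      using fF by (simp add: of_bool_def sum.If_cases Int_def)
    also have "\<dots> = (\<Sum>c\<in>?F. \<Sum>e\<in>E. of_bool (?good c e))" by (rule sum.swap)
    also have "\<dots> = (\<Sum>c\<in>?F. card {e \<in> E. ?good c e})"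
      using fE by (simp add: of_bool_def sum.If_cases Int_def)
    also have "\<dots> * r ^ r = (\<Sum>c\<in>?F. card {e \<in> E. ?good c e} * r ^ r)" by (rule sum_distrib_right)
    also have "\<dots> < (\<Sum>c\<in>?F. card E)" using lt fF Fne by (intro sum_strict_mono) auto
    also have "\<dots> = card E * r ^ card V" by (simp add: cF)
    finally show False by simp
  qed
  then show ?thesis using that by blast
qed

text \<open>The second bound prevents a loss of logarithmic factors when the class is small. The ratio
  \<open>4/5\<close> is chosen such that \<open>(2 \<cdot> 4/5)\<^sup>3 \<ge> 4\<close>, which is what the density estimate needs.\<close>

lemma dyadic_class:
  fixes g :: "'b \<Rightarrow> real" and G :: real
  assumes fin: "finite E" and m: "m \<ge> 1" and g: "\<And>e. e \<in> E \<Longrightarrow> G / 2 ^ m < g e \<and> g e \<le> G"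
  obtains i where "card E / (2 * real m) \<le> card {e \<in> E. G / 2 ^ i / 2 < g e \<and> g e \<le> G / 2 ^ i}"
    "card E * (4/5) ^ i / 10 \<le> card {e \<in> E. G / 2 ^ i / 2 < g e \<and> g e \<le> G / 2 ^ i}"
proof -
  let ?C = "\<lambda>i. {e \<in> E. G / 2 ^ i / 2 < g e \<and> g e \<le> G / 2 ^ i}"
  have cov: "E \<subseteq> (\<Union>i<m. ?C i)"
  proof
    fix e assume e: "e \<in> E"
    define k where "k = (LEAST k. G / 2 ^ k < g e)"
    have k: "G / 2 ^ k < g e" unfolding k_def by (rule LeastI[of _ m]) (use g[OF e] in simp)
    have km: "k \<le> m" unfolding k_def by (rule Least_le) (use g[OF e] in simp)
    have "k \<noteq> 0" using k g[OF e] by (cases k) auto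
    then obtain j where j: "k = Suc j" by (cases k) auto
    have "\<not> G / 2 ^ j < g e" using not_less_Least[of j "\<lambda>k. G / 2 ^ k < g e"] j by (simp add: k_def)
    then have "e \<in> ?C j" using k e j by (simp add: field_simps)
    then show "e \<in> (\<Union>i<m. ?C i)" using j km by auto
  qed
  have "\<exists>i<m. card E / (2 * real m) \<le> card (?C i) \<and> card E * (4/5) ^ i / 10 \<le> card (?C i)"
  proof (rule ccontr)
    assume *: "\<not> ?thesis"
    \<comment> \<open>If every class violated one of the two bounds, each would be smaller than the
      sum of both thresholds. Over all classes these add up to at most
      \<open>card E / 2 + card E / 2\<close>.\<close>
    have lt: "card (?C i) < card E / (2 * real m) + card E * (4/5) ^ i / 10" if i: "i < m" for i
    proof -
      have "0 \<le> card E / (2 * real m)" "0 \<le> card E * (4/5::real) ^ i / 10" by auto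
      moreover have "card (?C i) < card E / (2 * real m) \<or> card (?C i) < card E * (4/5) ^ i / 10"
        using * i by (meson not_le)
      ultimately show ?thesis by linarith
    qed
    have "card E \<le> card (\<Union>i<m. ?C i)" using fin cov by (intro card_mono) auto
    also have "\<dots> \<le> (\<Sum>i<m. card (?C i))" by (rule card_UN_le) simp
    finally have "real (card E) \<le> real (\<Sum>i<m. card (?C i))" by (rule of_nat_mono)
    also have "\<dots> = (\<Sum>i<m. real (card (?C i)))" by simp
    also have "\<dots> < (\<Sum>i<m. card E / (2 * real m) + card E * (4/5) ^ i / 10)"
      using lt m by (intro sum_strict_mono) (auto simp: lessThan_empty_iff)
    also have "\<dots> = card E / 2 + card E / 10 * (\<Sum>i<m. (4/5) ^ i)"
      using m by (simp add: sum.distrib sum_distrib_left)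
    also have "(\<Sum>i<m. (4/5::real) ^ i) \<le> 5"
      by (subst sum_gp_strict) (simp add: field_simps)
    finally show False by (simp add: mult_left_mono)
  qed
  then show ?thesis using that by blast
qed

lemma binary_length:
  fixes n :: nat
  assumes "n \<ge> 2"
  obtains k :: nat where "n < 2 ^ k" "k \<ge> 1" "real k \<le> 4 * ln (real n)"
proof -
  define k where "k = (LEAST k. n < 2 ^ k)"
  have k: "n < 2 ^ k" unfolding k_def by (rule LeastI[of _ n]) (rule less_exp)
  then have k1: "k \<ge> 1" using assms by (cases k) auto
  then obtain j where j: "k = Suc j" by (cases k) auto
  have "\<not> n < 2 ^ j" using not_less_Least[of j "\<lambda>k. n < 2 ^ k"] j by (simp add: k_def)
  then have "real (2 ^ j) \<le> real n" by (intro of_nat_mono) simp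
  then have "ln (2 ^ j) \<le> ln (real n)" using assms by (subst ln_le_cancel_iff) auto
  then have 1: "real j * ln 2 \<le> ln (real n)" by (simp add: ln_realpow)
  have "ln 2 \<le> ln (real n)" using assms by (subst ln_le_cancel_iff) auto
  moreover have l2: "1/2 \<le> ln (2::real)"
    using ln_le_minus_one[of "1/2::real"] by (simp add: ln_div)
  moreover have "real j * (1/2) \<le> real j * ln 2" using l2 by (intro mult_left_mono) auto
  ultimately have "real k \<le> 4 * ln (real n)" using 1 j by simp
  then show ?thesis using that k k1 by blast
qed

text \<open>Here \<open>\<phi> e\<close> is the pair of \<open>e\<close> in the graph,
  \<open>D\<close> the common codegree of the pairs and \<open>s ^ (r - 1)\<close> the common degree
  of the vertices of \<open>A\<close>, both up to a factor 2. A vertex of degree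
  \<open>s ^ (r - 1)\<close> has at least \<open>s\<close> neighbours in some further part; a robust
  form of this gives average degree of order \<open>s\<close> on \<open>A\<close>. The factors
  \<open>(8/5) ^ i\<close> record that a class of small degree must contain many vertices.\<close>

lemma regularise:
  assumes r: "r \<ge> 3"
  shows "\<exists>\<kappa>::real. \<kappa> > 0 \<and> (\<forall>(V :: 'a set) E (n :: nat) (t :: real). finite V \<and> card V = n \<and> n \<ge> 2 \<and> t > 0 \<and>
      (\<forall>e\<in>E. e \<subseteq> V \<and> card e = r) \<and> real (card E) = t * real n ^ (r - 1) \<longrightarrow>
    (\<exists>E4 A B \<phi> (D :: real) (s :: real) (i :: nat). E4 \<subseteq> E \<and> A \<subseteq> V \<and> B \<subseteq> V \<and> A \<inter> B = {} \<and> A \<noteq> {} \<and>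
       (\<forall>e\<in>E4. \<exists>x\<in>A. \<exists>y\<in>B. \<phi> e = {x, y} \<and> {x, y} \<subseteq> e) \<and>
       (\<forall>f\<in>\<phi> ` E4. D / 2 \<le> real (card {e \<in> E4. \<phi> e = f}) \<and> real (card {e \<in> E4. \<phi> e = f}) \<le> D) \<and>
       \<kappa> * card E \<le> card E4 * (ln (real n))\<^sup>2 \<and>
       \<kappa> * card A * s \<le> card (\<phi> ` E4) \<and> 0 < s \<and> s ^ (r - 1) = real n ^ (r - 1) / 2 ^ i \<and>
       \<kappa> * t * (8/5) ^ i \<le> card A \<and> \<kappa> * t * real n ^ (r - 2) \<le> s ^ (r - 1) \<and>
       \<kappa> * t * real n ^ (r - 3) \<le> D))"
proof -
  \<comment> \<open>The reciprocal of a sum lies below three reciprocals at once: one for the share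
    of edges kept, one for the number of pairs, one for the size of \<open>A\<close> and the lower
    bounds on degree and codegree.\<close>
  define \<kappa> :: real where "\<kappa> = 1 / (16 * real r * real r ^ r * (4 * real r) * (12 * real r) + 320 * (real r)\<^sup>2 + 20 * real r ^ r)"
  define \<kappa>1 :: real where "\<kappa>1 = 1 / (16 * real r * real r ^ r * (4 * real r) * (12 * real r))"
  have rpos: "0 < real r" "0 < real r ^ r" using r by auto
  have den: "0 < 16 * real r * real r ^ r * (4 * real r) * (12 * real r)" "0 < 320 * (real r)\<^sup>2" "0 < 20 * real r ^ r"
    using rpos by auto
  have \<kappa>: "\<kappa> > 0" unfolding \<kappa>_def using den by (intro divide_pos_pos add_pos_pos) auto
  have \<kappa>le: "\<kappa> \<le> \<kappa>1" "\<kappa> \<le> 1 / (320 * (real r)\<^sup>2)" "\<kappa> \<le> 1 / (20 * real r ^ r)"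
  proof -
    have "1 / (x + y + z) \<le> 1 / x \<and> 1 / (x + y + z) \<le> 1 / y \<and> 1 / (x + y + z) \<le> 1 / z"
      if "0 < x" "0 < y" "0 < z" for x y z :: real using that by (intro conjI frac_le) auto
    from this[OF den] show "\<kappa> \<le> \<kappa>1" "\<kappa> \<le> 1 / (320 * (real r)\<^sup>2)" "\<kappa> \<le> 1 / (20 * real r ^ r)"
      unfolding \<kappa>_def \<kappa>1_def by blast+
  qed
  have main: "\<exists>E4 A B \<phi> (D :: real) (s :: real) (i :: nat). E4 \<subseteq> E \<and> A \<subseteq> V \<and> B \<subseteq> V \<and> A \<inter> B = {} \<and> A \<noteq> {} \<and>
       (\<forall>e\<in>E4. \<exists>x\<in>A. \<exists>y\<in>B. \<phi> e = {x, y} \<and> {x, y} \<subseteq> e) \<and>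
       (\<forall>f\<in>\<phi> ` E4. D / 2 \<le> real (card {e \<in> E4. \<phi> e = f}) \<and> real (card {e \<in> E4. \<phi> e = f}) \<le> D) \<and>
       \<kappa> * card E \<le> card E4 * (ln (real n))\<^sup>2 \<and>
       \<kappa> * card A * s \<le> card (\<phi> ` E4) \<and> 0 < s \<and> s ^ (r - 1) = real n ^ (r - 1) / 2 ^ i \<and>
       \<kappa> * t * (8/5) ^ i \<le> card A \<and> \<kappa> * t * real n ^ (r - 2) \<le> s ^ (r - 1) \<and>
       \<kappa> * t * real n ^ (r - 3) \<le> D"
    if V: "finite V" "card V = n" and n: "n \<ge> 2" and t: "t > 0"
      and E: "\<forall>e\<in>E. e \<subseteq> V \<and> card e = r" and cE: "real (card E) = t * real n ^ (r - 1)"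
    for V :: "'a set" and E and n :: nat and t :: real
  proof -
    obtain kk :: nat where kk: "n < 2 ^ kk" "kk \<ge> 1" "real kk \<le> 4 * ln (real n)" using binary_length[OF n] by metis
    have fE: "finite E" by (rule finite_subset[of _ "Pow V"]) (use E V in auto)
    have r1: "r \<ge> 1" using r by simp
    have Er: "e \<subseteq> V \<and> card e = r" if "e \<in> E" for e using E that by blast
    obtain c :: "'a \<Rightarrow> nat" where c: "card E \<le> card {e \<in> E. c ` e = {..<r} \<and> inj_on c e} * r ^ r"
      by (rule rainbow_colouring[OF V(1) r1 Er]) auto
    define E1 where "E1 = {e \<in> E. c ` e = {..<r} \<and> inj_on c e}"
    have fE1: "finite E1" using fE by (simp add: E1_def)
    have E1: "e \<subseteq> V" "card e = r" "finite e" if "e \<in> E1" for e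
    proof -
      show "e \<subseteq> V" "card e = r" using Er that by (auto simp: E1_def)
      then show "finite e" using V finite_subset by blast
    qed
    have "real (card E) \<le> real (card E1 * r ^ r)" using c unfolding E1_def by (rule of_nat_mono)
    then have cE1: "t * real n ^ (r - 1) / real r ^ r \<le> card E1" using rpos cE by (simp add: pos_divide_le_eq)
    have npos: "0 < real n" using n by simp
    define w1 where "w1 = real (r - 1)"
    have w1: "0 < w1" "w1 \<le> real r" using r by (auto simp: w1_def)
    have [simp]: "0 \<le> w1" using w1 by simp
    have E1pos: "0 < real (card E1)"
    proof -
      have "0 < t * real n ^ (r - 1) / real r ^ r" using t npos rpos by simp
      then show ?thesis using cE1 by linarith
    qed
    define vt where "vt k e = (THE z. z \<in> e \<and> c z = k)" for k e
    have vt_eq: "vt k e = z" if "e \<in> E1" "z \<in> e" "c z = k" for k e z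
      unfolding vt_def using that by (intro the_equality) (auto simp: E1_def inj_on_def)
    have vt: "vt k e \<in> e" "c (vt k e) = k" if ek: "e \<in> E1" "k < r" for k e
    proof -
      have "k \<in> c ` e" using ek by (auto simp: E1_def)
      then obtain z where z: "z \<in> e" "c z = k" by blast
      then have "vt k e = z" using ek vt_eq by blast
      then show "vt k e \<in> e" "c (vt k e) = k" using z by auto
    qed
    define X where "X = vt 0"
    have X: "X e \<in> e" "c (X e) = 0" if "e \<in> E1" for e using vt[OF that, of 0] r by (auto simp: X_def)
    have Xeq: "X e = z" if "e \<in> E1" "z \<in> e" "c z = 0" for e z using vt_eq that by (simp add: X_def)
    define d1 where "d1 x = real (card {e \<in> E1. x \<in> e})" for x
    define d2 where "d2 x y = real (card {e \<in> E1. x \<in> e \<and> y \<in> e})" for x y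
    have d1_le: "d1 x \<le> real n ^ (r - 1)" for x
    proof -
      have "card {e \<in> E1. x \<in> e} \<le> card {e. e \<subseteq> V \<and> card e = r \<and> {x} \<subseteq> e}"
      proof (rule card_mono)
        show "finite {e. e \<subseteq> V \<and> card e = r \<and> {x} \<subseteq> e}"
          by (rule finite_subset[of _ "Pow V"]) (use V in auto)
        show "{e \<in> E1. x \<in> e} \<subseteq> {e. e \<subseteq> V \<and> card e = r \<and> {x} \<subseteq> e}" using E1(1,2) by blast
      qed
      also have "\<dots> \<le> card V ^ (r - card {x})" using V r by (intro card_supersets_le) auto
      finally have "real (card {e \<in> E1. x \<in> e}) \<le> real (n ^ (r - 1))" using V by (intro of_nat_mono) simp
      then show ?thesis by (simp add: d1_def)
    qed
    \<comment> \<open>Discarding edges at vertices of less than half the average degree costs at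
      most half of the edges and yields the lower bound on \<open>D1\<close>, and so on
      \<open>s\<close>.\<close>
    define E1' where "E1' = {e \<in> E1. card E1 / (2 * real n) \<le> d1 (X e)}"
    have fE1': "finite E1'" "E1' \<subseteq> E1" using fE1 by (auto simp: E1'_def)
    have cE1': "card E1 / 2 \<le> card E1'"
    proof -
      have "card (E1 - E1') \<le> card {x \<in> V. d1 x \<le> card E1 / (2 * real n)} * (card E1 / (2 * real n))"
      proof (rule card_cover_le[where B = "\<lambda>x. {e \<in> E1. x \<in> e}"])
        show "E1 - E1' \<subseteq> (\<Union>x\<in>{x \<in> V. d1 x \<le> card E1 / (2 * real n)}. {e \<in> E1. x \<in> e})"
        proof
          fix e assume e: "e \<in> E1 - E1'"
          then have "X e \<in> e" "X e \<in> V" using X(1)[of e] E1(1)[of e] by auto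
          then show "e \<in> (\<Union>x\<in>{x \<in> V. d1 x \<le> card E1 / (2 * real n)}. {e \<in> E1. x \<in> e})"
            using e by (intro UN_I[of "X e"]) (auto simp: E1'_def)
        qed
      qed (use V fE1 in \<open>auto simp: d1_def\<close>)
      also have "\<dots> \<le> real n * (card E1 / (2 * real n))"
        using V card_mono[of V "{x \<in> V. d1 x \<le> card E1 / (2 * real n)}"] by (intro mult_right_mono) auto
      also have "\<dots> = card E1 / 2" using npos by simp
      finally have "card (E1 - E1') \<le> card E1 / 2" .
      moreover have "card (E1 - E1') = card E1 - card E1'" "card E1' \<le> card E1"
        using fE1' fE1 by (auto simp: card_Diff_subset finite_subset card_mono)
      ultimately show ?thesis by (simp add: of_nat_diff)
    qed
    define m1 where "m1 = kk * (r - 1)"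
    have m1: "m1 \<ge> 1" "real n ^ (r - 1) < 2 ^ m1"
    proof -
      show "m1 \<ge> 1" using kk r by (simp add: m1_def Suc_leI)
      have "real n < 2 ^ kk" using kk(1) by (metis of_nat_less_iff of_nat_numeral of_nat_power)
      then have "real n ^ (r - 1) < (2 ^ kk) ^ (r - 1)" using npos r by (intro power_strict_mono) auto
      then show "real n ^ (r - 1) < 2 ^ m1" by (simp add: m1_def power_mult)
    qed
    have d1_ge: "1 \<le> d1 (X e)" if "e \<in> E1" for e
    proof -
      have "e \<in> {e' \<in> E1. X e \<in> e'}" using that X by auto
      then have "0 < card {e' \<in> E1. X e \<in> e'}" using fE1 by (auto simp: card_gt_0_iff)
      then show ?thesis by (simp add: d1_def)
    qed
    obtain i where i: "card E1' / (2 * real m1) \<le> card {e \<in> E1'. real n ^ (r - 1) / 2 ^ i / 2 < d1 (X e) \<and> d1 (X e) \<le> real n ^ (r - 1) / 2 ^ i}"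
      "card E1' * (4/5) ^ i / 10 \<le> card {e \<in> E1'. real n ^ (r - 1) / 2 ^ i / 2 < d1 (X e) \<and> d1 (X e) \<le> real n ^ (r - 1) / 2 ^ i}"
    proof (rule dyadic_class[OF fE1'(1) m1(1), of "real n ^ (r - 1)" "\<lambda>e. d1 (X e)"])
      fix e assume "e \<in> E1'"
      then have "1 \<le> d1 (X e)" using d1_ge fE1'(2) by blast
      moreover have "real n ^ (r - 1) / 2 ^ m1 < 1" using m1 by simp
      ultimately show "real n ^ (r - 1) / 2 ^ m1 < d1 (X e) \<and> d1 (X e) \<le> real n ^ (r - 1)"
        using d1_le by (meson less_le_trans)
    qed (use that in blast)
    define D1 where "D1 = real n ^ (r - 1) / 2 ^ i"
    have D1: "D1 > 0" using npos by (simp add: D1_def)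
    define E2 where "E2 = {e \<in> E1'. D1 / 2 < d1 (X e) \<and> d1 (X e) \<le> D1}"
    have E2c: "card E1' / (2 * real m1) \<le> card E2" "card E1' * (4/5) ^ i / 10 \<le> card E2"
      using i by (auto simp: E2_def D1_def)
    have E2E1: "E2 \<subseteq> E1" "finite E2" using fE1' by (auto simp: E2_def)
    define A where "A = X ` E2"
    have fA: "finite A" using E2E1 by (simp add: A_def)
    \<comment> \<open>Membership in \<open>E2\<close> depends only on \<open>X e\<close>, so all
      edges of \<open>E1\<close> at a vertex of \<open>A\<close> survive together. Degrees and
      codegrees can therefore be measured in \<open>E1\<close>.\<close>
    have fibA: "{e \<in> E2. X e = x} = {e \<in> E1. x \<in> e}" if xA: "x \<in> A" for x
    proof
      show "{e \<in> E2. X e = x} \<subseteq> {e \<in> E1. x \<in> e}" using X E2E1 by auto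
      obtain e0 where e0: "e0 \<in> E2" "x = X e0" using xA by (auto simp: A_def)
      have "c x = 0" using e0 X E2E1 by auto
      then have "X e = x" if "e \<in> E1" "x \<in> e" for e using Xeq that by blast
      then show "{e \<in> E1. x \<in> e} \<subseteq> {e \<in> E2. X e = x}" using e0 by (auto simp: E2_def E1'_def)
    qed
    have dA: "D1 / 2 < d1 x" "d1 x \<le> D1" "c x = 0" "x \<in> V" if xA: "x \<in> A" for x
    proof -
      obtain e where e: "e \<in> E2" "x = X e" using xA by (auto simp: A_def)
      then have "e \<in> E1" using E2E1 by blast
      then show "c x = 0" "x \<in> V" using e X[of e] E1(1)[of e] by auto
      show "D1 / 2 < d1 x" "d1 x \<le> D1" using e by (auto simp: E2_def)
    qed
    have E2b: "card A * (D1 / 2) \<le> card E2" "card E2 \<le> card A * D1"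
      unfolding A_def using card_fibres[OF E2E1(2), of X "D1 / 2" D1] fibA dA
      by (auto simp: A_def[symmetric] d1_def less_imp_le)
    have E2pos: "0 < real (card E2)"
    proof -
      have "0 < card E1' / (2 * real m1)" using cE1' E1pos m1 by (intro divide_pos_pos) linarith+
      then show ?thesis using E2c(1) by linarith
    qed
    have Ane: "A \<noteq> {}" using E2pos by (auto simp: A_def)
    \<comment> \<open>With exactly \<open>s\<close> choices in each of the \<open>r - 1\<close>
      further parts, a vertex would have degree \<open>D1\<close>.\<close>
    define s where "s = D1 powr (1 / real (r - 1))"
    have s: "s > 0" "s ^ (r - 1) = D1"
    proof -
      show "s > 0" using D1 by (simp add: s_def)
      have "s ^ (r - 1) = s powr real (r - 1)" using D1 by (simp add: powr_realpow s_def)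
      also have "\<dots> = D1" using D1 r by (simp add: s_def powr_powr)
      finally show "s ^ (r - 1) = D1" .
    qed
    have D1low: "t * real n ^ (r - 2) / (2 * real r ^ r) \<le> D1"
    proof -
      obtain e where e: "e \<in> E2" using E2pos by (metis all_not_in_conv card.empty less_irrefl of_nat_0)
      have "card E1 / (2 * real n) \<le> D1" using e by (auto simp: E2_def E1'_def)
      moreover have "t * real n ^ (r - 2) / (2 * real r ^ r) \<le> card E1 / (2 * real n)"
      proof -
        have "real n ^ (r - 1) = real n ^ (r - 2) * real n" 
        proof -
          have "r - 1 = Suc (r - 2)" using r by simp
          then show ?thesis by simp
        qed
        then have "t * real n ^ (r - 2) / (2 * real r ^ r) = (t * real n ^ (r - 1) / real r ^ r) / (2 * real n)"
          using npos by simp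
        also have "\<dots> \<le> card E1 / (2 * real n)" using cE1 npos by (intro divide_right_mono) auto
        finally show ?thesis .
      qed
      ultimately show ?thesis by linarith
    qed
    \<comment> \<open>Both losses are to be at most a quarter of \<open>E2\<close>, whose degrees
      exceed \<open>D1 / 2\<close>. At most \<open>s / 8\<close> vertices have codegree at least
      \<theta> with \<open>x\<close>, and edges at \<open>x\<close> consisting of such vertices
      number at most \<open>(s / 8) ^ (r - 1) \<le> D1 / 8\<close>. At most \<open>n\<close>
      vertices of codegree below \<eta> lie in at most \<open>n * \<eta> = D1 / 8\<close> edges at
      \<open>x\<close>.\<close>
    define \<theta> where "\<theta> = 8 * w1 * D1 / s"
    define \<eta> where "\<eta> = D1 / (8 * real n)"
    have \<theta>: "\<theta> > 0" using D1 s w1 by (simp add: \<theta>_def)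
    define L where "L = {e \<in> E2. \<exists>k\<in>{1..<r}. d2 (X e) (vt k e) < \<eta>}"
    define Hv where "Hv = {e \<in> E2. \<forall>k\<in>{1..<r}. \<theta> \<le> d2 (X e) (vt k e)}"
    have cL: "card L \<le> card E2 / 4"
    proof -
      have "card L \<le> card {q \<in> A \<times> V. d2 (fst q) (snd q) \<le> \<eta>} * \<eta>"
      proof (rule card_cover_le[where B = "\<lambda>q. {e \<in> E1. fst q \<in> e \<and> snd q \<in> e}"])
        show "L \<subseteq> (\<Union>q\<in>{q \<in> A \<times> V. d2 (fst q) (snd q) \<le> \<eta>}. {e \<in> E1. fst q \<in> e \<and> snd q \<in> e})"
        proof
          fix e assume e: "e \<in> L"
          then obtain k where k: "k < r" "d2 (X e) (vt k e) < \<eta>" by (auto simp: L_def)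
          have e1: "e \<in> E1" "X e \<in> A" using e E2E1 by (auto simp: L_def A_def)
          show "e \<in> (\<Union>q\<in>{q \<in> A \<times> V. d2 (fst q) (snd q) \<le> \<eta>}. {e \<in> E1. fst q \<in> e \<and> snd q \<in> e})"
            using k e1 X(1)[OF e1(1)] vt(1)[OF e1(1) k(1)] E1(1)[OF e1(1)] by (intro UN_I[of "(X e, vt k e)"]) auto
        qed
      qed (use V fA fE1 in \<open>auto simp: d2_def\<close>)
      also have "\<dots> \<le> (real (card A) * real n) * \<eta>"
      proof (rule mult_right_mono)
        have "card {q \<in> A \<times> V. d2 (fst q) (snd q) \<le> \<eta>} \<le> card (A \<times> V)" using fA V by (intro card_mono) auto
        then have "real (card {q \<in> A \<times> V. d2 (fst q) (snd q) \<le> \<eta>}) \<le> real (card A * n)"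
          using V by (intro of_nat_mono) (simp add: card_cartesian_product)
        then show "real (card {q \<in> A \<times> V. d2 (fst q) (snd q) \<le> \<eta>}) \<le> real (card A) * real n" by simp
      qed (use D1 in \<open>simp add: \<eta>_def\<close>)
      also have "\<dots> = card A * (D1 / 2) / 4" using npos by (simp add: \<eta>_def)
      also have "\<dots> \<le> card E2 / 4" by (rule divide_right_mono[OF E2b(1)]) simp
      finally show ?thesis .
    qed
    have cH: "card Hv \<le> card E2 / 4"
    proof -
      define Y where "Y x = {y \<in> V - {x}. \<theta> \<le> d2 x y}" for x
      have fY: "finite (Y x)" for x using V by (simp add: Y_def)
      have cY: "card (Y x) \<le> s / 8" if x: "x \<in> A" for x
      proof -
        have "card (Y x) * \<theta> = (\<Sum>y\<in>Y x. \<theta>)" by simp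
        also have "\<dots> \<le> (\<Sum>y\<in>Y x. d2 x y)" by (intro sum_mono) (auto simp: Y_def)
        also have "\<dots> = (\<Sum>y\<in>Y x. \<Sum>e\<in>{e \<in> E1. x \<in> e}. of_bool (y \<in> e))"
        proof (rule sum.cong[OF refl])
          fix y
          have "{e \<in> E1. x \<in> e \<and> y \<in> e} = {e \<in> E1. x \<in> e} \<inter> {e. y \<in> e}" by auto
          then show "d2 x y = (\<Sum>e\<in>{e \<in> E1. x \<in> e}. of_bool (y \<in> e))"
            using fE1 by (simp add: d2_def of_bool_def sum.If_cases)
        qed
        also have "\<dots> = (\<Sum>e\<in>{e \<in> E1. x \<in> e}. \<Sum>y\<in>Y x. of_bool (y \<in> e))" by (rule sum.swap)
        also have "\<dots> \<le> (\<Sum>e\<in>{e \<in> E1. x \<in> e}. w1)"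
        proof (rule sum_mono)
          fix e assume e: "e \<in> {e \<in> E1. x \<in> e}"
          have "(\<Sum>y\<in>Y x. of_bool (y \<in> e)) = real (card (Y x \<inter> e))"
            using fY by (simp add: of_bool_def sum.If_cases)
          also have "\<dots> \<le> card (e - {x})" using e E1(3) by (intro of_nat_mono card_mono) (auto simp: Y_def)
          also have "\<dots> = w1" using e E1 by (simp add: w1_def)
          finally show "(\<Sum>y\<in>Y x. of_bool (y \<in> e)) \<le> w1" .
        qed
        also have "\<dots> = d1 x * w1" by (simp add: d1_def)
        also have "\<dots> \<le> D1 * w1" using dA[OF x] by (intro mult_right_mono) auto
        also have "\<dots> = (s / 8) * \<theta>" using s by (simp add: \<theta>_def)
        finally show ?thesis using \<theta> mult_le_cancel_right_pos by blast
      qed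
      have "card Hv \<le> card A * (D1 / 8)"
      proof (rule card_cover_le[where B = "\<lambda>x. {e. x \<in> e \<and> e - {x} \<subseteq> Y x \<and> card e = r}"])
        fix x assume x: "x \<in> A"
        have sub: "{e. x \<in> e \<and> e - {x} \<subseteq> Y x \<and> card e = r} \<subseteq> Pow (insert x (Y x))" by auto
        show "finite {e. x \<in> e \<and> e - {x} \<subseteq> Y x \<and> card e = r}"
          by (rule finite_subset[OF sub]) (use fY in simp)
        have "card {e. x \<in> e \<and> e - {x} \<subseteq> Y x \<and> card e = r} \<le> card {f. f \<subseteq> Y x \<and> card f = r - 1 \<and> {} \<subseteq> f}"
        proof (rule card_inj_on_le[of "\<lambda>e. e - {x}"])
          show "inj_on (\<lambda>e. e - {x}) {e. x \<in> e \<and> e - {x} \<subseteq> Y x \<and> card e = r}" by (auto simp: inj_on_def)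
          show "(\<lambda>e. e - {x}) ` {e. x \<in> e \<and> e - {x} \<subseteq> Y x \<and> card e = r} \<subseteq> {f. f \<subseteq> Y x \<and> card f = r - 1 \<and> {} \<subseteq> f}"
            using r by auto
          show "finite {f. f \<subseteq> Y x \<and> card f = r - 1 \<and> {} \<subseteq> f}"
            by (rule finite_subset[of _ "Pow (Y x)"]) (use fY in auto)
        qed
        also have "\<dots> \<le> card (Y x) ^ (r - 1 - card ({}::'a set))" by (rule card_supersets_le) (use fY in auto)
        finally have "real (card {e. x \<in> e \<and> e - {x} \<subseteq> Y x \<and> card e = r})
            \<le> real (card (Y x) ^ (r - 1 - card ({}::'a set)))" by (rule of_nat_mono)
        also have "\<dots> = real (card (Y x)) ^ (r - 1)" by simp
        also have "\<dots> \<le> (s / 8) ^ (r - 1)" using cY[OF x] by (intro power_mono) auto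
        also have "\<dots> = D1 / 8 ^ (r - 1)" using s by (simp add: power_divide)
        also have "\<dots> \<le> D1 / 8 ^ 1" using D1 r by (intro divide_left_mono power_increasing) auto
        finally show "real (card {e. x \<in> e \<and> e - {x} \<subseteq> Y x \<and> card e = r}) \<le> D1 / 8" by simp
      next
        show "Hv \<subseteq> (\<Union>x\<in>A. {e. x \<in> e \<and> e - {x} \<subseteq> Y x \<and> card e = r})"
        proof
          fix e assume e: "e \<in> Hv"
          then have e1: "e \<in> E1" "X e \<in> A" "e \<in> E2" using E2E1 by (auto simp: Hv_def A_def)
          have "y \<in> Y (X e)" if y: "y \<in> e - {X e}" for y
          proof -
            have "c y < r" using e1 y by (auto simp: E1_def)
            moreover have "c y \<noteq> 0" using Xeq[OF e1(1), of y] y by auto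
            moreover have "vt (c y) e = y" using vt_eq[OF e1(1)] y by auto
            moreover have "\<forall>k\<in>{1..<r}. \<theta> \<le> d2 (X e) (vt k e)" using e by (simp add: Hv_def)
            ultimately have "\<theta> \<le> d2 (X e) y" by (metis atLeastLessThan_iff less_one not_less)
            then show ?thesis using y E1(1)[OF e1(1)] by (auto simp: Y_def)
          qed
          then show "e \<in> (\<Union>x\<in>A. {e. x \<in> e \<and> e - {x} \<subseteq> Y x \<and> card e = r})"
            using e1 X E1 by (intro UN_I[of "X e"]) auto
        qed
      qed (use fA in auto)
      also have "\<dots> = card A * (D1 / 2) / 4" by simp
      also have "\<dots> \<le> card E2 / 4" by (rule divide_right_mono[OF E2b(1)]) simp
      finally show ?thesis .
    qed
    define E3 where "E3 k = {e \<in> E2. \<eta> \<le> d2 (X e) (vt k e) \<and> d2 (X e) (vt k e) < \<theta>}" for k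
    \<comment> \<open>An edge outside \<open>L\<close> and \<open>Hv\<close> has no light coordinate
      and some coordinate that is not heavy. At least half of \<open>E2\<close> is of this kind, and
      one coordinate serves a proportion \<open>1 / (r - 1)\<close> of these edges.\<close>
    have "\<exists>k\<in>{1..<r}. card E2 / (2 * w1) \<le> card (E3 k)"
    proof (rule ccontr)
      assume *: "\<not> ?thesis"
      have rr: "0 < w1" by (rule w1)
      have "card (E2 - (L \<union> Hv)) \<le> card {1..<r} * Max ((\<lambda>k. real (card (E3 k))) ` {1..<r})"
      proof (rule card_cover_le[where B = E3])
        show "E2 - (L \<union> Hv) \<subseteq> (\<Union>k\<in>{1..<r}. E3 k)"
          by (auto simp: L_def Hv_def E3_def not_le not_less)
      qed (use E2E1 in \<open>auto simp: E3_def\<close>)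
      also have "real (card {1..<r}) = w1" by (simp add: w1_def)
      also have "w1 * Max ((\<lambda>k. real (card (E3 k))) ` {1..<r}) < w1 * (card E2 / (2 * w1))"
      proof -
        have "Max ((\<lambda>k. real (card (E3 k))) ` {1..<r}) \<in> (\<lambda>k. real (card (E3 k))) ` {1..<r}"
          using r by (intro Max_in) auto
        then have "Max ((\<lambda>k. real (card (E3 k))) ` {1..<r}) < card E2 / (2 * w1)" using * by force
        then show ?thesis using rr by (rule mult_strict_left_mono)
      qed
      also have "\<dots> = card E2 / 2" using rr by simp
      finally have "card (E2 - (L \<union> Hv)) < card E2 / 2" .
      moreover have "real (card E2) - card (L \<union> Hv) \<le> card (E2 - (L \<union> Hv))"
      proof -
        have "finite (L \<union> Hv)" using E2E1 by (auto simp: L_def Hv_def)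
        from diff_card_le_card_Diff[OF this, of E2] show ?thesis by linarith
      qed
      moreover have "card (L \<union> Hv) \<le> card E2 / 2"
        using card_Un_le[of L Hv] cL cH by linarith
      ultimately show False by linarith
    qed
    then obtain k where k: "k \<in> {1..<r}" and E3c: "card E2 / (2 * w1) \<le> card (E3 k)" by blast
    have k': "k < r" "k \<noteq> 0" using k by auto
    \<comment> \<open>The codegrees range from 1 up to less than \<theta>, which is below
      \<open>8 * 2 ^ r * 2 ^ m1\<close>; the number of dyadic classes is still logarithmic in
      \<open>n\<close>.\<close>
    define m2 where "m2 = r + 3 + m1"
    have "1 \<le> D1"
    proof -
      obtain e where "e \<in> E2" using E2pos by (metis all_not_in_conv card.empty less_irrefl of_nat_0)
      then show ?thesis using d1_ge[of e] E2E1 by (auto simp: E2_def)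
    qed
    then have s1: "1 \<le> s" using s r by (intro real_pow_ge1[of s "r - 1"]) auto
    have \<theta>2: "\<theta> < 2 ^ m2"
    proof -
      have "\<theta> \<le> 8 * w1 * D1 / 1"
        unfolding \<theta>_def using s1 D1 by (intro divide_left_mono) auto
      also have "\<dots> \<le> 8 * 2 ^ r * real n ^ (r - 1)"
      proof -
        have "real r < 2 ^ r" by (rule of_nat_less_two_power)
        then have "w1 \<le> 2 ^ r" using w1 by linarith
        moreover have "D1 \<le> real n ^ (r - 1)" using npos by (simp add: D1_def divide_le_eq mult_ge1_I)
        ultimately have "(8 * w1) * D1 \<le> (8 * 2 ^ r) * real n ^ (r - 1)"
          using D1 by (intro mult_mono) auto
        then show ?thesis by simp
      qed
      also have "\<dots> < 8 * 2 ^ r * 2 ^ m1" using m1 by simp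
      also have "\<dots> = 2 ^ m2" by (simp add: m2_def power_add)
      finally show ?thesis .
    qed
    define g where "g e = d2 (X e) (vt k e)" for e
    have g1: "1 \<le> g e" if e: "e \<in> E1" for e
    proof -
      have "e \<in> {e' \<in> E1. X e \<in> e' \<and> vt k e \<in> e'}" using e X(1)[OF e] vt(1)[OF e k'(1)] by auto
      then have "0 < card {e' \<in> E1. X e \<in> e' \<and> vt k e \<in> e'}" using fE1 by (auto simp: card_gt_0_iff)
      then show ?thesis by (simp add: g_def d2_def)
    qed
    have fE3: "finite (E3 k)" "E3 k \<subseteq> E2" using E2E1 by (auto simp: E3_def)
    have m2: "m2 \<ge> 1" by (simp add: m2_def)
    obtain j where j: "card (E3 k) / (2 * real m2) \<le> card {e \<in> E3 k. \<theta> / 2 ^ j / 2 < g e \<and> g e \<le> \<theta> / 2 ^ j}"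
      "card (E3 k) * (4/5) ^ j / 10 \<le> card {e \<in> E3 k. \<theta> / 2 ^ j / 2 < g e \<and> g e \<le> \<theta> / 2 ^ j}"
    proof (rule dyadic_class[OF fE3(1) m2, of \<theta> g])
      fix e assume e: "e \<in> E3 k"
      then have "1 \<le> g e" using g1 fE3(2) E2E1 by blast
      moreover have "\<theta> / 2 ^ m2 < 1" using \<theta>2 by simp
      moreover have "g e \<le> \<theta>" using e by (simp add: E3_def g_def)
      ultimately show "\<theta> / 2 ^ m2 < g e \<and> g e \<le> \<theta>" by linarith
    qed (use that in blast)
    define D where "D = \<theta> / 2 ^ j"
    have D: "D > 0" using \<theta> by (simp add: D_def)
    define E4 where "E4 = {e \<in> E3 k. D / 2 < g e \<and> g e \<le> D}"
    have E4c: "card (E3 k) / (2 * real m2) \<le> card E4" "card (E3 k) * (4/5) ^ j / 10 \<le> card E4"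
      using j by (auto simp: E4_def D_def)
    have E4s: "E4 \<subseteq> E3 k" "finite E4" "E4 \<subseteq> E1" "E4 \<subseteq> E" "E4 \<subseteq> E2"
      using fE3 E2E1 by (auto simp: E4_def E1_def)
    define \<phi> where "\<phi> e = {X e, vt k e}" for e
    define B where "B = vt k ` E4"
    define N where "N = real (card (\<phi> ` E4))"
    have fib: "D / 2 \<le> real (card {e \<in> E4. \<phi> e = f}) \<and> real (card {e \<in> E4. \<phi> e = f}) \<le> D" if f: "f \<in> \<phi> ` E4" for f
    proof -
      obtain e0 where e0: "e0 \<in> E4" "f = \<phi> e0" using f by blast
      define x y where "x = X e0" and "y = vt k e0"
      have e01: "e0 \<in> E1" using e0 E4s by blast
      have cxy: "c x = 0" "c y = k" "x \<in> A" using X[OF e01] vt[OF e01 k'(1)] e0 E4s by (auto simp: x_def y_def A_def)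
      \<comment> \<open>Membership in \<open>E4\<close> depends only on the pair, so every fibre is
        the full set of edges of \<open>E1\<close> through \<open>x\<close> and
        \<open>y\<close>.\<close>
      have "{e \<in> E4. \<phi> e = f} = {e \<in> E1. x \<in> e \<and> y \<in> e}"
      proof
        show "{e \<in> E4. \<phi> e = f} \<subseteq> {e \<in> E1. x \<in> e \<and> y \<in> e}"
        proof
          fix e assume e: "e \<in> {e \<in> E4. \<phi> e = f}"
          then have e1: "e \<in> E1" using E4s by blast
          have "\<phi> e \<subseteq> e" using X[OF e1] vt[OF e1 k'(1)] by (auto simp: \<phi>_def)
          moreover have "\<phi> e = {x, y}" using e e0 by (simp add: \<phi>_def x_def y_def)
          ultimately show "e \<in> {e \<in> E1. x \<in> e \<and> y \<in> e}" using e1 by auto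
        qed
        show "{e \<in> E1. x \<in> e \<and> y \<in> e} \<subseteq> {e \<in> E4. \<phi> e = f}"
        proof
          fix e assume e: "e \<in> {e \<in> E1. x \<in> e \<and> y \<in> e}"
          then have e1: "e \<in> E1" and xy: "X e = x" "vt k e = y" using Xeq vt_eq cxy by auto
          have "e \<in> E2" using fibA[OF cxy(3)] e by blast
          moreover have "g e = g e0" using xy by (simp add: g_def x_def y_def)
          moreover have "g e0 = d2 (X e0) (vt k e0)" "g e = d2 (X e) (vt k e)" by (simp_all add: g_def)
          ultimately have "e \<in> E4" using e0(1) by (auto simp: E4_def E3_def)
          then show "e \<in> {e \<in> E4. \<phi> e = f}" using xy e0 by (simp add: \<phi>_def x_def y_def)
        qed
      qed
      then have "real (card {e \<in> E4. \<phi> e = f}) = g e0" by (simp add: g_def d2_def x_def y_def)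
      then show ?thesis using e0 by (simp add: E4_def)
    qed
    have ND: "card E4 \<le> N * D" unfolding N_def using card_fibres(2)[OF E4s(2) fib] by simp
    have E3pos: "0 < real (card (E3 k))"
    proof -
      have "0 < card E2 / (2 * w1)" using E2pos w1 by simp
      then show ?thesis using E3c by linarith
    qed
    have E4ne: "E4 \<noteq> {}"
    proof -
      have "0 < card (E3 k) / (2 * real m2)" using E3pos m2 by simp
      then have "0 < real (card E4)" using E4c(1) by linarith
      then show ?thesis by auto
    qed
    have lnn: "0 < ln (real n)" using n by simp
    show ?thesis
    proof (intro exI conjI)
      show "E4 \<subseteq> E" by (rule E4s)
      show "A \<subseteq> V" using dA by blast
      show "B \<subseteq> V" using vt(1)[OF _ k'(1)] E1(1) E4s unfolding B_def by blast
      show "A \<inter> B = {}"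
      proof -
        have "c y = k" if "y \<in> B" for y using that vt(2)[OF _ k'(1)] E4s by (auto simp: B_def)
        then show ?thesis using dA(3) k'(2) by fastforce
      qed
      show "A \<noteq> {}" by (rule Ane)
      show "\<forall>e\<in>E4. \<exists>x\<in>A. \<exists>y\<in>B. \<phi> e = {x, y} \<and> {x, y} \<subseteq> e"
      proof
        fix e assume e: "e \<in> E4"
        then have "e \<in> E1" "X e \<in> A" "vt k e \<in> B" using E4s by (auto simp: A_def B_def)
        moreover have "X e \<in> e" "vt k e \<in> e" using calculation X vt k' by auto
        ultimately show "\<exists>x\<in>A. \<exists>y\<in>B. \<phi> e = {x, y} \<and> {x, y} \<subseteq> e"
          by (intro bexI[of _ "X e"] bexI[of _ "vt k e"]) (auto simp: \<phi>_def)
      qed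
      show "\<forall>f\<in>\<phi> ` E4. D / 2 \<le> real (card {e \<in> E4. \<phi> e = f}) \<and> real (card {e \<in> E4. \<phi> e = f}) \<le> D"
        using fib by blast
      show "0 < s" by (rule s)
      show "s ^ (r - 1) = real n ^ (r - 1) / 2 ^ i" using s by (simp add: D1_def)
      have a1: "t * real n ^ (r - 1) / (2 * real r ^ r) \<le> card E1'"
      proof -
        have "t * real n ^ (r - 1) / (2 * real r ^ r) = (t * real n ^ (r - 1) / real r ^ r) / 2" by simp
        also have "\<dots> \<le> card E1 / 2" by (rule divide_right_mono[OF cE1]) simp
        also note cE1'
        finally show ?thesis .
      qed
      show "\<kappa> * card E \<le> card E4 * (ln (real n))\<^sup>2"
      proof -
        have m1b: "real m1 \<le> 4 * real r * ln (real n)"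
        proof -
          have "real m1 = real kk * w1" by (simp add: m1_def w1_def)
          also have "\<dots> \<le> (4 * ln (real n)) * real r" using kk(3) w1 by (intro mult_mono) auto
          finally show ?thesis by (simp add: mult_ac)
        qed
        have m2b: "real m2 \<le> 12 * real r * ln (real n)"
        proof -
          have "m2 \<le> kk * (3 * r)"
          proof -
            have "m2 \<le> kk * (r + 3) + kk * (r - 1)" using kk(2) by (simp add: m2_def m1_def Suc_le_eq)
            also have "\<dots> = kk * (r + 3 + (r - 1))" by (rule distrib_left[symmetric])
            also have "\<dots> \<le> kk * (3 * r)" using r by (intro mult_le_mono2) simp
            finally show ?thesis .
          qed
          then have "real m2 \<le> real kk * (3 * real r)" by (metis of_nat_le_iff of_nat_mult of_nat_numeral)
          also have "\<dots> \<le> (4 * ln (real n)) * (3 * real r)" using kk(3) by (intro mult_right_mono) auto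
          finally show ?thesis by (simp add: mult_ac)
        qed
        have mpos: "0 < real m1" "0 < real m2" using m1 m2 by auto
        have "card E1' \<le> card E2 * (2 * real m1)" using E2c(1) mpos by (simp add: pos_divide_le_eq)
        moreover have "card E2 \<le> card (E3 k) * (2 * w1)" using E3c w1 by (simp add: pos_divide_le_eq)
        moreover have "card (E3 k) \<le> card E4 * (2 * real m2)" using E4c(1) mpos by (simp add: pos_divide_le_eq)
        moreover have "card E \<le> 2 * real r ^ r * card E1'"
          using a1 rpos unfolding cE by (simp add: pos_divide_le_eq mult_ac)
        ultimately have "card E \<le> 2 * real r ^ r * (card E4 * (2 * real m2) * (2 * w1) * (2 * real m1))"
          using mpos w1 rpos
          by (smt (verit) mult_left_mono mult_right_mono mult_pos_pos zero_less_power)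
        also have "\<dots> \<le> 2 * real r ^ r * (card E4 * (2 * (12 * real r * ln (real n))) * (2 * real r) * (2 * (4 * real r * ln (real n))))"
          using m1b m2b w1 mpos rpos lnn by (intro mult_left_mono mult_mono) auto
        also have "\<dots> = card E4 * (ln (real n))\<^sup>2 / \<kappa>1" by (simp add: \<kappa>1_def power2_eq_square)
        finally have "\<kappa>1 * card E \<le> card E4 * (ln (real n))\<^sup>2" using rpos by (simp add: \<kappa>1_def field_simps)
        moreover have "\<kappa> * card E \<le> \<kappa>1 * card E" using \<kappa>le by (intro mult_right_mono) auto
        ultimately show ?thesis by linarith
      qed
      \<comment> \<open>From \<open>card E4 \<le> N * D\<close> with
        \<open>D = \<theta> / 2 ^ j\<close>: the dyadic class loses a factor
        \<open>(4/5) ^ j\<close>, while the smaller codegree gains \<open>2 ^ j\<close> in the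
        number of pairs. So \<open>j = 0\<close> is the worst case, where
        \<open>\<theta> = 8 * w1 * D1 / s\<close> gives \<open>card A * s\<close> up to a
        constant.\<close>
      show "\<kappa> * card A * s \<le> card (\<phi> ` E4)"
      proof -
        have "card (E3 k) * (4/5) ^ j / 10 \<le> N * (\<theta> / 2 ^ j)" using order_trans[OF E4c(2) ND] unfolding D_def .
        then have "card (E3 k) * ((4/5) ^ j * 2 ^ j) / 10 \<le> N * \<theta>" by (simp add: field_simps)
        moreover have "(4/5) ^ j * 2 ^ j = (8/5 :: real) ^ j" by (simp flip: power_mult_distrib)
        moreover have "real (card (E3 k)) * 1 / 10 \<le> card (E3 k) * (8/5 :: real) ^ j / 10"
          by (rule divide_right_mono[OF mult_left_mono[OF one_le_power]]) auto
        ultimately have "card (E3 k) \<le> 10 * (N * \<theta>)" by simp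
        moreover have "card E2 \<le> card (E3 k) * (2 * w1)" using E3c w1 by (simp add: pos_divide_le_eq)
        moreover have "card (E3 k) * (2 * w1) \<le> 10 * (N * \<theta>) * (2 * w1)"
          using calculation(1) w1 by (intro mult_right_mono) auto
        ultimately have "card A * (D1 / 2) \<le> 10 * (N * \<theta>) * (2 * w1)" using E2b(1) by linarith
        also have "\<dots> = N * (160 * (w1)\<^sup>2) * D1 / s" by (simp add: \<theta>_def power2_eq_square)
        finally have "(card A * s) * D1 \<le> N * (320 * (w1)\<^sup>2) * D1" using s by (simp add: field_simps)
        then have "card A * s \<le> N * (320 * (w1)\<^sup>2)" using D1 mult_le_cancel_right_pos by blast
        also have "\<dots> \<le> N * (320 * (real r)\<^sup>2)" using w1 by (intro mult_left_mono power_mono) (auto simp: N_def)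
        finally have "1 / (320 * (real r)\<^sup>2) * (card A * s) \<le> N" using rpos by (simp add: field_simps)
        moreover have "\<kappa> * (card A * s) \<le> 1 / (320 * (real r)\<^sup>2) * (card A * s)"
          using \<kappa>le s by (intro mult_right_mono) auto
        ultimately show ?thesis unfolding N_def mult.assoc by (rule order_trans[rotated])
      qed
      \<comment> \<open>The same trade-off for degrees: \<open>card E2 \<le> card A * D1\<close>
        with \<open>D1 = n ^ (r - 1) / 2 ^ i\<close>.\<close>
      show "\<kappa> * t * (8/5) ^ i \<le> card A"
      proof -
        define P where "P = real n ^ (r - 1)"
        have P: "P > 0" using npos by (simp add: P_def)
        have "t * P / (2 * real r ^ r) * (4/5) ^ i / 10 \<le> card E1' * (4/5) ^ i / 10"
          using a1 by (intro divide_right_mono mult_right_mono) (auto simp: P_def)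
        also have "\<dots> \<le> card A * (P / 2 ^ i)" using order_trans[OF E2c(2) E2b(2)] unfolding D1_def P_def .
        finally have "(1 / (20 * real r ^ r) * t * ((4/5) ^ i * 2 ^ i)) * P \<le> card A * P" by (simp add: field_simps)
        then have "1 / (20 * real r ^ r) * t * ((4/5) ^ i * 2 ^ i) \<le> card A" using P mult_le_cancel_right_pos by blast
        moreover have "(4/5) ^ i * 2 ^ i = (8/5 :: real) ^ i" by (simp flip: power_mult_distrib)
        moreover have "\<kappa> * t * (8/5) ^ i \<le> 1 / (20 * real r ^ r) * t * (8/5) ^ i"
          using \<kappa>le t by (intro mult_right_mono) auto
        ultimately show ?thesis by simp
      qed
      have \<kappa>2: "\<kappa> * t * y \<le> t * y / (2 * real r ^ r)" "\<kappa> * t * y \<le> t * y / (16 * real r ^ r)" if "y \<ge> 0" for y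
      proof -
        have "\<kappa> * (t * y) \<le> 1 / (20 * real r ^ r) * (t * y)" using \<kappa>le t that by (intro mult_right_mono) auto
        moreover have "1 / (20 * real r ^ r) * (t * y) \<le> 1 / (2 * real r ^ r) * (t * y)"
          "1 / (20 * real r ^ r) * (t * y) \<le> 1 / (16 * real r ^ r) * (t * y)"
          using t that rpos by (intro mult_right_mono frac_le; simp)+
        ultimately show "\<kappa> * t * y \<le> t * y / (2 * real r ^ r)" "\<kappa> * t * y \<le> t * y / (16 * real r ^ r)" by auto
      qed
      show "\<kappa> * t * real n ^ (r - 2) \<le> s ^ (r - 1)" using \<kappa>2(1)[of "real n ^ (r - 2)"] D1low s by simp
      show "\<kappa> * t * real n ^ (r - 3) \<le> D"
      proof -
        obtain e where e: "e \<in> E4" using E4ne by blast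
        then have "\<eta> \<le> D" using E4s(1) by (auto simp: E4_def E3_def g_def)
        moreover have "t * real n ^ (r - 3) / (16 * real r ^ r) \<le> \<eta>"
        proof -
          have "r - 2 = Suc (r - 3)" using r by simp
          then have "t * real n ^ (r - 3) / (16 * real r ^ r) = t * real n ^ (r - 2) / (2 * real r ^ r) / (8 * real n)"
            using npos by simp
          also have "\<dots> \<le> \<eta>" unfolding \<eta>_def using D1low npos by (intro divide_right_mono) auto
          finally show ?thesis .
        qed
        ultimately show ?thesis using \<kappa>2(2)[of "real n ^ (r - 3)"] by simp
      qed
    qed
  qed
  show ?thesis
    by (rule exI[of _ \<kappa>], rule conjI[OF \<kappa>], intro allI impI, elim conjE) (rule main)
qed

section \<open>Clones and copies of linear cycles\<close>

text \<open>The edges at \<open>v\<close> are numbered by \<open>\<iota> v\<close> and cut into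
  blocks of length \<open>m\<close>, one clone per block. A vertex needs at most one clone beyond
  its degree divided by \<open>m\<close>, which gives at most \<open>card G / m + card S\<close>
  clones.\<close>

lemma side_clones:
  fixes G :: "'a set set" and \<iota> :: "'a \<Rightarrow> 'a set \<Rightarrow> nat" and x :: real
  defines "m \<equiv> nat \<lceil>card G / x\<rceil>"
  assumes fin: "finite G" "finite S" and one: "\<And>f. f \<in> G \<Longrightarrow> card (f \<inter> S) = 1"
    and x: "0 < x" "card S \<le> x" "x \<le> card G"
    and \<iota>: "\<And>v. inj_on (\<iota> v) {f \<in> G. v \<in> f}" "\<And>v f. f \<in> G \<Longrightarrow> v \<in> f \<Longrightarrow> \<iota> v f < card {f \<in> G. v \<in> f}"
  shows "card (\<Union>v\<in>S. (\<lambda>f. (v, \<iota> v f div m)) ` {f \<in> G. v \<in> f}) \<le> 2 * x"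
    and "card {f \<in> G. v \<in> f \<and> \<iota> v f div m = q} \<le> 2 * card G / x"
proof -
  have m: "m > 0" "card G / x \<le> m" "m \<le> card G / x + 1"
  proof -
    have "1 \<le> card G / x" using x by simp
    then show "m > 0" "card G / x \<le> m" "m \<le> card G / x + 1" unfolding m_def by linarith+
  qed
  have fib: "card {f \<in> G. v \<in> f \<and> \<iota> v f div m = q} \<le> m" for v q
  proof -
    have "card {f \<in> G. v \<in> f \<and> \<iota> v f div m = q} \<le> card {q * m..<q * m + m}"
    proof (rule card_inj_on_le[of "\<iota> v"])
      show "inj_on (\<iota> v) {f \<in> G. v \<in> f \<and> \<iota> v f div m = q}" using \<iota>(1) by (rule inj_on_subset) auto
      show "\<iota> v ` {f \<in> G. v \<in> f \<and> \<iota> v f div m = q} \<subseteq> {q * m..<q * m + m}"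
        using m(1) by (auto simp: div_times_less_eq_dividend dividend_less_div_times add.commute)
    qed simp
    then show ?thesis by simp
  qed
  show "card {f \<in> G. v \<in> f \<and> \<iota> v f div m = q} \<le> 2 * card G / x"
  proof -
    have "real (card {f \<in> G. v \<in> f \<and> \<iota> v f div m = q}) \<le> m" using fib by simp
    also have "\<dots> \<le> card G / x + card G / x" using m(3) x by (simp add: field_simps)
    finally show ?thesis by simp
  qed
  have each: "real (card ((\<lambda>f. (v, \<iota> v f div m)) ` {f \<in> G. v \<in> f})) \<le> card {f \<in> G. v \<in> f} / m + 1" for v
  proof -
    have "card ((\<lambda>f. (v, \<iota> v f div m)) ` {f \<in> G. v \<in> f}) \<le> card ((\<lambda>q. (v, q)) ` {..card {f \<in> G. v \<in> f} div m})"
    proof (rule card_mono)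
      show "(\<lambda>f. (v, \<iota> v f div m)) ` {f \<in> G. v \<in> f} \<subseteq> (\<lambda>q. (v, q)) ` {..card {f \<in> G. v \<in> f} div m}"
      proof
        fix z assume "z \<in> (\<lambda>f. (v, \<iota> v f div m)) ` {f \<in> G. v \<in> f}"
        then obtain f where f: "f \<in> G" "v \<in> f" "z = (v, \<iota> v f div m)" by blast
        have "\<iota> v f div m \<le> card {f \<in> G. v \<in> f} div m"
          by (rule div_le_mono[OF less_imp_le[OF \<iota>(2)[OF f(1,2)]]])
        then show "z \<in> (\<lambda>q. (v, q)) ` {..card {f \<in> G. v \<in> f} div m}" using f(3) by blast
      qed
    qed simp
    also have "\<dots> \<le> card {f \<in> G. v \<in> f} div m + 1" by (rule order_trans[OF card_image_le]) auto
    finally have "real (card ((\<lambda>f. (v, \<iota> v f div m)) ` {f \<in> G. v \<in> f})) \<le> real (card {f \<in> G. v \<in> f} div m) + 1" by linarith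
    also have "real (card {f \<in> G. v \<in> f} div m) \<le> card {f \<in> G. v \<in> f} / m" by (rule of_nat_div_le_of_nat)
    finally show ?thesis by simp
  qed
  have sumdeg: "(\<Sum>v\<in>S. real (card {f \<in> G. v \<in> f})) = card G"
  proof -
    have "(\<Sum>v\<in>S. real (card {f \<in> G. v \<in> f})) = (\<Sum>v\<in>S. \<Sum>f\<in>G. of_bool (v \<in> f))"
      using fin by (simp add: of_bool_def sum.If_cases Int_def)
    also have "\<dots> = (\<Sum>f\<in>G. \<Sum>v\<in>S. of_bool (v \<in> f))" by (rule sum.swap)
    also have "\<dots> = (\<Sum>f\<in>G. 1)"
    proof (rule sum.cong[OF refl])
      fix f assume "f \<in> G"
      then show "(\<Sum>v\<in>S. of_bool (v \<in> f)) = (1::real)"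
        using fin one[of f] by (simp add: of_bool_def sum.If_cases Int_commute)
    qed
    finally show ?thesis by simp
  qed
  have "card (\<Union>v\<in>S. (\<lambda>f. (v, \<iota> v f div m)) ` {f \<in> G. v \<in> f})
      \<le> (\<Sum>v\<in>S. card ((\<lambda>f. (v, \<iota> v f div m)) ` {f \<in> G. v \<in> f}))" by (rule card_UN_le[OF fin(2)])
  then have "real (card (\<Union>v\<in>S. (\<lambda>f. (v, \<iota> v f div m)) ` {f \<in> G. v \<in> f}))
      \<le> real (\<Sum>v\<in>S. card ((\<lambda>f. (v, \<iota> v f div m)) ` {f \<in> G. v \<in> f}))" by (rule of_nat_mono)
  also have "\<dots> = (\<Sum>v\<in>S. real (card ((\<lambda>f. (v, \<iota> v f div m)) ` {f \<in> G. v \<in> f})))" by (rule of_nat_sum)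
  also have "\<dots> \<le> (\<Sum>v\<in>S. card {f \<in> G. v \<in> f} / m + 1)" by (rule sum_mono[OF each])
  also have "\<dots> = card G / m + card S" by (simp add: sum.distrib sum_divide_distrib[symmetric] sumdeg)
  also have "\<dots> \<le> x + x"
  proof (rule add_mono)
    show "card G / m \<le> x" using m x by (simp add: field_simps)
  qed (rule x)
  finally show "card (\<Union>v\<in>S. (\<lambda>f. (v, \<iota> v f div m)) ` {f \<in> G. v \<in> f}) \<le> 2 * x" by simp
qed

text \<open>Splitting every vertex into clones of bounded degree replaces a regularisation of the degrees,
  which would cost further logarithmic factors.\<close>

lemma clone_graph:
  fixes G :: "'a set set" and a b :: real
  assumes fin: "finite A" "finite B" and disj: "A \<inter> B = {}"
    and G: "\<forall>f\<in>G. \<exists>x\<in>A. \<exists>y\<in>B. f = {x, y}"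
    and ab: "0 < a" "card A \<le> a" "a \<le> card G" "0 < b" "card B \<le> b" "b \<le> card G"
  shows "\<exists>(cl :: 'a set \<Rightarrow> ('a \<times> nat) set) U W. (\<forall>f. fst ` cl f = f) \<and> finite U \<and> finite W \<and> U \<inter> W = {} \<and>
    (\<forall>f\<in>G. \<exists>u\<in>U. \<exists>w\<in>W. cl f = {u, w}) \<and> card U \<le> 2 * a \<and> card W \<le> 2 * b \<and>
    (\<forall>u\<in>U. card {e \<in> cl ` G. u \<in> e} \<le> 2 * card G / a) \<and>
    (\<forall>w\<in>W. card {e \<in> cl ` G. w \<in> e} \<le> 2 * card G / b)"
proof -
  have fG: "finite G" by (rule finite_subset[of _ "Pow (A \<union> B)"]) (use G fin in auto)
  have "\<forall>v. \<exists>h. bij_betw h {f \<in> G. v \<in> f} {0..<card {f \<in> G. v \<in> f}}"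
    using fG by (intro allI ex_bij_betw_finite_nat) auto
  from choice[OF this] obtain \<iota> where "\<forall>v. bij_betw (\<iota> v) {f \<in> G. v \<in> f} {0..<card {f \<in> G. v \<in> f}}" by blast
  then have \<iota>: "\<And>v. inj_on (\<iota> v) {f \<in> G. v \<in> f}"
      "\<And>v. \<iota> v ` {f \<in> G. v \<in> f} = {0..<card {f \<in> G. v \<in> f}}" by (auto simp only: bij_betw_def)
  have \<iota>2: "\<iota> v f < card {f \<in> G. v \<in> f}" if "f \<in> G" "v \<in> f" for v f
  proof -
    have "\<iota> v f \<in> \<iota> v ` {f \<in> G. v \<in> f}" using that by blast
    then show ?thesis unfolding \<iota>(2) by simp
  qed
  have oneA: "card (f \<inter> A) = 1" if f: "f \<in> G" for f
  proof -
    obtain x y where "x \<in> A" "y \<in> B" "f = {x, y}" using G[rule_format, OF f] by blast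
    then have "f \<inter> A = {x}" using disj by auto
    then show ?thesis by simp
  qed
  have oneB: "card (f \<inter> B) = 1" if f: "f \<in> G" for f
  proof -
    obtain x y where "x \<in> A" "y \<in> B" "f = {x, y}" using G[rule_format, OF f] by blast
    then have "f \<inter> B = {y}" using disj by auto
    then show ?thesis by simp
  qed
  define mA where "mA = nat \<lceil>card G / a\<rceil>"
  define mB where "mB = nat \<lceil>card G / b\<rceil>"
  define m where "m v = (if v \<in> A then mA else mB)" for v
  \<comment> \<open>Each end of an edge is tagged with its block at that end. Forgetting the tags
    recovers the edge, so no two edges are identified.\<close>
  define cl where "cl f = (\<lambda>v. (v, \<iota> v f div m v)) ` f" for f
  define U where "U = (\<Union>v\<in>A. (\<lambda>f. (v, \<iota> v f div mA)) ` {f \<in> G. v \<in> f})"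
  define W where "W = (\<Union>v\<in>B. (\<lambda>f. (v, \<iota> v f div mB)) ` {f \<in> G. v \<in> f})"
  have fcl: "fst ` cl f = f" for f by (auto simp: cl_def image_image)
  have degcl: "card {e \<in> cl ` G. (v, q) \<in> e} \<le> card {f \<in> G. v \<in> f \<and> \<iota> v f div m v = q}" for v q
  proof -
    have "{e \<in> cl ` G. (v, q) \<in> e} \<subseteq> cl ` {f \<in> G. v \<in> f \<and> \<iota> v f div m v = q}" by (auto simp: cl_def)
    then have "card {e \<in> cl ` G. (v, q) \<in> e} \<le> card (cl ` {f \<in> G. v \<in> f \<and> \<iota> v f div m v = q})"
      using fG by (intro card_mono) auto
    also have "\<dots> \<le> card {f \<in> G. v \<in> f \<and> \<iota> v f div m v = q}" using fG by (intro card_image_le) auto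
    finally show ?thesis .
  qed
  show ?thesis
  proof (rule exI[of _ cl], rule exI[of _ U], rule exI[of _ W], intro conjI allI ballI)
    show "fst ` cl f = f" for f by (rule fcl)
    show "finite U" "finite W" using fin fG by (auto simp: U_def W_def)
    show "U \<inter> W = {}" using disj by (auto simp: U_def W_def)
    show "card U \<le> 2 * a" unfolding U_def mA_def
      using side_clones(1)[OF fG fin(1) oneA ab(1-3) \<iota>(1) \<iota>2] by simp
    show "card W \<le> 2 * b" unfolding W_def mB_def
      using side_clones(1)[OF fG fin(2) oneB ab(4-6) \<iota>(1) \<iota>2] by simp
    show "\<exists>u\<in>U. \<exists>w\<in>W. cl f = {u, w}" if f: "f \<in> G" for f
    proof -
      obtain x y where xy: "x \<in> A" "y \<in> B" "f = {x, y}" using G[rule_format, OF f] by blast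
      moreover have "y \<notin> A" using xy disj by auto
      ultimately show ?thesis using f
        by (intro bexI[of _ "(x, \<iota> x f div mA)"] bexI[of _ "(y, \<iota> y f div mB)"])
          (auto simp: cl_def m_def U_def W_def)
    qed
    show "card {e \<in> cl ` G. u \<in> e} \<le> 2 * card G / a" if u: "u \<in> U" for u
    proof -
      obtain v q where vq: "u = (v, q)" by (cases u)
      have "v \<in> A" using u vq by (auto simp: U_def)
      then have "m v = mA" by (simp add: m_def)
      then have "real (card {e \<in> cl ` G. u \<in> e}) \<le> card {f \<in> G. v \<in> f \<and> \<iota> v f div mA = q}"
        using degcl[of v q] vq by simp
      also have "\<dots> \<le> 2 * card G / a" unfolding mA_def
        using side_clones(2)[OF fG fin(1) oneA ab(1-3) \<iota>(1) \<iota>2] by simp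
      finally show ?thesis .
    qed
    show "card {e \<in> cl ` G. w \<in> e} \<le> 2 * card G / b" if w: "w \<in> W" for w
    proof -
      obtain v q where vq: "w = (v, q)" by (cases w)
      have "v \<in> B" using w vq by (auto simp: W_def)
      then have "m v = mB" using disj by (auto simp: m_def)
      then have "real (card {e \<in> cl ` G. w \<in> e}) \<le> card {f \<in> G. v \<in> f \<and> \<iota> v f div mB = q}"
        using degcl[of v q] vq by simp
      also have "\<dots> \<le> 2 * card G / b" unfolding mB_def
        using side_clones(2)[OF fG fin(2) oneB ab(4-6) \<iota>(1) \<iota>2] by simp
      finally show ?thesis .
    qed
  qed
qed

text \<open>The block \<open>blk i\<close> consists of the labels of an edge of the linear cycle
  without its first one. The blocks partition the labels, so it suffices to map each
  \<open>blk i\<close> bijectively onto \<open>e i - {x i}\<close>, with its last label going to the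
  next core vertex; \<open>disj\<close> then yields injectivity.\<close>

lemma linear_cycle_copy:
  fixes x :: "nat \<Rightarrow> 'a" and e :: "nat \<Rightarrow> 'a set"
  assumes k: "k \<ge> 1" and r: "r \<ge> 2"
    and e: "\<And>i. i < k \<Longrightarrow> card (e i) = r \<and> x i \<in> e i \<and> x (Suc i mod k) \<in> e i \<and> x (Suc i mod k) \<noteq> x i"
    and disj: "\<And>i j. i < k \<Longrightarrow> j < k \<Longrightarrow> i \<noteq> j \<Longrightarrow> (e i - {x i}) \<inter> (e j - {x j}) = {}"
    and F: "\<And>i. i < k \<Longrightarrow> e i \<in> edges F \<and> e i \<subseteq> verts F"
  shows "contains_copy F (linear_cycle r k)"
proof -
  define s where "s = r - 1"
  have s: "s \<ge> 1" using r by (simp add: s_def)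
  define blk where "blk i = {i * s + 1..(i + 1) * s}" for i
  have fe: "finite (e i)" if "i < k" for i using e[OF that] r by (intro card_ge_0_finite) auto
  have "\<exists>b. bij_betw b (blk i) (e i - {x i}) \<and> b ((i + 1) * s) = x (Suc i mod k)" if i: "i < k" for i
  proof -
    have cards: "card (blk i - {(i + 1) * s}) = card (e i - {x i, x (Suc i mod k)})"
    proof -
      have "(i + 1) * s \<in> blk i" using s by (simp add: blk_def)
      then have "card (blk i - {(i + 1) * s}) = s - 1" by (simp add: blk_def)
      moreover have "card (e i - {x i, x (Suc i mod k)}) = r - 2"
        using e[OF i] fe[OF i] by (subst card_Diff_subset) auto
      ultimately show ?thesis by (simp add: s_def)
    qed
    have "finite (blk i - {(i + 1) * s})" "finite (e i - {x i, x (Suc i mod k)})"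
      using fe[OF i] by (auto simp: blk_def)
    then have "\<exists>b. bij_betw b (blk i - {(i + 1) * s}) (e i - {x i, x (Suc i mod k)})"
      using cards by (simp only: bij_betw_iff_card)
    then obtain b where b: "bij_betw b (blk i - {(i + 1) * s}) (e i - {x i, x (Suc i mod k)})" by blast
    have "bij_betw (b((i + 1) * s := x (Suc i mod k))) (insert ((i + 1) * s) (blk i - {(i + 1) * s}))
       (insert (x (Suc i mod k)) (e i - {x i, x (Suc i mod k)}))"
      using b by (auto simp: bij_betw_def inj_on_def image_iff) 
    moreover have "insert ((i + 1) * s) (blk i - {(i + 1) * s}) = blk i" using s by (auto simp: blk_def)
    moreover have "insert (x (Suc i mod k)) (e i - {x i, x (Suc i mod k)}) = e i - {x i}" using e[OF i] by auto
    ultimately show ?thesis by (intro exI[of _ "b((i + 1) * s := x (Suc i mod k))"]) simp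
  qed
  then obtain b where b: "\<And>i. i < k \<Longrightarrow> bij_betw (b i) (blk i) (e i - {x i})"
      "\<And>i. i < k \<Longrightarrow> b i ((i + 1) * s) = x (Suc i mod k)" by metis
  define f where "f m = b ((m - 1) div s) m" for m
  have idx: "(m - 1) div s = i" if m: "m \<in> blk i" for m i
  proof -
    have "i * s \<le> m - 1" "m - 1 < (i + 1) * s" using m s by (auto simp: blk_def)
    then show ?thesis by (intro div_nat_eqI) (auto simp: mult.commute)
  qed
  have inblk: "\<exists>i<k. m \<in> blk i" if m: "m \<in> {1..k * s}" for m
  proof (intro exI conjI)
    have "m - 1 < k * s" using m by auto
    then show "(m - 1) div s < k" using s by (simp add: less_mult_imp_div_less)
    have 1: "(m - 1) div s * s \<le> m - 1" by simp
    have 2: "m - 1 < ((m - 1) div s + 1) * s" using s by (metis dividend_less_div_times add.commute Suc_eq_plus1 mult_Suc less_le_trans zero_less_one)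
    show "m \<in> blk ((m - 1) div s)" using m 1 2 unfolding blk_def atLeastAtMost_iff by linarith
  qed
  have fblk: "f ` blk i = e i - {x i}" if "i < k" for i
  proof -
    have "f ` blk i = b i ` blk i" by (rule image_cong[OF refl]) (simp only: f_def idx)
    then show ?thesis using b(1)[OF that] by (simp add: bij_betw_def)
  qed
  have V: "verts (linear_cycle r k) = {1..k * s}" by (simp add: linear_cycle_def verts_def s_def)
  have ends: "f ((i + 1) * s) = x (Suc i mod k)" if "i < k" for i
  proof -
    have "(i + 1) * s \<in> blk i" using s by (simp add: blk_def)
    then show ?thesis using b(2)[OF that] idx by (simp add: f_def)
  qed
  show ?thesis
    unfolding contains_copy_def V
  proof (intro exI[of _ f] conjI ballI)
    show "inj_on f {1..k * s}"
    proof (rule inj_onI)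
      fix m m' assume mm: "m \<in> {1..k * s}" "m' \<in> {1..k * s}" "f m = f m'"
      obtain i j where ij: "i < k" "m \<in> blk i" "j < k" "m' \<in> blk j" using inblk mm by metis
      have "f m \<in> e i - {x i}" "f m' \<in> e j - {x j}" using ij fblk by blast+
      then have "f m \<in> (e i - {x i}) \<inter> (e j - {x j})" using mm(3) by auto
      then have "i = j" using disj[OF ij(1,3)] by blast
      then have "b i m = b i m'" using mm(3) ij idx by (simp add: f_def)
      then show "m = m'" using b(1)[OF ij(1)] ij \<open>i = j\<close> by (auto simp: bij_betw_def inj_on_def)
    qed
    show "f ` {1..k * s} \<subseteq> verts F"
    proof
      fix y assume "y \<in> f ` {1..k * s}"
      then obtain m where m: "m \<in> {1..k * s}" "y = f m" by blast
      then obtain i where "i < k" "m \<in> blk i" using inblk by blast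
      then have "y \<in> e i" using m fblk by blast
      then show "y \<in> verts F" using F \<open>i < k\<close> by blast
    qed
    fix ed assume "ed \<in> edges (linear_cycle r k)"
    then obtain j where j: "1 \<le> j" "j \<le> k" "ed = linear_cycle_edge r k j"
      by (auto simp: linear_cycle_def edges_def)
    define i where "i = j - 1"
    have i: "i < k" "j = i + 1" using j by (auto simp: i_def)
    have "{i * s..(i + 1) * s} = insert (i * s) (blk i)" by (auto simp: blk_def)
    then have "ed = (\<lambda>j. if j = 0 then k * s else j) ` insert (i * s) (blk i)"
      using j i by (simp add: linear_cycle_edge_def s_def)
    also have "\<dots> = insert (if i * s = 0 then k * s else i * s) (blk i)"
    proof -
      have "(\<lambda>j. if j = 0 then k * s else j) ` blk i = (\<lambda>j. j) ` blk i"
        by (rule image_cong) (auto simp: blk_def)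
      then show ?thesis by (simp only: image_insert image_ident)
    qed
    finally have "f ` ed = insert (f (if i * s = 0 then k * s else i * s)) (e i - {x i})"
      using fblk[OF i(1)] by simp
    \<comment> \<open>The first label of an edge is the last label of the preceding block; for
      \<open>i = 0\<close> that block is the last one, in agreement with the identification of label
      0.\<close>
    moreover have "f (if i * s = 0 then k * s else i * s) = x i"
    proof (cases "i = 0")
      case True
      have "f ((k - 1 + 1) * s) = x (Suc (k - 1) mod k)" using k by (intro ends) auto
      then show ?thesis using True k by simp
    next
      case False
      have "f ((i - 1 + 1) * s) = x (Suc (i - 1) mod k)" using i by (intro ends) auto
      then show ?thesis using False i s by simp
    qed
    ultimately have "f ` ed = e i" using e[OF i(1)] by auto
    then show "f ` ed \<in> edges F" using F[OF i(1)] by simp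
  qed
qed

text \<open>Greedy choice, one hyperedge after the other. At most \<open>k + k * r\<close> vertices
  are forbidden, and each of them lies together with the pair \<open>J f\<close> in at most
  \<open>n ^ (r - 3)\<close> edges. So at most \<open>D / 4\<close> of the at least
  \<open>D / 2\<close> edges over \<open>f\<close> are excluded.\<close>

lemma count_expansions:
  fixes H :: "'f \<Rightarrow> 'a set set" and J :: "'f \<Rightarrow> 'a set" and X0 :: "'a set" and D :: real
  assumes V: "finite V" "card V = n" and c: "finite c" "card c \<le> k" and X0: "finite X0" "card X0 \<le> k"
    and r: "r \<ge> 3" and H: "\<And>f e. f \<in> c \<Longrightarrow> e \<in> H f \<Longrightarrow> e \<subseteq> V \<and> card e = r \<and> J f \<subseteq> e"
    and J: "\<And>f. f \<in> c \<Longrightarrow> card (J f) = 2 \<and> J f \<subseteq> X0" and HD: "\<And>f. f \<in> c \<Longrightarrow> D / 2 \<le> card (H f)"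
    and D: "(real k + real k * real r) * real n ^ (r - 3) \<le> D / 4"
  defines "good \<equiv> \<lambda>c'. {g \<in> Pi\<^sub>E c' H. (\<forall>f\<in>c'. (g f - J f) \<inter> X0 = {}) \<and>
      (\<forall>f\<in>c'. \<forall>f'\<in>c'. f \<noteq> f' \<longrightarrow> (g f - J f) \<inter> g f' = {})}"
  shows "(D / 4) ^ card c \<le> card (good c)"
proof -
  have fH: "finite (H f)" if "f \<in> c" for f
    by (rule finite_subset[of _ "Pow V"]) (use H[OF that] V in auto)
  have D0: "0 \<le> D / 4" by (rule order_trans[OF _ D]) simp
  have fgood: "finite (good c')" if "c' \<subseteq> c" for c'
  proof -
    have "finite (Pi\<^sub>E c' H)" using that c(1) fH finite_subset by (intro finite_PiE) auto
    then show ?thesis by (simp add: good_def)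
  qed
  have "(D / 4) ^ card c' \<le> card (good c')" if "c' \<subseteq> c" for c'
    using finite_subset[OF that c(1)] that
  proof (induction c' rule: finite_induct)
    case empty
    have "good {} = {\<lambda>_. undefined}" by (auto simp: good_def)
    then show ?case by simp
  next
    case (insert f c')
    then have fc: "f \<in> c" and cc: "c' \<subseteq> c" by auto
    define ok where "ok g = {e \<in> H f. (e - J f) \<inter> (X0 \<union> (\<Union>f'\<in>c'. g f')) = {}}" for g
    have okc: "D / 4 \<le> card (ok g)" if g: "g \<in> good c'" for g
    proof -
      define Y where "Y = (X0 \<union> (\<Union>f'\<in>c'. g f')) - J f"
      have gH: "g f' \<in> H f'" if "f' \<in> c'" for f' using g that by (auto simp: good_def)
      have gf: "finite (g f')" "card (g f') = r" if f': "f' \<in> c'" for f'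
      proof -
        have "g f' \<subseteq> V" "card (g f') = r" using H[OF _ gH[OF f']] cc f' by auto
        then show "finite (g f')" "card (g f') = r" using V finite_subset by auto
      qed
      have fY: "finite Y" using X0 insert.hyps(1) gf by (auto simp: Y_def)
      have "card (\<Union>f'\<in>c'. g f') \<le> k * r"
      proof -
        have "card (\<Union>f'\<in>c'. g f') \<le> (\<Sum>f'\<in>c'. card (g f'))" by (rule card_UN_le[OF insert.hyps(1)])
        also have "\<dots> = card c' * r" using gf by simp
        also have "\<dots> \<le> k * r" using card_mono[OF c(1) cc] c(2) by (intro mult_le_mono1) auto
        finally show ?thesis .
      qed
      moreover have "card Y \<le> card X0 + card (\<Union>f'\<in>c'. g f')"
      proof -
        have "card Y \<le> card (X0 \<union> (\<Union>f'\<in>c'. g f'))"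
          unfolding Y_def using X0 insert.hyps(1) gf by (intro card_mono) auto
        then show ?thesis using card_Un_le[of X0 "\<Union>f'\<in>c'. g f'"] by linarith
      qed
      ultimately have "card Y \<le> k + k * r" using X0(2) by linarith
      then have cY: "real (card Y) \<le> real k + real k * real r" by (metis of_nat_add of_nat_le_iff of_nat_mult)
      have each: "card {e \<in> H f. z \<in> e} \<le> real n ^ (r - 3)" if z: "z \<in> Y" for z
      proof -
        have fJ: "finite (J f)" "z \<notin> J f" using J[OF fc] z by (auto simp: Y_def intro: card_ge_0_finite)
        then have c3: "card (insert z (J f)) = 3" using J[OF fc] by simp
        have "card {e \<in> H f. z \<in> e} \<le> card {e. e \<subseteq> V \<and> card e = r \<and> insert z (J f) \<subseteq> e}"
        proof (rule card_mono)
          show "finite {e. e \<subseteq> V \<and> card e = r \<and> insert z (J f) \<subseteq> e}"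
            by (rule finite_subset[of _ "Pow V"]) (use V in auto)
        qed (use H[OF fc] in blast)
        also have "\<dots> \<le> card V ^ (r - card (insert z (J f)))"
          using V fJ c3 r by (intro card_supersets_le) auto
        finally have "real (card {e \<in> H f. z \<in> e}) \<le> real (n ^ (r - 3))" unfolding c3 V(2) by (rule of_nat_mono)
        then show ?thesis by simp
      qed
      have "card (H f - ok g) \<le> card Y * real n ^ (r - 3)"
      proof (rule card_cover_le[where B = "\<lambda>z. {e \<in> H f. z \<in> e}"])
        show "H f - ok g \<subseteq> (\<Union>z\<in>Y. {e \<in> H f. z \<in> e})" by (auto simp: ok_def Y_def)
      qed (use fY fH[OF fc] each in auto)
      also have "\<dots> \<le> (real k + real k * real r) * real n ^ (r - 3)" using cY by (intro mult_right_mono) auto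
      also have "\<dots> \<le> D / 4" by (rule D)
      finally have "card (H f - ok g) \<le> D / 4" .
      moreover have "card (H f - ok g) = card (H f) - card (ok g)" "card (ok g) \<le> card (H f)"
        using fH[OF fc] by (auto simp: card_Diff_subset ok_def card_mono)
      ultimately show ?thesis using HD[OF fc] by (simp add: of_nat_diff)
    qed
    have fok: "finite (ok g)" for g using fH[OF fc] by (simp add: ok_def)
    have "card (SIGMA g:good c'. ok g) \<le> card (good (insert f c'))"
    proof (rule card_inj_on_le[of "\<lambda>(g, e). g(f := e)"])
      show "inj_on (\<lambda>(g, e). g(f := e)) (SIGMA g:good c'. ok g)"
      proof (rule inj_onI, clarify)
        fix g e g' e' assume *: "g \<in> good c'" "g' \<in> good c'" "g(f := e) = g'(f := e')"
        have "e = e'" using fun_cong[OF *(3), of f] by simp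
        moreover have "g = g'"
        proof (rule PiE_ext)
          show "g \<in> Pi\<^sub>E c' H" "g' \<in> Pi\<^sub>E c' H" using * by (auto simp: good_def)
          fix x assume "x \<in> c'"
          then show "g x = g' x" using fun_cong[OF *(3), of x] insert.hyps(2) by (auto split: if_splits)
        qed
        ultimately show "g = g' \<and> e = e'" by simp
      qed
      show "(\<lambda>(g, e). g(f := e)) ` (SIGMA g:good c'. ok g) \<subseteq> good (insert f c')"
      proof clarify
        fix g e assume g: "g \<in> good c'" and e: "e \<in> ok g"
        have gP: "g \<in> Pi\<^sub>E c' H" and g1: "\<And>f'. f' \<in> c' \<Longrightarrow> (g f' - J f') \<inter> X0 = {}"
          and g2: "\<And>f1 f2. f1 \<in> c' \<Longrightarrow> f2 \<in> c' \<Longrightarrow> f1 \<noteq> f2 \<Longrightarrow> (g f1 - J f1) \<inter> g f2 = {}"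
          using g by (auto simp: good_def)
        have eH: "e \<in> H f" and eX: "(e - J f) \<inter> X0 = {}" and eg: "\<And>f'. f' \<in> c' \<Longrightarrow> (e - J f) \<inter> g f' = {}"
          using e by (auto simp: ok_def)
        have "g(f := e) \<in> Pi\<^sub>E (insert f c') H" by (rule PiE_fun_upd[OF eH gP])
        moreover have "\<forall>f'\<in>insert f c'. ((g(f := e)) f' - J f') \<inter> X0 = {}" using g1 eX by auto
        moreover have "\<forall>f1\<in>insert f c'. \<forall>f2\<in>insert f c'. f1 \<noteq> f2 \<longrightarrow> ((g(f := e)) f1 - J f1) \<inter> (g(f := e)) f2 = {}"
        proof (intro ballI impI)
          fix f1 f2 assume f12: "f1 \<in> insert f c'" "f2 \<in> insert f c'" "f1 \<noteq> f2"
          then consider "f1 = f" "f2 \<in> c'" "f2 \<noteq> f" | "f2 = f" "f1 \<in> c'" "f1 \<noteq> f" | "f1 \<in> c'" "f2 \<in> c'" "f1 \<noteq> f" "f2 \<noteq> f"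
            by blast
          then show "((g(f := e)) f1 - J f1) \<inter> (g(f := e)) f2 = {}"
          proof cases
            case 1
            then show ?thesis using eg[of f2] by simp
          next
            case 2
            \<comment> \<open>Disjointness is needed in both directions. The new edge consists of
              its core pair, avoided by earlier edges as part of \<open>X0\<close>, and of vertices
              that avoid all earlier edges.\<close>
            have "J f \<subseteq> X0" using J[OF fc] by blast
            then have "(g f1 - J f1) \<inter> e = {}" using eg[OF 2(2)] g1[OF 2(2)] by blast
            then show ?thesis using 2 by simp
          next
            case 3
            then show ?thesis using g2 f12(3) by simp
          qed
        qed
        ultimately show "g(f := e) \<in> good (insert f c')" by (simp add: good_def)
      qed
      show "finite (good (insert f c'))" using insert.prems by (rule fgood)
    qed
    moreover have "card (SIGMA g:good c'. ok g) = (\<Sum>g\<in>good c'. card (ok g))"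
      using fgood[OF cc] fok by (intro card_SigmaI) auto
    ultimately have "real (\<Sum>g\<in>good c'. card (ok g)) \<le> real (card (good (insert f c')))" by (intro of_nat_mono) simp
    moreover have "(\<Sum>g\<in>good c'. D / 4) \<le> (\<Sum>g\<in>good c'. real (card (ok g)))" using okc by (rule sum_mono)
    ultimately have "card (good c') * (D / 4) \<le> card (good (insert f c'))" by simp
    moreover have "(D / 4) ^ card c' * (D / 4) \<le> card (good c') * (D / 4)"
      using insert.IH[OF cc] D0 by (rule mult_right_mono)
    ultimately show ?case using insert.hyps by (simp add: mult.commute)
  qed
  from this[OF subset_refl] show ?thesis .
qed

lemma expand_cycles:
  fixes \<psi> :: "'a set \<Rightarrow> ('a \<times> nat) set" and D :: real and b :: "nat \<Rightarrow> real"
  assumes V: "finite V" "card V = n" and r: "r \<ge> 3" and l: "l \<ge> 2"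
    and E4: "\<And>e. e \<in> E4 \<Longrightarrow> e \<subseteq> V \<and> card e = r" and \<psi>: "\<And>e. e \<in> E4 \<Longrightarrow> fst ` \<psi> e \<subseteq> e"
    and HD: "\<And>f. f \<in> \<psi> ` E4 \<Longrightarrow> D / 2 \<le> real (card {e \<in> E4. \<psi> e = f}) \<and> real (card {e \<in> E4. \<psi> e = f}) \<le> D"
    and D: "(real (2 * l) + real (2 * l) * real r) * real n ^ (r - 3) \<le> D / 4"
    and \<C>: "\<C> \<subseteq> {c. is_cycle fst (2 * l) (\<psi> ` E4) c}"
    and deg: "\<And>\<sigma>. \<sigma> \<subseteq> \<psi> ` E4 \<Longrightarrow> \<sigma> \<noteq> {} \<Longrightarrow> card \<sigma> < 2 * l \<Longrightarrow> card {c \<in> \<C>. \<sigma> \<subseteq> c} \<le> b (card \<sigma>)"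
    and b: "\<And>j. 0 \<le> b j"
  obtains S where "\<And>Z. Z \<in> S \<Longrightarrow> Z \<subseteq> E4 \<and> card Z = 2 * l"
    "\<And>Z F. Z \<in> S \<Longrightarrow> Z \<subseteq> edges F \<Longrightarrow> (\<And>e. e \<in> Z \<Longrightarrow> e \<subseteq> verts F) \<Longrightarrow> contains_copy F (linear_cycle r (2 * l))"
    "card \<C> * (D / 4) ^ (2 * l) \<le> card S"
    "\<And>\<sigma>. \<sigma> \<subseteq> E4 \<Longrightarrow> \<sigma> \<noteq> {} \<Longrightarrow> card \<sigma> < 2 * l \<Longrightarrow> card {Z \<in> S. \<sigma> \<subseteq> Z} \<le> b (card \<sigma>) * D ^ (2 * l - card \<sigma>)"
proof -
  define k where "k = 2 * l"
  have k3: "k \<ge> 3" using l by (simp add: k_def)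
  define H where "H f = {e \<in> E4. \<psi> e = f}" for f
  define J :: "('a \<times> nat) set \<Rightarrow> 'a set" where "J f = fst ` f" for f
  have fE4: "finite E4" by (rule finite_subset[of _ "Pow V"]) (use E4 V in auto)
  have f\<C>: "finite \<C>"
    by (rule finite_subset[of _ "Pow (\<psi> ` E4)"]) (use \<C> fE4 in \<open>auto simp: is_cycle_def\<close>)
  have fH: "finite (H f)" for f using fE4 by (simp add: H_def)
  have D0: "0 \<le> D"
  proof -
    have "0 \<le> D / 4" by (rule order_trans[OF _ D]) simp
    then show ?thesis by simp
  qed
  define \<Gamma> where "\<Gamma> c = {g \<in> Pi\<^sub>E c H. (\<forall>f\<in>c. (g f - J f) \<inter> fst ` \<Union> c = {}) \<and>
      (\<forall>f\<in>c. \<forall>f'\<in>c. f \<noteq> f' \<longrightarrow> (g f - J f) \<inter> g f' = {})}" for c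
  have cyc: "\<exists>xs. length xs = k \<and> distinct (map fst xs) \<and> c = cycle_edges xs \<and> c \<subseteq> \<psi> ` E4" if "c \<in> \<C>" for c
    using \<C> that by (auto simp: is_cycle_def k_def)
  have edge_inj: "inj_on (\<lambda>i. {xs ! i, xs ! (Suc i mod k)}) {..<k}" and ccard: "card (cycle_edges xs) = k"
    if xs: "length xs = k" "distinct (map fst xs)" for xs :: "('a \<times> nat) list"
  proof -
    have "distinct xs" using xs by (simp add: distinct_map)
    then show cc: "card (cycle_edges xs) = k" using cycle_edges_card[of xs] xs k3 by simp
    then show "inj_on (\<lambda>i. {xs ! i, xs ! (Suc i mod k)}) {..<k}"
      using xs by (intro eq_card_imp_inj_on) (auto simp: cycle_edges_def)
  qed
  have ck: "card c = k" "finite c" if c: "c \<in> \<C>" for c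
  proof -
    obtain xs where "length xs = k" "distinct (map fst xs)" "c = cycle_edges xs" using cyc[OF c] by blast
    then show "card c = k" using ccard by blast
    then show "finite c" using k3 by (intro card_ge_0_finite) auto
  qed
  have \<Gamma>prop: "\<And>f. f \<in> c \<Longrightarrow> g f \<in> E4 \<and> \<psi> (g f) = f" "inj_on g c" "\<psi> ` g ` c = c" "g ` c \<subseteq> E4"
    "card (g ` c) = k" if cg: "c \<in> \<C>" "g \<in> \<Gamma> c" for c g
  proof -
    show a: "g f \<in> E4 \<and> \<psi> (g f) = f" if "f \<in> c" for f
      using cg(2) that by (auto simp: \<Gamma>_def H_def PiE_iff)
    show inj: "inj_on g c" by (rule inj_on_inverseI[of _ \<psi>]) (use a in blast)
    show "\<psi> ` g ` c = c" using a by force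
    show "g ` c \<subseteq> E4" using a by blast
    show "card (g ` c) = k" using inj ck[OF cg(1)] by (simp add: card_image)
  qed
  define S where "S = (\<lambda>(c, g). g ` c) ` (SIGMA c:\<C>. \<Gamma> c)"
  have f\<Gamma>: "finite (\<Gamma> c)" if "c \<in> \<C>" for c
  proof -
    have "finite (Pi\<^sub>E c H)" using ck[OF that] fH by (intro finite_PiE) auto
    then show ?thesis by (simp add: \<Gamma>_def)
  qed
  have SE: "\<exists>c g. c \<in> \<C> \<and> g \<in> \<Gamma> c \<and> Z = g ` c" if "Z \<in> S" for Z using that by (auto simp: S_def)
  show ?thesis
  proof (rule that[of S])
    fix Z assume Z: "Z \<in> S"
    from SE[OF Z] obtain c g where cg: "c \<in> \<C>" "g \<in> \<Gamma> c" "Z = g ` c" by blast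
    show "Z \<subseteq> E4 \<and> card Z = 2 * l" using \<Gamma>prop(4,5)[OF cg(1,2)] cg(3) by (simp add: k_def)
    fix F assume F: "Z \<subseteq> edges F" "\<And>e. e \<in> Z \<Longrightarrow> e \<subseteq> verts F"
    obtain xs where xs: "length xs = k" "distinct (map fst xs)" "c = cycle_edges xs" using cyc[OF cg(1)] by blast
    define x where "x i = fst (xs ! i)" for i
    define fe where "fe i = {xs ! i, xs ! (Suc i mod k)}" for i
    define e where "e i = g (fe i)" for i
    have fec: "fe i \<in> c" if "i < k" for i using that xs by (auto simp: fe_def cycle_edges_def)
    have Jfe: "J (fe i) = {x i, x (Suc i mod k)}" for i by (auto simp: J_def fe_def x_def)
    have xinj: "i = j" if "x i = x j" "i < k" "j < k" for i j
      using that xs(1,2) nth_eq_iff_index_eq[OF xs(2), of i j] by (simp add: x_def)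
    have eZ: "e i \<in> Z" "e i \<in> E4" "J (fe i) \<subseteq> e i" if i: "i < k" for i
    proof -
      show "e i \<in> Z" using fec[OF i] cg(3) by (simp add: e_def)
      have a: "g (fe i) \<in> E4 \<and> \<psi> (g (fe i)) = fe i" using \<Gamma>prop(1)[OF cg(1,2) fec[OF i]] .
      then show "e i \<in> E4" by (simp add: e_def)
      have "fst ` \<psi> (g (fe i)) \<subseteq> g (fe i)" using \<psi> a by blast
      then show "J (fe i) \<subseteq> e i" using a by (simp add: J_def e_def)
    qed
    show "contains_copy F (linear_cycle r (2 * l))"
      unfolding k_def[symmetric]
    proof (rule linear_cycle_copy[where e = e and x = x])
      show "1 \<le> k" "2 \<le> r" using k3 r by auto
    next
      fix i assume i: "i < k"
      have "Suc i mod k \<noteq> i" using i k3 by (auto simp: mod_Suc)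
      then have "x (Suc i mod k) \<noteq> x i" using xinj[of "Suc i mod k" i] i k3 by auto
      then show "card (e i) = r \<and> x i \<in> e i \<and> x (Suc i mod k) \<in> e i \<and> x (Suc i mod k) \<noteq> x i"
        using eZ[OF i] E4 Jfe[of i] by auto
      show "e i \<in> edges F \<and> e i \<subseteq> verts F" using F eZ[OF i] by blast
    next
      fix i j assume ij: "i < k" "j < k" "i \<noteq> j"
      have "fe i \<noteq> fe j" using edge_inj[OF xs(1,2)] ij by (auto simp: fe_def inj_on_def)
      then have d: "(e i - J (fe i)) \<inter> e j = {}" "(e j - J (fe j)) \<inter> e i = {}"
        using cg(2) fec[OF ij(1)] fec[OF ij(2)] by (auto simp: \<Gamma>_def e_def)
      show "(e i - {x i}) \<inter> (e j - {x j}) = {}"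
      proof (rule ccontr)
        assume "(e i - {x i}) \<inter> (e j - {x j}) \<noteq> {}"
        then obtain y where y: "y \<in> e i" "y \<noteq> x i" "y \<in> e j" "y \<noteq> x j" by blast
        then have "y \<in> J (fe i)" "y \<in> J (fe j)" using d by blast+
        \<comment> \<open>A common vertex must be a core vertex of both edges other than their first
          ones, hence the second core vertex of each, and these differ.\<close>
        then have "x (Suc i mod k) = x (Suc j mod k)" using y by (simp add: Jfe)
        then have "Suc i mod k = Suc j mod k" using xinj[of "Suc i mod k" "Suc j mod k"] k3 by simp
        then show False using ij by (auto simp: mod_Suc split: if_splits)
      qed
    qed
  next
    have inj: "inj_on (\<lambda>(c, g). g ` c) (SIGMA c:\<C>. \<Gamma> c)"
    proof (rule inj_onI, clarify)
      fix c g c' g' assume *: "c \<in> \<C>" "g \<in> \<Gamma> c" "c' \<in> \<C>" "g' \<in> \<Gamma> c'" "g ` c = g' ` c'"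
      have "\<psi> ` g ` c = c" "\<psi> ` g' ` c' = c'" by (rule \<Gamma>prop(3)[OF *(1,2)], rule \<Gamma>prop(3)[OF *(3,4)])
      then have cc: "c = c'" using *(5) by simp
      moreover have "g = g'"
      proof (rule PiE_ext)
        show "g \<in> Pi\<^sub>E c H" "g' \<in> Pi\<^sub>E c H" using * cc by (auto simp: \<Gamma>_def)
        fix f assume f: "f \<in> c"
        then obtain f' where f': "f' \<in> c" "g f = g' f'" using *(5) cc by (metis image_iff)
        have "f = f'" using \<Gamma>prop(1)[OF *(1,2) f] \<Gamma>prop(1)[OF *(3,4)] f' cc by metis
        then show "g f = g' f" using f' by simp
      qed
      ultimately show "c = c' \<and> g = g'" by simp
    qed
    have "(D / 4) ^ k \<le> card (\<Gamma> c)" if c: "c \<in> \<C>" for c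
    proof -
      obtain xs where xs: "length xs = k" "distinct (map fst xs)" "c = cycle_edges xs" "c \<subseteq> \<psi> ` E4"
        using cyc[OF c] by blast
      have "(D / 4) ^ card c \<le> card (\<Gamma> c)"
        unfolding \<Gamma>_def
      proof (rule count_expansions[OF V ck(2)[OF c]])
        show "card c \<le> k" using ck[OF c] by simp
        have Uc: "fst ` \<Union> c = set (map fst xs)" using Union_cycle_edges[of xs] xs(3) by simp
        then show "finite (fst ` \<Union> c)" by simp
        show "card (fst ` \<Union> c) \<le> k" unfolding Uc using card_length[of "map fst xs"] xs(1) by simp
        show "3 \<le> r" by (rule r)
        show "(real k + real k * real r) * real n ^ (r - 3) \<le> D / 4" using D by (simp add: k_def)
      next
        fix f assume f: "f \<in> c"
        show "D / 2 \<le> card (H f)" using HD[of f] f xs(4) by (auto simp: H_def)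
        obtain i where i: "i < k" "f = {xs ! i, xs ! (Suc i mod k)}" using f xs by (auto simp: cycle_edges_def)
        have "Suc i mod k \<noteq> i" "Suc i mod k < k" using i k3 by (auto simp: mod_Suc)
        then have "fst (xs ! i) \<noteq> fst (xs ! (Suc i mod k))"
          using nth_eq_iff_index_eq[OF xs(2), of i "Suc i mod k"] i xs(1) by simp
        then have "card (J f) = 2" using i by (simp add: J_def)
        moreover have "J f \<subseteq> fst ` \<Union> c" using f by (auto simp: J_def)
        ultimately show "card (J f) = 2 \<and> J f \<subseteq> fst ` \<Union> c" by simp
        fix e assume e: "e \<in> H f"
        then have "e \<in> E4" "\<psi> e = f" by (auto simp: H_def)
        then show "e \<subseteq> V \<and> card e = r \<and> J f \<subseteq> e" using E4[of e] \<psi>[of e] by (simp add: J_def)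
      qed
      then show ?thesis using ck[OF c] by simp
    qed
    then have "(\<Sum>c\<in>\<C>. (D / 4) ^ k) \<le> (\<Sum>c\<in>\<C>. real (card (\<Gamma> c)))" by (rule sum_mono)
    also have "\<dots> = card (SIGMA c:\<C>. \<Gamma> c)" using f\<C> f\<Gamma> by (simp add: card_SigmaI)
    also have "\<dots> = card S" unfolding S_def by (simp only: card_image[OF inj])
    finally show "card \<C> * (D / 4) ^ (2 * l) \<le> card S" by (simp add: k_def)
  next
    fix \<sigma> assume \<sigma>: "\<sigma> \<subseteq> E4" "\<sigma> \<noteq> {}" "card \<sigma> < 2 * l"
    show "card {Z \<in> S. \<sigma> \<subseteq> Z} \<le> b (card \<sigma>) * D ^ (2 * l - card \<sigma>)"
    proof (cases "{Z \<in> S. \<sigma> \<subseteq> Z} = {}")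
      case True
      show ?thesis unfolding True using b D0 by simp
    next
      case False
      define T where "T = \<psi> ` \<sigma>"
      obtain Z0 where Z0: "Z0 \<in> S" "\<sigma> \<subseteq> Z0" using False by blast
      obtain c0 g0 where cg0: "c0 \<in> \<C>" "g0 \<in> \<Gamma> c0" "Z0 = g0 ` c0" using SE[OF Z0(1)] by blast
      have "inj_on \<psi> Z0"
        unfolding cg0(3) by (rule inj_on_inverseI[of _ g0]) (use \<Gamma>prop(1)[OF cg0(1,2)] in auto)
      then have T: "card T = card \<sigma>" unfolding T_def using Z0(2) by (metis card_image inj_on_subset)
      have TE: "T \<subseteq> \<psi> ` E4" "T \<noteq> {}" using \<sigma> by (auto simp: T_def)
      \<comment> \<open>A cycle through the shadow of \<sigma> together with hyperedges for its
        other edges; on the shadow the expansion is prescribed by \<sigma>.\<close>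
      define Q where "Q = (SIGMA c:{c \<in> \<C>. T \<subseteq> c}. Pi\<^sub>E (c - T) H)"
      have fQ: "finite Q"
        unfolding Q_def using f\<C> ck fH by (intro finite_SigmaI finite_PiE) auto
      have "{Z \<in> S. \<sigma> \<subseteq> Z} \<subseteq> (\<lambda>(c, g). \<sigma> \<union> g ` (c - T)) ` Q"
      proof
        fix Z assume "Z \<in> {Z \<in> S. \<sigma> \<subseteq> Z}"
        then have Z: "Z \<in> S" "\<sigma> \<subseteq> Z" by auto
        obtain c g where cg: "c \<in> \<C>" "g \<in> \<Gamma> c" "Z = g ` c" using SE[OF Z(1)] by blast
        note P = \<Gamma>prop(1)[OF cg(1,2)]
        have Tc: "T \<subseteq> c" using Z(2) P unfolding T_def cg(3) by fastforce
        have \<sigma>g: "\<sigma> = g ` T"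
        proof
          show "\<sigma> \<subseteq> g ` T"
          proof
            fix y assume y: "y \<in> \<sigma>"
            then obtain f where "f \<in> c" "y = g f" using Z(2) cg(3) by blast
            then have "\<psi> y = f" using P by simp
            then show "y \<in> g ` T" using y \<open>y = g f\<close> unfolding T_def by blast
          qed
          show "g ` T \<subseteq> \<sigma>"
          proof
            fix z assume "z \<in> g ` T"
            then obtain y where y: "y \<in> \<sigma>" "z = g (\<psi> y)" by (auto simp: T_def)
            then obtain f where "f \<in> c" "y = g f" using Z(2) cg(3) by blast
            then show "z \<in> \<sigma>" using y P by simp
          qed
        qed
        have "Z = \<sigma> \<union> restrict g (c - T) ` (c - T)"
          unfolding cg(3) \<sigma>g using Tc by (auto simp: image_iff)
        moreover have "restrict g (c - T) \<in> Pi\<^sub>E (c - T) H" using cg(2) by (auto simp: \<Gamma>_def)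
        ultimately show "Z \<in> (\<lambda>(c, g). \<sigma> \<union> g ` (c - T)) ` Q"
          using cg(1) Tc by (intro image_eqI[of _ _ "(c, restrict g (c - T))"]) (auto simp: Q_def)
      qed
      then have "card {Z \<in> S. \<sigma> \<subseteq> Z} \<le> card Q"
        using card_mono[OF finite_imageI[OF fQ]] card_image_le[OF fQ] by (meson order_trans)
      also have "card Q = (\<Sum>c\<in>{c \<in> \<C>. T \<subseteq> c}. card (Pi\<^sub>E (c - T) H))"
        unfolding Q_def using f\<C> ck fH by (intro card_SigmaI) (auto intro!: finite_PiE)
      finally have "real (card {Z \<in> S. \<sigma> \<subseteq> Z}) \<le> real (\<Sum>c\<in>{c \<in> \<C>. T \<subseteq> c}. card (Pi\<^sub>E (c - T) H))"
        by (rule of_nat_mono)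
      also have "\<dots> = (\<Sum>c\<in>{c \<in> \<C>. T \<subseteq> c}. real (card (Pi\<^sub>E (c - T) H)))" by (rule of_nat_sum)
      also have "\<dots> \<le> (\<Sum>c\<in>{c \<in> \<C>. T \<subseteq> c}. D ^ (k - card \<sigma>))"
      proof (rule sum_mono)
        fix c assume "c \<in> {c \<in> \<C>. T \<subseteq> c}"
        then have c: "c \<in> \<C>" "T \<subseteq> c" by auto
        have fT: "finite T" using finite_subset[OF c(2) ck(2)[OF c(1)]] .
        have "real (card (Pi\<^sub>E (c - T) H)) = (\<Prod>f\<in>c - T. real (card (H f)))"
          using ck[OF c(1)] by (simp add: card_PiE)
        also have "\<dots> \<le> (\<Prod>f\<in>c - T. D)"
        proof (rule prod_mono)
          fix f assume "f \<in> c - T"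
          moreover have "c \<subseteq> \<psi> ` E4" using cyc[OF c(1)] by blast
          ultimately have "f \<in> \<psi> ` E4" by blast
          then show "0 \<le> real (card (H f)) \<and> real (card (H f)) \<le> D" using HD by (simp add: H_def)
        qed
        also have "\<dots> = D ^ (k - card \<sigma>)" using ck[OF c(1)] c(2) fT T by (simp add: card_Diff_subset)
        finally show "real (card (Pi\<^sub>E (c - T) H)) \<le> D ^ (k - card \<sigma>)" .
      qed
      also have "\<dots> = card {c \<in> \<C>. T \<subseteq> c} * D ^ (k - card \<sigma>)" by simp
      also have "\<dots> \<le> b (card \<sigma>) * D ^ (k - card \<sigma>)"
        using deg[OF TE] T \<sigma>(3) D0 by (intro mult_right_mono) auto
      finally show ?thesis by (simp add: k_def)
    qed
  qed
qed

section \<open>Balanced families of linear cycles\<close>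

text \<open>This guarantees a sampling rate of at most 1. For \<open>y = s / n \<le> 1\<close> and
  \<open>r - 1 \<ge> 3\<close>, one has \<open>y ^ 3 \<ge> 1 / 2 ^ i\<close>, whereas
  \<open>a ^ 3 \<ge> (\<kappa> * t) ^ 3 * 4 ^ i\<close>. In the cube of
  \<open>a ^ (l - 1) * y ^ l\<close> the gain \<open>4 ^ (i * (l - 1))\<close> outweighs the loss
  \<open>2 ^ (i * l)\<close>.\<close>

lemma density_estimate:
  fixes a s n \<kappa> t C0 N :: real and r l i :: nat
  assumes r: "r \<ge> 4" and l: "l \<ge> 2" and \<kappa>: "\<kappa> > 0" and n: "n > 0" and s: "0 < s" "s ^ (r - 1) = n ^ (r - 1) / 2 ^ i"
    and a: "\<kappa> * t * (8/5) ^ i \<le> a" and N: "\<kappa> * a * s \<le> N" and t: "1 \<le> \<kappa> * t" "C0 \<le> \<kappa> ^ l * (\<kappa> * t)"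
  shows "C0 * a * n ^ l \<le> N ^ l"
proof -
  define y where "y = s / n"
  have y: "0 < y" using s n by (simp add: y_def)
  have yr: "y ^ (r - 1) = 1 / 2 ^ i" using s n by (simp add: y_def power_divide)
  have y1: "y \<le> 1"
  proof (rule ccontr)
    assume "\<not> y \<le> 1"
    then have "1 < y ^ (r - 1)" using r by (intro one_less_power) auto
    moreover have "1 / 2 ^ i \<le> (1::real)" by simp
    ultimately show False unfolding yr by linarith
  qed
  have apos: "0 < a"
  proof -
    have "0 < \<kappa> * t * (8/5) ^ i" using t by simp
    then show ?thesis using a by linarith
  qed
  have y3: "1 / 2 ^ i \<le> y ^ 3" unfolding yr[symmetric] using y y1 r by (intro power_decreasing) auto
  have "(\<kappa> * t) ^ (l - 1) \<le> a ^ (l - 1) * y ^ l"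
  proof -
    obtain m where m: "l = Suc (Suc m)" using l by (metis add_2_eq_Suc le_Suc_ex)
    have "((\<kappa> * t) ^ (l - 1)) ^ 3 = ((\<kappa> * t) ^ 3) ^ (l - 1)" by (simp flip: power_mult add: mult.commute)
    also have "\<dots> \<le> ((\<kappa> * t) ^ 3) ^ (l - 1) * 2 ^ (i * m)" using t by (simp add: mult_ge1_I)
    also have "\<dots> = ((\<kappa> * t) ^ 3) ^ (l - 1) * (4 ^ i) ^ (l - 1) * (1 / 2 ^ i) ^ l"
    proof -
      have "(4::real) ^ i = 2 ^ i * 2 ^ i" by (simp flip: power_mult_distrib)
      then have "((4::real) ^ i) ^ (l - 1) * (1 / 2 ^ i) ^ l = 2 ^ (i * m)"
        by (simp add: m power_divide power_mult field_simps)
      then show ?thesis by (simp add: mult.assoc)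
    qed
    also have "\<dots> = ((\<kappa> * t) ^ 3 * 4 ^ i) ^ (l - 1) * (1 / 2 ^ i) ^ l" by (simp add: power_mult_distrib)
    also have "\<dots> \<le> (a ^ 3) ^ (l - 1) * (y ^ 3) ^ l"
    proof (intro mult_mono power_mono)
      have "(\<kappa> * t) ^ 3 * 4 ^ i \<le> (\<kappa> * t) ^ 3 * ((8/5) ^ 3) ^ i"
        using t by (intro mult_left_mono power_mono) (auto simp: power3_eq_cube)
      also have "\<dots> = (\<kappa> * t * (8/5) ^ i) ^ 3" by (simp add: power_mult_distrib flip: power_mult add: mult.commute)
      also have "\<dots> \<le> a ^ 3" using a t by (intro power_mono) auto
      finally show "(\<kappa> * t) ^ 3 * 4 ^ i \<le> a ^ 3" .
    qed (use y3 t apos in auto)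
    also have "\<dots> = (a ^ (l - 1) * y ^ l) ^ 3" by (simp add: power_mult_distrib flip: power_mult add: mult.commute)
    finally show ?thesis by (subst (asm) power_mono_iff) (use apos y t in auto)
  qed
  moreover have "\<kappa> * t \<le> (\<kappa> * t) ^ (l - 1)" using t l by (intro self_le_power) auto
  ultimately have ayl: "\<kappa> * t \<le> a ^ (l - 1) * y ^ l" by linarith
  have "C0 \<le> \<kappa> ^ l * (a ^ (l - 1) * y ^ l)" 
    by (rule order_trans[OF t(2) mult_left_mono[OF ayl]]) (use \<kappa> in simp)
  then have "C0 * (a * n ^ l) \<le> \<kappa> ^ l * (a ^ (l - 1) * y ^ l) * (a * n ^ l)" using apos n by (intro mult_right_mono) auto
  also have "\<dots> = (\<kappa> * a * s) ^ l"
  proof -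
    have "a ^ (l - 1) * a = a ^ l" using l by (metis Suc_1 Suc_le_D diff_Suc_1 power_Suc2)
    moreover have "y ^ l * n ^ l = s ^ l" using n by (simp add: y_def flip: power_mult_distrib)
    ultimately show ?thesis by (simp add: power_mult_distrib mult_ac) (metis mult.assoc mult.commute)
  qed
  also have "\<dots> \<le> N ^ l" using N \<kappa> apos s by (intro power_mono) auto
  finally show ?thesis by (simp add: mult.assoc)
qed

text \<open>By the choice of \<open>p\<close>, the power \<open>(p * N) ^ (l - 1)\<close> is
  \<open>C0 * a * n ^ l / N\<close>. Since \<open>N\<close> is at least
  \<open>\<kappa> * a * s\<close>, the size \<open>a\<close> cancels and
  \<open>s \<ge> n powr (2/3)\<close> leaves the exponent \<open>l - 2/3\<close>.\<close>

lemma sampling_rate_estimate: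
  fixes a s n \<kappa> t C0 N p :: real and r l i :: nat
  assumes r: "r \<ge> 4" and l: "l \<ge> 2" and \<kappa>: "\<kappa> > 0" and n: "n \<ge> 1" and s: "0 < s" "s ^ (r - 1) = n ^ (r - 1) / 2 ^ i"
    and a: "a > 0" and N: "\<kappa> * a * s \<le> N" and t: "1 \<le> \<kappa> * t" and C0: "C0 \<ge> 1"
    and sl: "\<kappa> * t * n ^ (r - 2) \<le> s ^ (r - 1)" and p: "0 < p" "p ^ (l - 1) = C0 * a * n ^ l / N ^ l"
  shows "p * N \<le> max 1 (C0 / \<kappa>) * n powr (2 * real l / (2 * real l - 1))"
proof -
  define y where "y = s / n"
  have y: "0 < y" using s n by (simp add: y_def)
  have yr: "y ^ (r - 1) = 1 / 2 ^ i" using s n by (simp add: y_def power_divide)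
  have y1: "y \<le> 1"
  proof (rule ccontr)
    assume "\<not> y \<le> 1"
    then have "1 < y ^ (r - 1)" using r by (intro one_less_power) auto
    moreover have "1 / 2 ^ i \<le> (1::real)" by simp
    ultimately show False unfolding yr by linarith
  qed
  have "1 / n \<le> y ^ (r - 1)"
  proof -
    have "1 * n ^ (r - 2) \<le> \<kappa> * t * n ^ (r - 2)" using t n by (intro mult_right_mono) auto
    then have "n ^ (r - 2) \<le> s ^ (r - 1)" using sl by linarith
    then have "n ^ (r - 2) / n ^ (r - 1) \<le> y ^ (r - 1)" using n by (simp add: y_def power_divide divide_right_mono)
    moreover have "r - 1 = Suc (r - 2)" using r by simp
    then have "n ^ (r - 2) / n ^ (r - 1) = 1 / n" using n by simp
    ultimately show ?thesis by simp
  qed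
  also have "\<dots> \<le> y ^ 3" using y y1 r by (intro power_decreasing) auto
  finally have "1 / n * n ^ 3 \<le> y ^ 3 * n ^ 3" using n by (intro mult_right_mono) auto
  then have "n ^ 2 \<le> s ^ 3" using n by (simp add: y_def power_divide power2_eq_square power3_eq_cube)
  moreover have "(n powr (2/3)) ^ 3 = n ^ 2"
  proof -
    have "(n powr (2/3)) ^ 3 = (n powr (2/3)) powr (real 3)" by (rule powr_realpow[symmetric]) (use n in simp)
    also have "\<dots> = n ^ 2" using n by (simp add: powr_powr)
    finally show ?thesis .
  qed
  ultimately have "(n powr (2/3)) ^ 3 \<le> s ^ 3" by simp
  then have sn: "n powr (2/3) \<le> s" by (subst (asm) power_mono_iff) (use s in auto)
  have N0: "N > 0"
  proof -
    have "0 < \<kappa> * a * s" using \<kappa> a s by simp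
    then show ?thesis using N by linarith
  qed
  define C1 where "C1 = max 1 (C0 / \<kappa>)"
  define b0 where "b0 = n powr (2 * real l / (2 * real l - 1))"
  have C1: "1 \<le> C1" "C0 / \<kappa> \<le> C1" by (auto simp: C1_def)
  have l': "l = Suc (l - 1)" "0 < l - 1" using l by auto
  have "(p * N) ^ (l - 1) = C0 * a * n ^ l / N"
  proof -
    have "N ^ l = N ^ (l - 1) * N" by (metis l'(1) power_Suc2)
    then have "(p * N) ^ (l - 1) = C0 * a * n ^ l / (N ^ (l - 1) * N) * N ^ (l - 1)"
      by (simp only: power_mult_distrib p(2))
    then show ?thesis using N0 by simp
  qed
  also have "\<dots> \<le> C0 * a * n ^ l / (\<kappa> * a * s)"
    using N N0 C0 a n \<kappa> s by (intro divide_left_mono) auto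
  also have "\<dots> = C0 / \<kappa> * (n ^ l / s)" using a by simp
  also have "\<dots> \<le> C1 * (n ^ l / n powr (2/3))"
    using C1 C0 \<kappa> sn s n by (intro mult_mono divide_left_mono) auto
  also have "n ^ l / n powr (2/3) = n powr (real l - 2/3)" using n by (simp add: powr_diff powr_realpow)
  also have "C1 * n powr (real l - 2/3) \<le> C1 ^ (l - 1) * b0 ^ (l - 1)"
  proof (rule mult_mono)
    show "C1 \<le> C1 ^ (l - 1)" using C1 l' by (intro self_le_power) auto
    have "b0 ^ (l - 1) = n powr (2 * real l / (2 * real l - 1) * real (l - 1))"
    proof -
      have "b0 ^ (l - 1) = b0 powr (real (l - 1))" by (rule powr_realpow[symmetric]) (use n in \<open>simp add: b0_def\<close>)
      then show ?thesis by (simp add: b0_def powr_powr)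
    qed
    \<comment> \<open>The right side is \<open>l - l / (2 * l - 1)\<close>, so this amounts to
      \<open>l \<ge> 2\<close>, with equality at 2.\<close>
    moreover have "real l - 2/3 \<le> 2 * real l / (2 * real l - 1) * real (l - 1)"
    proof -
      have "(real l - 2/3) * (2 * real l - 1) \<le> 2 * real l * real (l - 1)"
        using l by (simp add: of_nat_diff algebra_simps)
      moreover have "0 < 2 * real l - 1" using l by simp
      ultimately show ?thesis by (simp add: pos_le_divide_eq)
    qed
    ultimately show "n powr (real l - 2/3) \<le> b0 ^ (l - 1)" using n by (simp add: powr_mono)
  qed (use C1 in auto)
  also have "\<dots> = (C1 * b0) ^ (l - 1)" by (simp add: power_mult_distrib)
  finally have le: "(p * N) ^ (l - 1) \<le> (C1 * b0) ^ (l - 1)" .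
  have "p * N \<le> C1 * b0"
  proof (rule power_le_imp_le_base[of _ "l - 2"])
    have "Suc (l - 2) = l - 1" using l by simp
    then show "(p * N) ^ Suc (l - 2) \<le> (C1 * b0) ^ Suc (l - 2)" using le by simp
    show "0 \<le> C1 * b0" using C1 by (simp add: b0_def)
  qed
  then show ?thesis by (simp add: C1_def b0_def)
qed

text \<open>The weight is the indicator of a family of expanded cycles. Graph codegrees governed by
  \<open>p\<close> become hypergraph codegrees governed by \<open>p / D\<close>, and
  \<open>p * N / (N * D)\<close> is compared with \<open>\<tau> = C1 * b0 / v\<close> through
  \<open>v \<le> N * D\<close>.\<close>

lemma balanced_linear_cycles:
  assumes r: "r \<ge> 4" and l: "l \<ge> 2"
  shows "\<exists>(\<kappa> :: real) (C1 :: real) (K1 :: real) (T :: real). 0 < \<kappa> \<and> 1 \<le> C1 \<and> 1 \<le> K1 \<and> 0 < T \<and>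
    (\<forall>(V :: 'a set) E (n :: nat) (t :: real). finite V \<and> card V = n \<and> n \<ge> 2 \<and> t \<ge> T \<and>
       (\<forall>e\<in>E. e \<subseteq> V \<and> card e = r) \<and> real (card E) = t * real n ^ (r - 1) \<longrightarrow>
     (\<exists>E4 w. E4 \<subseteq> E \<and> \<kappa> * card E \<le> card E4 * (ln (real n))\<^sup>2 \<and>
        codeg_bounded E4 (2 * l) K1 (C1 * real n powr (2 * real l / (2 * real l - 1)) / card E4) w \<and>
        (\<forall>Z F. w Z \<noteq> 0 \<and> Z \<subseteq> edges F \<and> (\<forall>e\<in>Z. e \<subseteq> verts F) \<longrightarrow> contains_copy F (linear_cycle r (2 * l)))))"
proof -
  obtain c0 C0 K0 :: real where c0: "c0 > 0" and C0: "C0 \<ge> 1" and K0: "K0 \<ge> 1" and bal: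
    "\<forall>(U :: ('a \<times> nat) set) W E (\<pi> :: 'a \<times> nat \<Rightarrow> 'a) (a :: real) (b :: real) (p :: real).
     finite U \<and> finite W \<and> U \<inter> W = {} \<and> (\<forall>e\<in>E. \<exists>u\<in>U. \<exists>w\<in>W. e = {u, w}) \<and>
     inj_on ((`) \<pi>) E \<and> 0 < a \<and> a \<le> b \<and> real (card U) \<le> 2 * a \<and> real (card W) \<le> 2 * b \<and>
     (\<forall>u\<in>U. real (card {e \<in> E. u \<in> e}) \<le> 2 * card E / a) \<and>
     (\<forall>w\<in>W. real (card {e \<in> E. w \<in> e}) \<le> 2 * card E / b) \<and>
     real (card E) \<le> a * b \<and> 0 < p \<and> p \<le> 1 \<and> C0 * a * b ^ l \<le> p ^ (l - 1) * real (card E) ^ l \<longrightarrow>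
     (\<exists>\<C>. \<C> \<subseteq> {c. is_cycle \<pi> (2 * l) E c} \<and>
        c0 * ((real (card E))\<^sup>2 / (a * b)) ^ l \<le> card \<C> \<and>
        (\<forall>\<sigma>. \<sigma> \<subseteq> E \<and> \<sigma> \<noteq> {} \<and> card \<sigma> < 2 * l \<longrightarrow>
            real (card {c \<in> \<C>. \<sigma> \<subseteq> c}) \<le> K0 * p ^ (card \<sigma> - 1) * card \<C> / card E))"
    using balanced_cycles[OF l, where ?'v = "'a \<times> nat" and ?'a = 'a] by (elim exE conjE) (rule that; assumption)
  have r3: "r \<ge> 3" using r by simp
  obtain \<kappa> :: real where \<kappa>: "\<kappa> > 0" and reg:
    "\<forall>(V :: 'a set) E (n :: nat) (t :: real). finite V \<and> card V = n \<and> n \<ge> 2 \<and> t > 0 \<and>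
      (\<forall>e\<in>E. e \<subseteq> V \<and> card e = r) \<and> real (card E) = t * real n ^ (r - 1) \<longrightarrow>
    (\<exists>E4 A B \<phi> (D :: real) (s :: real) (i :: nat). E4 \<subseteq> E \<and> A \<subseteq> V \<and> B \<subseteq> V \<and> A \<inter> B = {} \<and> A \<noteq> {} \<and>
       (\<forall>e\<in>E4. \<exists>x\<in>A. \<exists>y\<in>B. \<phi> e = {x, y} \<and> {x, y} \<subseteq> e) \<and>
       (\<forall>f\<in>\<phi> ` E4. D / 2 \<le> real (card {e \<in> E4. \<phi> e = f}) \<and> real (card {e \<in> E4. \<phi> e = f}) \<le> D) \<and>
       \<kappa> * card E \<le> card E4 * (ln (real n))\<^sup>2 \<and>
       \<kappa> * card A * s \<le> card (\<phi> ` E4) \<and> 0 < s \<and> s ^ (r - 1) = real n ^ (r - 1) / 2 ^ i \<and>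
       \<kappa> * t * (8/5) ^ i \<le> card A \<and> \<kappa> * t * real n ^ (r - 2) \<le> s ^ (r - 1) \<and>
       \<kappa> * t * real n ^ (r - 3) \<le> D)"
    using regularise[OF r3, where ?'a = 'a] by (elim exE conjE) (rule that; assumption)
  define C1 where "C1 = max 1 (C0 / \<kappa>)"
  \<comment> \<open>The first term is for fewer than \<open>2 * l\<close> edges, where expanding
    costs a factor \<open>4\<close> per edge; the second is for a full cycle, where the number of
    cycles enters through \<open>c0\<close>.\<close>
  define K1 where "K1 = max (K0 * 4 ^ (2 * l)) (4 ^ (2 * l) / c0)"
  \<comment> \<open>The three thresholds make \<open>\<kappa> * t\<close> at least 1, meet the
    condition on \<open>C0\<close> in \<open>density_estimate\<close>, and make codegrees large
    enough for the greedy expansion.\<close>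
  define T where "T = max (max (1 / \<kappa>) (C0 / \<kappa> ^ (l + 1))) (4 * (real (2 * l) + real (2 * l) * real r) / \<kappa>)"
  have C1: "C1 \<ge> 1" by (simp add: C1_def)
  have K1: "K1 \<ge> 1" "K0 * 4 ^ (2 * l) \<le> K1" "4 ^ (2 * l) / c0 \<le> K1"
  proof -
    have "1 * 1 \<le> K0 * 4 ^ (2 * l)" using K0 by (intro mult_mono one_le_power) auto
    then show "K1 \<ge> 1" "K0 * 4 ^ (2 * l) \<le> K1" "4 ^ (2 * l) / c0 \<le> K1" by (auto simp: K1_def)
  qed
  have T: "0 < T" "1 / \<kappa> \<le> T" "C0 / \<kappa> ^ (l + 1) \<le> T" "4 * (real (2 * l) + real (2 * l) * real r) / \<kappa> \<le> T"
  proof -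
    have "0 < 1 / \<kappa>" using \<kappa> by simp
    also show "1 / \<kappa> \<le> T" by (simp add: T_def)
    finally show "0 < T" .
  qed (auto simp: T_def)
  have main: "\<exists>E4 w. E4 \<subseteq> E \<and> \<kappa> * card E \<le> card E4 * (ln (real n))\<^sup>2 \<and>
        codeg_bounded E4 (2 * l) K1 (C1 * real n powr (2 * real l / (2 * real l - 1)) / card E4) w \<and>
        (\<forall>Z F. w Z \<noteq> 0 \<and> Z \<subseteq> edges F \<and> (\<forall>e\<in>Z. e \<subseteq> verts F) \<longrightarrow> contains_copy F (linear_cycle r (2 * l)))"
    if V: "finite V" "card V = n" and n: "n \<ge> 2" and tT: "t \<ge> T"
      and E: "\<forall>e\<in>E. e \<subseteq> V \<and> card e = r" and cE: "real (card E) = t * real n ^ (r - 1)"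
    for V :: "'a set" and E and n :: nat and t :: real
  proof -
    have t0: "t > 0" using tT T by linarith
    have t1: "1 \<le> \<kappa> * t"
    proof -
      have "1 / \<kappa> \<le> t" using tT T by linarith
      then show ?thesis using \<kappa> by (simp add: pos_divide_le_eq mult.commute)
    qed
    have t2: "C0 \<le> \<kappa> ^ l * (\<kappa> * t)"
    proof -
      have "C0 / \<kappa> ^ (l + 1) \<le> t" using tT T by linarith
      then have "C0 \<le> t * \<kappa> ^ (l + 1)" using \<kappa> by (simp add: pos_divide_le_eq)
      then show ?thesis by (simp add: mult_ac)
    qed
    have t3: "4 * (real (2 * l) + real (2 * l) * real r) \<le> \<kappa> * t"
    proof -
      have "4 * (real (2 * l) + real (2 * l) * real r) / \<kappa> \<le> t" using tT T by linarith
      then show ?thesis using \<kappa> by (simp add: pos_divide_le_eq mult.commute)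
    qed
    obtain E4 A B \<phi> and D s :: real and i :: nat where
      E4E: "E4 \<subseteq> E" and AB: "A \<subseteq> V" "B \<subseteq> V" "A \<inter> B = {}" "A \<noteq> {}"
      and \<phi>: "\<forall>e\<in>E4. \<exists>x\<in>A. \<exists>y\<in>B. \<phi> e = {x, y} \<and> {x, y} \<subseteq> e"
      and fib: "\<forall>f\<in>\<phi> ` E4. D / 2 \<le> real (card {e \<in> E4. \<phi> e = f}) \<and> real (card {e \<in> E4. \<phi> e = f}) \<le> D"
      and cov: "\<kappa> * card E \<le> card E4 * (ln (real n))\<^sup>2"
      and Ns: "\<kappa> * card A * s \<le> card (\<phi> ` E4)" and s: "0 < s" "s ^ (r - 1) = real n ^ (r - 1) / 2 ^ i"
      and aA: "\<kappa> * t * (8/5) ^ i \<le> card A" and sl: "\<kappa> * t * real n ^ (r - 2) \<le> s ^ (r - 1)"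
      and Dl: "\<kappa> * t * real n ^ (r - 3) \<le> D"
      using reg[rule_format, of V n t E] V n t0 E cE by blast
    have fV: "finite A" "finite B" "finite E4"
    proof -
      show "finite A" "finite B" using AB V by (auto intro: finite_subset)
      show "finite E4" by (rule finite_subset[of _ "Pow V"]) (use E4E E V in auto)
    qed
    define a where "a = real (card A)"
    define G where "G = \<phi> ` E4"
    define N where "N = real (card G)"
    define v where "v = real (card E4)"
    have npos: "0 < real n" "1 \<le> real n" using n by auto
    have a: "0 < a" "a \<le> real n"
    proof -
      show "0 < a" using AB fV by (simp add: a_def card_gt_0_iff)
      show "a \<le> real n" using card_mono[OF V(1) AB(1)] V by (simp add: a_def)
    qed
    have dens: "C0 * a * real n ^ l \<le> N ^ l"
      by (rule density_estimate[OF r l \<kappa> npos(1) s _ _ t1 t2]) (use aA Ns in \<open>auto simp: a_def N_def G_def\<close>)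
    have Nn: "real n \<le> N"
    proof -
      have "1 * 1 * real n ^ l \<le> C0 * a * real n ^ l"
        using C0 AB fV npos by (intro mult_mono) (auto simp: a_def card_gt_0_iff Suc_leI)
      then have "real n ^ l \<le> N ^ l" using dens by linarith
      then show ?thesis by (subst (asm) power_mono_iff) (use l in \<open>auto simp: N_def\<close>)
    qed
    have N: "N > 0" using Nn npos by linarith
    have Nan: "N \<le> a * real n"
    proof -
      have "G \<subseteq> (\<lambda>(x, y). {x, y}) ` (A \<times> B)" using \<phi> by (fastforce simp: G_def)
      then have "card G \<le> card (A \<times> B)"
        using fV by (meson card_image_le card_mono finite_SigmaI finite_imageI order_trans)
      also have "\<dots> \<le> card A * n" using card_mono[OF V(1) AB(2)] V by (simp add: card_cartesian_product)
      finally show ?thesis unfolding N_def a_def by (metis of_nat_le_iff of_nat_mult)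
    qed
    \<comment> \<open>The smallest value of \<open>p ^ (l - 1)\<close> that
      \<open>balanced_cycles\<close> permits; a smaller rate means stronger codegree bounds.\<close>
    define P where "P = C0 * a * real n ^ l / N ^ l"
    have P: "0 < P" "P \<le> 1" using C0 a npos N dens by (auto simp: P_def)
    define p where "p = root (l - 1) P"
    have l1: "0 < l - 1" using l by simp
    have p: "0 < p" "p ^ (l - 1) = P" "p \<le> 1"
      using P l1 by (auto simp: p_def real_root_pow_pos)
    define b0 where "b0 = real n powr (2 * real l / (2 * real l - 1))"
    have pN: "p * N \<le> C1 * b0"
      unfolding C1_def b0_def
      by (rule sampling_rate_estimate[OF r l \<kappa> npos(2) s a(1) _ t1 C0 sl p(1)])
        (use Ns p P_def in \<open>auto simp: a_def N_def G_def\<close>)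
    have GAB: "\<forall>f\<in>G. \<exists>x\<in>A. \<exists>y\<in>B. f = {x, y}"
    proof
      fix f assume f: "f \<in> G"
      obtain e where "e \<in> E4" "f = \<phi> e" using f by (auto simp: G_def)
      then show "\<exists>x\<in>A. \<exists>y\<in>B. f = {x, y}" using \<phi>[rule_format, of e] by blast
    qed
    have cB: "real (card B) \<le> real n" using card_mono[OF V(1) AB(2)] V by simp
    have aG: "real (card A) \<le> a" "a \<le> card G" "real n \<le> card G" using a Nn by (auto simp: a_def N_def)
    obtain cl :: "'a set \<Rightarrow> ('a \<times> nat) set" and U W where
      cl': "\<forall>f. fst ` cl f = f" and UW: "finite U" "finite W" "U \<inter> W = {}"
      "\<forall>f\<in>G. \<exists>u\<in>U. \<exists>w\<in>W. cl f = {u, w}" "card U \<le> 2 * a" "card W \<le> 2 * real n"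
      and dU: "\<forall>u\<in>U. card {e \<in> cl ` G. u \<in> e} \<le> 2 * card G / a"
      and dW: "\<forall>w\<in>W. card {e \<in> cl ` G. w \<in> e} \<le> 2 * card G / real n"
      using clone_graph[OF fV(1,2) AB(3) GAB a(1) aG(1,2) npos(1) cB aG(3)] by (elim exE conjE) (rule that; assumption)
    have cl: "fst ` cl f = f" for f using cl' by blast
    have clinj: "inj_on cl G" by (rule inj_on_inverseI[of _ "(`) fst"]) (rule cl)
    have ccl: "card (cl ` G) = card G" by (rule card_image[OF clinj])
    have "inj_on ((`) fst) (cl ` G)" by (rule inj_on_inverseI[of _ cl]) (auto simp: cl)
    moreover have "C0 * a * real n ^ l \<le> p ^ (l - 1) * real (card (cl ` G)) ^ l"
      unfolding p(2) P_def ccl N_def[symmetric] using N by simp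
    ultimately obtain \<C> where \<C>: "\<C> \<subseteq> {c. is_cycle fst (2 * l) (cl ` G) c}"
        "c0 * (N\<^sup>2 / (a * real n)) ^ l \<le> card \<C>"
      and \<C>deg: "\<And>\<sigma>. \<sigma> \<subseteq> cl ` G \<Longrightarrow> \<sigma> \<noteq> {} \<Longrightarrow> card \<sigma> < 2 * l \<Longrightarrow>
            real (card {c \<in> \<C>. \<sigma> \<subseteq> c}) \<le> K0 * p ^ (card \<sigma> - 1) * card \<C> / N"
      using bal[rule_format, of U W "cl ` G" fst a "real n" p] UW dU dW a Nan p(1,3) unfolding ccl N_def by auto
    define \<psi> where "\<psi> e = cl (\<phi> e)" for e
    have \<psi>G: "\<psi> ` E4 = cl ` G" by (auto simp: \<psi>_def G_def)
    have E4: "e \<subseteq> V \<and> card e = r" if "e \<in> E4" for e using E E4E that by blast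
    have \<psi>e: "fst ` \<psi> e \<subseteq> e" if "e \<in> E4" for e using \<phi> that by (auto simp: \<psi>_def cl)
    have \<psi>fib: "D / 2 \<le> real (card {e \<in> E4. \<psi> e = f}) \<and> real (card {e \<in> E4. \<psi> e = f}) \<le> D" if f: "f \<in> \<psi> ` E4" for f
    proof -
      obtain f' where f': "f' \<in> \<phi> ` E4" "f = cl f'" using f by (auto simp: \<psi>_def)
      have "\<psi> e = f \<longleftrightarrow> \<phi> e = f'" for e unfolding \<psi>_def f'(2) using cl by metis
      then show ?thesis using bspec[OF fib f'(1)] by simp
    qed
    have Dk: "(real (2 * l) + real (2 * l) * real r) * real n ^ (r - 3) \<le> D / 4"
    proof -
      have "4 * (real (2 * l) + real (2 * l) * real r) * real n ^ (r - 3) \<le> \<kappa> * t * real n ^ (r - 3)"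
        using t3 by (intro mult_right_mono) auto
      then show ?thesis using Dl by linarith
    qed
    have D: "D > 0"
    proof -
      have "0 < \<kappa> * t * real n ^ (r - 3)" using \<kappa> t0 npos by simp
      then show ?thesis using Dl by linarith
    qed
    define bd where "bd j = K0 * p ^ (j - 1) * card \<C> / N" for j :: nat
    have bd: "0 \<le> bd j" for j using K0 p N by (simp add: bd_def)
    obtain S where SE: "\<And>Z. Z \<in> S \<Longrightarrow> Z \<subseteq> E4 \<and> card Z = 2 * l"
      and Scopy: "\<And>Z F. Z \<in> S \<Longrightarrow> Z \<subseteq> edges F \<Longrightarrow> (\<And>e. e \<in> Z \<Longrightarrow> e \<subseteq> verts F) \<Longrightarrow> contains_copy F (linear_cycle r (2 * l))"
      and Sc: "card \<C> * (D / 4) ^ (2 * l) \<le> card S"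
      and Sdeg: "\<And>\<sigma>. \<sigma> \<subseteq> E4 \<Longrightarrow> \<sigma> \<noteq> {} \<Longrightarrow> card \<sigma> < 2 * l \<Longrightarrow> card {Z \<in> S. \<sigma> \<subseteq> Z} \<le> bd (card \<sigma>) * D ^ (2 * l - card \<sigma>)"
    proof (rule expand_cycles[OF V r3 l E4 \<psi>e \<psi>fib Dk, of \<C> bd])
      show "\<C> \<subseteq> {c. is_cycle fst (2 * l) (\<psi> ` E4) c}" unfolding \<psi>G by (rule \<C>(1))
      show "real (card {c \<in> \<C>. \<sigma> \<subseteq> c}) \<le> bd (card \<sigma>)" if "\<sigma> \<subseteq> \<psi> ` E4" "\<sigma> \<noteq> {}" "card \<sigma> < 2 * l" for \<sigma>
        unfolding bd_def using that \<psi>G by (intro \<C>deg) auto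
    qed (use bd in auto)
    define w :: "'a set set \<Rightarrow> real" where "w Z = of_bool (Z \<in> S)" for Z
    define \<tau> where "\<tau> = C1 * b0 / v"
    have wd: "wdeg E4 w \<sigma> = card {Z \<in> S. \<sigma> \<subseteq> Z}" for \<sigma>
    proof -
      have "{e. e \<subseteq> E4 \<and> \<sigma> \<subseteq> e} \<inter> {Z. Z \<in> S} = {Z \<in> S. \<sigma> \<subseteq> Z}" using SE by auto
      then show ?thesis using fV by (simp add: wdeg_def w_def of_bool_def sum.If_cases)
    qed
    have vND: "v \<le> N * D"
      unfolding v_def N_def G_def using fib by (intro card_fibres(2)[OF fV(3), of \<phi> "D / 2" D]) auto
    have v: "v > 0"
    proof -
      have "G \<noteq> {}" using N by (auto simp: N_def)
      then show ?thesis using fV by (auto simp: v_def G_def card_gt_0_iff)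
    qed
    have CD: "card \<C> * D ^ (2 * l) \<le> 4 ^ (2 * l) * real (card S)"
      using Sc by (simp add: power_divide field_simps)
    \<comment> \<open>Since \<open>a \<le> n\<close>, the number of expanded cycles is at least a
      constant times \<open>(v / n) ^ (2 * l)\<close>.\<close>
    have Slow: "c0 * (v / real n) ^ (2 * l) \<le> 4 ^ (2 * l) * real (card S)"
    proof -
      have "c0 * (v / real n) ^ (2 * l) \<le> c0 * (N * D / real n) ^ (2 * l)"
        using vND c0 v npos by (intro mult_left_mono power_mono divide_right_mono) auto
      also have "\<dots> = c0 * ((N / real n)\<^sup>2) ^ l * D ^ (2 * l)"
        by (simp add: power_mult_distrib power_divide power_mult)
      also have "\<dots> \<le> c0 * (N\<^sup>2 / (a * real n)) ^ l * D ^ (2 * l)"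
      proof (intro mult_right_mono mult_left_mono power_mono)
        show "(N / real n)\<^sup>2 \<le> N\<^sup>2 / (a * real n)"
          unfolding power_divide using a npos by (intro divide_left_mono) (auto simp: power2_eq_square)
      qed (use c0 D in auto)
      also have "\<dots> \<le> card \<C> * D ^ (2 * l)" using \<C>(2) D by (intro mult_right_mono) auto
      also note CD
      finally show ?thesis .
    qed
    have Spos: "0 < real (card S)"
    proof -
      have "0 < c0 * (v / real n) ^ (2 * l)" using c0 v npos by simp
      then have "0 < 4 ^ (2 * l) * real (card S)" using Slow by linarith
      then show ?thesis by (simp add: zero_less_mult_iff)
    qed
    have b0: "0 < b0" using npos by (simp add: b0_def)
    have \<tau>: "0 < \<tau>" using C1 b0 v by (simp add: \<tau>_def)
    have cb: "codeg_bounded E4 (2 * l) K1 \<tau> w"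
      unfolding codeg_bounded_def
    proof (intro conjI allI impI)
      show "0 \<le> w Z" for Z by (simp add: w_def)
      show "Z \<subseteq> E4" "card Z = 2 * l" if "w Z \<noteq> 0" for Z using that SE by (auto simp: w_def)
      show "0 < wdeg E4 w {}" using Spos by (simp add: wd)
      fix \<sigma> assume \<sigma>: "\<sigma> \<subseteq> E4 \<and> \<sigma> \<noteq> {}"
      have f\<sigma>: "finite \<sigma>" using \<sigma> fV finite_subset by blast
      define j where "j = card \<sigma>"
      have j: "j \<ge> 1" using \<sigma> f\<sigma> by (simp add: j_def card_gt_0_iff Suc_leI)
      have "real (card {Z \<in> S. \<sigma> \<subseteq> Z}) \<le> K1 * \<tau> ^ (j - 1) * card S / v"
      proof -
        consider "j < 2 * l" | "j = 2 * l" | "j > 2 * l" by linarith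
        then show ?thesis
        proof cases
          case 1
          \<comment> \<open>The factor left after splitting off
            \<open>card \<C> * D ^ (2 * l)\<close>, which \<open>CD\<close> compares with the size
            of \<open>S\<close>.\<close>
          define q where "q = K0 * p ^ (j - 1) / (N * D ^ j)"
          have q: "0 \<le> q" using K0 p N D by (simp add: q_def)
          have "real (card {Z \<in> S. \<sigma> \<subseteq> Z}) \<le> bd j * D ^ (2 * l - j)" using Sdeg[of \<sigma>] \<sigma> 1 by (simp add: j_def)
          also have "\<dots> = q * (card \<C> * D ^ (2 * l))"
          proof -
            have "D ^ (2 * l) = D ^ (2 * l - j) * D ^ j" using 1 by (simp flip: power_add)
            then show ?thesis using D by (simp add: bd_def q_def)
          qed
          also have "\<dots> \<le> q * (4 ^ (2 * l) * real (card S))" using CD q by (rule mult_left_mono)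
          also have "\<dots> = (K0 * 4 ^ (2 * l)) * ((p / D) ^ (j - 1) * card S / (N * D))"
          proof -
            have "D ^ j = D ^ (j - 1) * D" using j by (metis One_nat_def Suc_le_D diff_Suc_1 power_Suc2)
            then show ?thesis by (simp add: q_def power_divide mult_ac)
          qed
          also have "\<dots> \<le> K1 * (\<tau> ^ (j - 1) * card S / v)"
          proof (rule mult_mono[OF K1(2)])
            have "p / D = p * N / (N * D)" using N by simp
            also have "\<dots> \<le> C1 * b0 / v" using pN vND v C1 b0 by (intro frac_le) auto
            finally have "(p / D) ^ (j - 1) \<le> \<tau> ^ (j - 1)" using p D by (intro power_mono) (auto simp: \<tau>_def)
            then show "(p / D) ^ (j - 1) * card S / (N * D) \<le> \<tau> ^ (j - 1) * card S / v"
              using vND v \<tau> by (intro frac_le mult_right_mono mult_nonneg_nonneg) auto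
            show "0 \<le> (p / D) ^ (j - 1) * card S / (N * D)" using p D N by simp
          qed (use K1 in simp)
          finally show ?thesis by simp
        next
          case 2
          have "{Z \<in> S. \<sigma> \<subseteq> Z} \<subseteq> {\<sigma>}"
          proof
            fix Z assume Z: "Z \<in> {Z \<in> S. \<sigma> \<subseteq> Z}"
            then have "card Z = card \<sigma>" "finite Z" using SE[of Z] 2 fV finite_subset by (auto simp: j_def)
            then show "Z \<in> {\<sigma>}" using Z card_subset_eq[of Z \<sigma>] by auto
          qed
          then have "card {Z \<in> S. \<sigma> \<subseteq> Z} \<le> card {\<sigma>}" by (intro card_mono) auto
          then have "real (card {Z \<in> S. \<sigma> \<subseteq> Z}) \<le> 1" by simp
          \<comment> \<open>The condition that fixes the exponent in \<open>b0\<close>: as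
            \<open>b0 ^ (2 * l - 1) = n ^ (2 * l)\<close>, the powers of \<open>n\<close> and
            \<open>v\<close> cancel against the lower bound \<open>Slow\<close>.\<close>
          also have "1 \<le> K1 * \<tau> ^ (j - 1) * card S / v"
          proof -
            have b0p: "b0 ^ (2 * l - 1) = real n ^ (2 * l)"
            proof -
              have "b0 ^ (2 * l - 1) = b0 powr real (2 * l - 1)" using b0 by (rule powr_realpow[symmetric])
              also have "\<dots> = real n powr (2 * real l / (2 * real l - 1) * real (2 * l - 1))" by (simp add: b0_def powr_powr)
              also have "2 * real l / (2 * real l - 1) * real (2 * l - 1) = real (2 * l)"
                using l by (simp add: of_nat_diff)
              also have "real n powr real (2 * l) = real n ^ (2 * l)" using npos(1) by (rule powr_realpow)
              finally show ?thesis .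
            qed
            have "real n ^ (2 * l) \<le> C1 ^ (2 * l - 1) * real n ^ (2 * l)"
              using one_le_power[OF C1, of "2 * l - 1"] npos by simp
            then have "real n ^ (2 * l) / v ^ (2 * l - 1) \<le> \<tau> ^ (2 * l - 1)"
              unfolding \<tau>_def power_divide power_mult_distrib b0p using v by (intro divide_right_mono) auto
            moreover have "c0 * (v / real n) ^ (2 * l) / 4 ^ (2 * l) \<le> card S"
              using Slow by (simp add: pos_divide_le_eq mult.commute)
            ultimately have "(4 ^ (2 * l) / c0) * (real n ^ (2 * l) / v ^ (2 * l - 1)) * (c0 * (v / real n) ^ (2 * l) / 4 ^ (2 * l)) / v
                \<le> K1 * \<tau> ^ (2 * l - 1) * card S / v"
              using K1 v c0 npos \<tau> by (intro divide_right_mono mult_mono) auto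
            moreover have "(4 ^ (2 * l) / c0) * (real n ^ (2 * l) / v ^ (2 * l - 1)) * (c0 * (v / real n) ^ (2 * l) / 4 ^ (2 * l)) / v = 1"
            proof -
              have "v ^ (2 * l) = v ^ (2 * l - 1) * v" using l by (simp flip: power_Suc2)
              then show ?thesis using c0 npos v by (simp add: power_divide)
            qed
            ultimately have "1 \<le> K1 * \<tau> ^ (2 * l - 1) * card S / v" by (simp only:)
            then show ?thesis by (simp only: 2)
          qed
          finally show ?thesis .
        next
          case 3
          have "{Z \<in> S. \<sigma> \<subseteq> Z} = {}"
          proof -
            have "\<not> \<sigma> \<subseteq> Z" if "Z \<in> S" for Z
            proof
              assume "\<sigma> \<subseteq> Z"
              moreover have "finite Z" "card Z = 2 * l" using SE[OF that] fV finite_subset by auto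
              ultimately show False using card_mono[of Z \<sigma>] 3 by (simp add: j_def)
            qed
            then show ?thesis by blast
          qed
          then show ?thesis using K1 \<tau> v by (simp only:) simp
        qed
      qed
      then show "wdeg E4 w \<sigma> \<le> K1 * \<tau> ^ (card \<sigma> - 1) * wdeg E4 w {} / real (card E4)"
        by (simp add: wd j_def v_def)
    qed
    show ?thesis
    proof (intro exI[of _ E4] exI[of _ w] conjI allI impI)
      show "codeg_bounded E4 (2 * l) K1 (C1 * real n powr (2 * real l / (2 * real l - 1)) / card E4) w"
        using cb unfolding \<tau>_def b0_def v_def .
      show "contains_copy F (linear_cycle r (2 * l))"
        if "w Z \<noteq> 0 \<and> Z \<subseteq> edges F \<and> (\<forall>e\<in>Z. e \<subseteq> verts F)" for Z F
        using that by (intro Scopy[of Z F]) (auto simp: w_def)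
    qed (use E4E cov in auto)
  qed
  show ?thesis
    by (rule exI[of _ \<kappa>], rule exI[of _ C1], rule exI[of _ K1], rule exI[of _ T],
        rule conjI[OF \<kappa>], rule conjI[OF C1], rule conjI[OF K1(1)], rule conjI[OF T(1)],
        intro allI impI, elim conjE) (rule main)
qed

section \<open>The container theorem for linear cycles\<close>

theorem theorem3p3:
  fixes r l :: nat
  assumes "r \<ge> 4" and "l \<ge> 2"
  shows "\<exists>K \<epsilon> :: real. K > 0 \<and> \<epsilon> > 0 \<and>
    (\<exists>N::nat. \<forall>n\<ge>N. \<forall>t\<ge>K. \<forall>H :: 'a hypergraph.
      rgraph r H \<and> card (verts H) = n \<and> real (num_edges H) = t * real n ^ (r - 1) \<longrightarrow>
      (\<exists>C :: 'a hypergraph set.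
         finite C \<and>
         real (card C) \<le> exp (ln (real n) ^ (r - 1) * real n powr (2 * real l / (2 * real l - 1)) / \<epsilon>) \<and>
         (\<forall>G\<in>C. subgraph G H) \<and>
         (\<forall>F. subgraph F H \<and> linear_cycle_free r (2 * l) F \<longrightarrow> (\<exists>G\<in>C. subgraph F G)) \<and>
         (\<forall>G\<in>C. real (num_edges G) \<le> (1 - \<epsilon> / ln (real n) ^ (r - 2)) * t * real n ^ (r - 1))))"
proof -
  note r = assms(1) and l = assms(2)
  obtain \<kappa> C1 K1 T :: real where \<kappa>: "0 < \<kappa>" and C1: "1 \<le> C1" and K1: "1 \<le> K1" and T: "0 < T" and blc:
    "\<forall>(V :: 'a set) E (n :: nat) (t :: real). finite V \<and> card V = n \<and> n \<ge> 2 \<and> t \<ge> T \<and>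
       (\<forall>e\<in>E. e \<subseteq> V \<and> card e = r) \<and> real (card E) = t * real n ^ (r - 1) \<longrightarrow>
     (\<exists>E4 w. E4 \<subseteq> E \<and> \<kappa> * card E \<le> card E4 * (ln (real n))\<^sup>2 \<and>
        codeg_bounded E4 (2 * l) K1 (C1 * real n powr (2 * real l / (2 * real l - 1)) / card E4) w \<and>
        (\<forall>Z F. w Z \<noteq> 0 \<and> Z \<subseteq> edges F \<and> (\<forall>e\<in>Z. e \<subseteq> verts F) \<longrightarrow> contains_copy F (linear_cycle r (2 * l))))"
    using balanced_linear_cycles[OF r l, where ?'a = 'a] by (elim exE conjE) (rule that; assumption)
  have l1: "1 \<le> 2 * l" using l by simp
  obtain \<delta> :: real where \<delta>: "0 < \<delta>" and cont: "\<forall>(X :: 'a set set) \<tau> w Q. finite X \<and> 0 < \<tau> \<and> \<tau> \<le> 1 \<and>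
       codeg_bounded X (2 * l) K1 \<tau> w \<and> \<tau> * card X \<le> real Q \<longrightarrow>
       (\<exists>F. container_family X w \<delta> F \<and> card F \<le> (card X + 1) ^ (Q * (2 * l - 1)))"
    using container_lemma[OF l1 K1, where ?'a = "'a set"] by (elim exE conjE) (rule that; assumption)
  define K where "K = max T 1"
  \<comment> \<open>The product of the bounds in the exponent: \<open>Q \<le> 2 * C1 * b0\<close>,
    the factor \<open>2 * l - 1\<close> of the container lemma, and \<open>r + 1\<close> from
    \<open>card E4 + 1 \<le> n ^ (r + 1)\<close>.\<close>
  define M where "M = 2 * C1 * (2 * real l) * (real r + 1)"
  define \<epsilon> where "\<epsilon> = min (\<delta> * \<kappa>) (1 / M)"
  have M: "M > 0" using C1 l by (simp add: M_def)
  have \<epsilon>: "\<epsilon> > 0" "\<epsilon> \<le> \<delta> * \<kappa>" "\<epsilon> \<le> 1 / M" using \<delta> \<kappa> M by (auto simp: \<epsilon>_def)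
  \<comment> \<open>Makes \<tau> at most 1. From \<open>ln n \<le> 4 * n powr (1/4)\<close> the
    squared logarithm is at most 16 times the square root of \<open>n\<close>, and this root is at
    least \<open>16 * C1 / \<kappa>\<close>. The summand 3 gives
    \<open>ln n \<ge> 1\<close>.\<close>
  define N where "N = nat \<lceil>(16 * C1 / \<kappa>)\<^sup>2\<rceil> + 3"
  have main: "\<exists>C :: 'a hypergraph set. finite C \<and>
         real (card C) \<le> exp (ln (real n) ^ (r - 1) * real n powr (2 * real l / (2 * real l - 1)) / \<epsilon>) \<and>
         (\<forall>G\<in>C. subgraph G H) \<and>
         (\<forall>F. subgraph F H \<and> linear_cycle_free r (2 * l) F \<longrightarrow> (\<exists>G\<in>C. subgraph F G)) \<and>
         (\<forall>G\<in>C. real (num_edges G) \<le> (1 - \<epsilon> / ln (real n) ^ (r - 2)) * t * real n ^ (r - 1))"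
    if nN: "n \<ge> N" and tK: "t \<ge> K" and H: "rgraph r H" "card (verts H) = n"
      and cE: "real (num_edges H) = t * real n ^ (r - 1)"
    for n :: nat and t :: real and H :: "'a hypergraph"
  proof -
    define V where "V = verts H"
    define E where "E = edges H"
    define b0 where "b0 = real n powr (2 * real l / (2 * real l - 1))"
    have n3: "n \<ge> 3" using nN by (simp add: N_def)
    have nbig: "(16 * C1 / \<kappa>)\<^sup>2 \<le> real n" using nN unfolding N_def by linarith
    have npos: "1 \<le> real n" using n3 by simp
    have V: "finite V" "card V = n" "\<forall>e\<in>E. e \<subseteq> V \<and> card e = r"
      using H by (auto simp: rgraph_def V_def E_def)
    have cE': "real (card E) = t * real n ^ (r - 1)" using cE by (simp add: num_edges_def E_def)
    have fE: "finite E" by (rule finite_subset[of _ "Pow V"]) (use V in auto)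
    have t: "t \<ge> T" "t \<ge> 1" using tK by (auto simp: K_def)
    define L where "L = ln (real n)"
    have L: "1 \<le> L"
    proof -
      have "exp 1 \<le> real n" using exp_le n3 by (meson numeral_le_real_of_nat_iff order_trans)
      then show ?thesis unfolding L_def using npos by (subst ln_ge_iff) auto
    qed
    have b0: "1 \<le> b0" unfolding b0_def using npos l by (intro ge_one_powr_ge_zero) auto
    have n2: "n \<ge> 2" using n3 by simp
    obtain E4 w where E4: "E4 \<subseteq> E" and cov: "\<kappa> * card E \<le> card E4 * L\<^sup>2"
      and cb: "codeg_bounded E4 (2 * l) K1 (C1 * b0 / card E4) w"
      and copy: "\<forall>Z F. w Z \<noteq> 0 \<and> Z \<subseteq> edges F \<and> (\<forall>e\<in>Z. e \<subseteq> verts F) \<longrightarrow> contains_copy F (linear_cycle r (2 * l))"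
      using blc[rule_format, of V n t E] V n2 t cE' unfolding L_def b0_def by blast
    define v where "v = real (card E4)"
    have fE4: "finite E4" using E4 fE by (rule finite_subset)
    have vlow: "\<kappa> * card E / L\<^sup>2 \<le> v" using cov L by (simp add: v_def pos_divide_le_eq)
    have vb: "C1 * b0 \<le> v"
    proof -
      define x where "x = real n powr (1/4)"
      have x: "0 < x" "x ^ 4 = real n"
      proof -
        show "0 < x" using npos by (simp add: x_def)
        then have "x ^ 4 = x powr real 4" by (rule powr_realpow[symmetric])
        also have "\<dots> = real n" using npos by (simp add: x_def powr_powr)
        finally show "x ^ 4 = real n" .
      qed
      have "L \<le> x / (1/4)" unfolding L_def x_def by (rule ln_powr_bound) (use npos in auto)
      then have L2: "L\<^sup>2 \<le> (4 * x)\<^sup>2" using L by (intro power_mono) auto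
      have "16 * C1 / \<kappa> \<le> x\<^sup>2"
      proof -
        have "(16 * C1 / \<kappa>)\<^sup>2 \<le> (x\<^sup>2)\<^sup>2" using nbig x by (simp flip: power_mult)
        then show ?thesis using C1 \<kappa> by (subst (asm) power_mono_iff) auto
      qed
      then have "16 * C1 \<le> \<kappa> * x\<^sup>2" using \<kappa> by (simp add: pos_divide_le_eq mult.commute)
      then have "16 * C1 * x\<^sup>2 \<le> \<kappa> * x\<^sup>2 * x\<^sup>2" by (rule mult_right_mono) simp
      also have "\<dots> = \<kappa> * real n" by (simp add: power2_eq_square power4_eq_xxxx flip: x(2))
      finally have "C1 * (4 * x)\<^sup>2 \<le> \<kappa> * real n" by (simp add: power_mult_distrib mult_ac)
      moreover have "C1 * L\<^sup>2 \<le> C1 * (4 * x)\<^sup>2" using L2 C1 by (intro mult_left_mono) auto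
      ultimately have "C1 * L\<^sup>2 \<le> \<kappa> * real n" by linarith
      then have 1: "C1 \<le> \<kappa> * real n / L\<^sup>2" using L by (simp add: pos_le_divide_eq)
      have b0n: "b0 \<le> real n ^ 2"
      proof -
        have "2 * real l / (2 * real l - 1) \<le> 2" using l by (simp add: pos_divide_le_eq)
        then have "b0 \<le> real n powr 2" unfolding b0_def using npos by (intro powr_mono) auto
        then show ?thesis using npos by simp
      qed
      have "C1 * b0 \<le> \<kappa> * real n / L\<^sup>2 * real n ^ 2"
        using 1 b0n C1 b0 by (intro mult_mono) auto
      also have "\<dots> = \<kappa> * (real n ^ 3) / L\<^sup>2" by (simp add: power2_eq_square power3_eq_cube)
      also have "\<dots> \<le> \<kappa> * card E / L\<^sup>2"
      proof (intro divide_right_mono mult_left_mono)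
        have "1 * real n ^ 3 \<le> t * real n ^ (r - 1)"
          using t npos r by (intro mult_mono power_increasing) auto
        then show "real n ^ 3 \<le> card E" by (simp add: cE')
      qed (use \<kappa> in auto)
      also note vlow
      finally show ?thesis .
    qed
    have v: "0 < v"
    proof -
      have "0 < C1 * b0" using C1 b0 by simp
      then show ?thesis using vb by linarith
    qed
    define Q where "Q = nat \<lceil>C1 * b0\<rceil>"
    have Q: "C1 * b0 \<le> real Q" "real Q \<le> 2 * C1 * b0"
    proof -
      have "1 * 1 \<le> C1 * b0" using C1 b0 by (intro mult_mono) auto
      then show "C1 * b0 \<le> real Q" "real Q \<le> 2 * C1 * b0" unfolding Q_def by linarith+
    qed
    obtain Fm where Fm: "container_family E4 w \<delta> Fm" "card Fm \<le> (card E4 + 1) ^ (Q * (2 * l - 1))"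
    proof -
      have "finite E4 \<and> 0 < C1 * b0 / card E4 \<and> C1 * b0 / card E4 \<le> 1 \<and>
        codeg_bounded E4 (2 * l) K1 (C1 * b0 / card E4) w \<and> C1 * b0 / card E4 * card E4 \<le> real Q"
        using fE4 cb v vb Q C1 b0 by (simp add: v_def)
      from cont[rule_format, OF this] show ?thesis using that by blast
    qed
    have fF: "finite Fm" and FE: "\<And>X. X \<in> Fm \<Longrightarrow> X \<subseteq> E4 \<and> real (card X) \<le> (1 - \<delta>) * card E4"
      and Fcov: "\<And>I. I \<subseteq> E4 \<Longrightarrow> (\<And>e. e \<subseteq> I \<Longrightarrow> w e = 0) \<Longrightarrow> \<exists>X\<in>Fm. I \<subseteq> X"
      using Fm(1) unfolding container_family_def by blast+
    \<comment> \<open>Only edges in \<open>E4\<close> are subject to the container lemma; each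
      container keeps all other edges of \<open>H\<close> and the whole vertex set.\<close>
    define C where "C = (\<lambda>X. (V, X \<union> (E - E4))) ` Fm"
    show ?thesis
    proof (intro exI[of _ C] conjI ballI allI impI)
      show "finite C" using fF by (simp add: C_def)
      show "real (card C) \<le> exp (ln (real n) ^ (r - 1) * real n powr (2 * real l / (2 * real l - 1)) / \<epsilon>)"
      proof -
        have vE: "real (card E4) + 1 \<le> real n ^ (r + 1)"
        proof -
          have "card E4 \<le> card {e. e \<subseteq> V \<and> card e = r \<and> {} \<subseteq> e}"
          proof (rule card_mono)
            show "finite {e. e \<subseteq> V \<and> card e = r \<and> {} \<subseteq> e}" by (rule finite_subset[of _ "Pow V"]) (use V in auto)
          qed (use E4 V in auto)
          also have "\<dots> \<le> card V ^ (r - card ({} :: 'a set))" using V by (intro card_supersets_le) auto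
          finally have "card E4 \<le> n ^ r" using V by simp
          moreover have "1 \<le> n ^ r" using n3 by simp
          ultimately have "card E4 + 1 \<le> 2 * n ^ r" by linarith
          also have "\<dots> \<le> n * n ^ r" using n3 by (intro mult_le_mono1) simp
          finally have "real (card E4 + 1) \<le> real (n ^ (r + 1))" by (intro of_nat_mono) simp
          then show ?thesis by simp
        qed
        have "real (card C) \<le> real ((card E4 + 1) ^ (Q * (2 * l - 1)))"
          using card_image_le[OF fF, of "\<lambda>X. (V, X \<union> (E - E4))"] Fm(2) unfolding C_def by (intro of_nat_mono) linarith
        also have "\<dots> = (real (card E4) + 1) ^ (Q * (2 * l - 1))" by (simp add: add.commute)
        also have "\<dots> \<le> (real n ^ (r + 1)) ^ (Q * (2 * l - 1))" using vE by (intro power_mono) auto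
        also have "\<dots> = exp (L * real ((r + 1) * (Q * (2 * l - 1))))"
        proof -
          have "exp (L * real ((r + 1) * (Q * (2 * l - 1)))) = exp L ^ ((r + 1) * (Q * (2 * l - 1)))"
            by (metis exp_of_nat_mult mult.commute)
          also have "exp L = real n" using npos by (simp add: L_def)
          finally show ?thesis by (simp only: power_mult)
        qed
        also have "\<dots> \<le> exp (L ^ (r - 1) * b0 / \<epsilon>)"
        proof -
          have "real ((r + 1) * (Q * (2 * l - 1))) \<le> (real r + 1) * ((2 * C1 * b0) * (2 * real l))"
            unfolding of_nat_mult using Q(2) l by (intro mult_mono) auto
          also have "\<dots> = M * b0" by (simp add: M_def)
          also have "\<dots> \<le> 1 / \<epsilon> * b0"
          proof (rule mult_right_mono)
            show "M \<le> 1 / \<epsilon>" using \<epsilon> M by (simp add: field_simps)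
          qed (use b0 in simp)
          \<comment> \<open>One logarithm comes from the base \<open>n ^ (r + 1)\<close>; as
            \<open>L \<ge> 1\<close>, it is at most \<open>L ^ (r - 1)\<close>.\<close>
          finally have "L * real ((r + 1) * (Q * (2 * l - 1))) \<le> L ^ (r - 1) * (1 / \<epsilon> * b0)"
            using L r b0 \<epsilon> by (intro mult_mono self_le_power) auto
          then show ?thesis by simp
        qed
        finally show ?thesis by (simp add: L_def b0_def)
      qed
    next
      fix G assume "G \<in> C"
      then obtain X where X: "X \<in> Fm" "G = (V, X \<union> (E - E4))" by (auto simp: C_def)
      show "subgraph G H" using X FE[OF X(1)] E4 V(3) by (auto simp: subgraph_def verts_def edges_def V_def E_def)
      show "real (num_edges G) \<le> (1 - \<epsilon> / ln (real n) ^ (r - 2)) * t * real n ^ (r - 1)"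
      proof -
        have "real (num_edges G) \<le> card X + card (E - E4)"
          using X card_Un_le[of X "E - E4"] by (simp add: num_edges_def edges_def)
        also have "\<dots> \<le> (1 - \<delta>) * v + (card E - v)"
          using FE[OF X(1)] fE4 E4 card_mono[OF fE E4] by (simp add: card_Diff_subset v_def of_nat_diff)
        also have "\<dots> = card E - \<delta> * v" by (simp add: algebra_simps)
        also have "\<dots> \<le> card E - \<epsilon> / L ^ (r - 2) * card E"
        proof -
          \<comment> \<open>The two dyadic steps cost \<open>L ^ 2\<close>, and
            \<open>r - 2 \<ge> 2\<close>.\<close>
          have "\<epsilon> / L ^ (r - 2) \<le> (\<delta> * \<kappa>) / L\<^sup>2"
            using \<epsilon> L r \<delta> \<kappa> by (intro frac_le power_increasing) auto
          then have "\<epsilon> / L ^ (r - 2) * card E \<le> (\<delta> * \<kappa>) / L\<^sup>2 * card E" by (intro mult_right_mono) auto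
          also have "\<dots> = \<delta> * (\<kappa> * card E / L\<^sup>2)" by simp
          also have "\<dots> \<le> \<delta> * v" using vlow \<delta> by (intro mult_left_mono) auto
          finally show ?thesis by simp
        qed
        also have "\<dots> = (1 - \<epsilon> / L ^ (r - 2)) * card E" by (simp add: left_diff_distrib)
        finally show ?thesis unfolding cE' L_def by (simp only: mult.assoc)
      qed
    next
      fix F assume F: "subgraph F H \<and> linear_cycle_free r (2 * l) F"
      have "\<exists>X\<in>Fm. edges F \<inter> E4 \<subseteq> X"
      proof (rule Fcov)
        fix Z assume Z: "Z \<subseteq> edges F \<inter> E4"
        show "w Z = 0"
        proof (rule ccontr)
          assume "w Z \<noteq> 0"
          moreover have "Z \<subseteq> edges F" "\<forall>e\<in>Z. e \<subseteq> verts F" using Z F by (auto simp: subgraph_def)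
          ultimately have "contains_copy F (linear_cycle r (2 * l))" using copy by blast
          then show False using F by (simp add: linear_cycle_free_def)
        qed
      qed simp
      then obtain X where X: "X \<in> Fm" "edges F \<inter> E4 \<subseteq> X" by blast
      have "edges F \<subseteq> E" "verts F \<subseteq> V" "\<forall>e\<in>edges F. e \<subseteq> verts F"
        using F by (auto simp: subgraph_def E_def V_def)
      then have "subgraph F (V, X \<union> (E - E4))" using X(2) by (auto simp: subgraph_def verts_def edges_def)
      then show "\<exists>G\<in>C. subgraph F G" using X(1) by (auto simp: C_def)
    qed
  qed
  have "K > 0" by (simp add: K_def)
  with \<epsilon>(1) main show ?thesis by (intro exI[of _ K] exI[of _ \<epsilon>] conjI exI[of _ N] allI impI) auto
qed

end
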